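(* Let $G$ be a non-compact, locally compact, $IN$-group and put $\kappa=\kappa(G)$. Then there is a linear isometry $\Psi\colon\ell_\infty(\kappa)\to\mathscr{WAP}(G)/\mathscr{B}(G)$.
   Context: All groups are Hausdorff, with identity $e$. A locally compact group $G$ is an $IN$-group if it has a compact invariant neighbourhood $U$ of $e$, i.e. $gUg^{-1}=U$ for all $g\in G$. The compact covering number $\kappa(G)$ is the smallest cardinal number of compact subsets of $G$ required to cover $G$. $\mathscr{CB}(G)$ is the algebra of bounded continuous complex-valued functions with the supremum norm. $\mathscr{WAP}(G)$ is the algebra of $f\in\mathscr{CB}(G)$ whose set of left translates $\{f_s:s\in G\}$, $f_s(t)=f(st)$, is relatively weakly compact in $\mathscr{CB}(G)$. The Fourier-Stieltjes algebra $B(G)$ is the linear span of the continuous positive definite functions on $G$, and the Eberlein algebra $\mathscr{B}(G)$ is the closure of $B(G)$ in the supremum norm; $\mathscr{B}(G)\subseteq\mathscr{WAP}(G)$. $\ell_\infty(\kappa)$ is the space of bounded complex functions on $\kappa$ with the supremum norm; quotients carry the quotient norm; a linear isometry need not be surjective. *)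

theory Defs
  imports "HOL-Analysis.Analysis"
begin

unbundle cardinal_syntax

unbundle bcontfun.lifting

text \<open>
  A topological group is a type of class \<^class>\<open>topological_group_add\<close>. This class does not
  assume commutativity: the group operation is merely written additively, so that
  \<open>st\<close> is \<open>s + t\<close>, \<open>e\<close> is \<open>0\<close>, and \<open>g x g\<^sup>-\<^sup>1\<close> is \<open>g + x - g\<close>.
\<close>

definition IN_group :: "'a::topological_group_add itself \<Rightarrow> bool" where
  "IN_group _ \<longleftrightarrow>
     (\<exists>U :: 'a set. compact U \<and> 0 \<in> interior U \<and> (\<forall>g. (\<lambda>x. g + x - g) ` U = U))"


section \<open>The compact covering number\<close>

definition compact_cover :: "'a::topological_space set set \<Rightarrow> bool" where
  "compact_cover \<K> \<longleftrightarrow> (\<forall>K\<in>\<K>. compact K) \<and> \<Union>\<K> = UNIV"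

definition least_compact_cover :: "'a::topological_space set set \<Rightarrow> bool" where
  "least_compact_cover \<K> \<longleftrightarrow>
     compact_cover \<K> \<and> (\<forall>\<L> :: 'a set set. compact_cover \<L> \<longrightarrow> |\<K>| \<le>o |\<L>| )"

text \<open>
  Cardinals are represented as in \<^theory>\<open>HOL.BNF_Cardinal_Order_Relation\<close>, by a well-order
  of minimal order type on its field. The choice below does not matter up to \<open>=o\<close>.
\<close>

definition compact_covering_number :: "'a::topological_space set rel" where
  "compact_covering_number = |SOME \<K>. least_compact_cover \<K>|"

lemma ex_least_compact_cover: "\<exists>\<K> :: 'a::topological_space set set. least_compact_cover \<K>"
proof -
  let ?R = "{|\<K>| | \<K> :: 'a set set. compact_cover \<K>}"
  have "compact_cover (range (\<lambda>x::'a. {x}))"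
    by (auto simp: compact_cover_def)
  then have "?R \<noteq> {}" by blast
  moreover have "\<forall>r\<in>?R. Well_order r" using card_of_Well_order by blast
  ultimately obtain r where "r \<in> ?R" "\<forall>r'\<in>?R. r \<le>o r'"
    using exists_minim_Well_order[of ?R] by blast
  then show ?thesis
    unfolding least_compact_cover_def by blast
qed


section \<open>Bounded functions on an index set\<close>

text \<open>Functions on \<open>I\<close> are encoded as functions on the whole type that vanish off \<open>I\<close>.\<close>

definition linf :: "'i set \<Rightarrow> ('i \<Rightarrow> complex) set" where
  "linf I = {x. (\<forall>i. i \<notin> I \<longrightarrow> x i = 0) \<and> bounded (x ` I)}"

definition linf_norm :: "'i set \<Rightarrow> ('i \<Rightarrow> complex) \<Rightarrow> real" where
  "linf_norm I x = (SUP i\<in>I. cmod (x i))"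


section \<open>Complex scalars on bounded continuous functions\<close>

lift_definition cscale :: "complex \<Rightarrow> ('a::topological_space \<Rightarrow>\<^sub>C complex) \<Rightarrow> ('a \<Rightarrow>\<^sub>C complex)"
  is "\<lambda>c f t. c * f t"
proof -
  fix c and f :: "'a \<Rightarrow> complex"
  assume f: "f \<in> bcontfun"
  have "continuous_on UNIV (\<lambda>t. c * f t)"
    using f by (auto simp: bcontfun_def intro!: continuous_intros)
  moreover have "bounded (range (\<lambda>t. c * f t))"
    using f bounded_linear_image[OF _ bounded_linear_mult_right[of c], of "range f"]
    by (simp add: bcontfun_def image_image)
  ultimately show "(\<lambda>t. c * f t) \<in> bcontfun" by (simp add: bcontfun_def)
qed

global_interpretation CB: vector_space "cscale :: complex \<Rightarrow> ('a::topological_space \<Rightarrow>\<^sub>C complex) \<Rightarrow> _"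
  by unfold_locales (transfer; simp add: algebra_simps)+

definition CB_functional :: "(('a::topological_space \<Rightarrow>\<^sub>C complex) \<Rightarrow> complex) \<Rightarrow> bool" where
  "CB_functional \<phi> \<longleftrightarrow>
     Vector_Spaces.linear cscale (*) \<phi> \<and> (\<exists>C. \<forall>f. cmod (\<phi> f) \<le> C * norm f)"

definition CB_weak_topology :: "('a::topological_space \<Rightarrow>\<^sub>C complex) topology" where
  "CB_weak_topology = topology_generated_by {\<phi> -` V | \<phi> V. CB_functional \<phi> \<and> open V}"


section \<open>Weakly almost periodic functions\<close>

lift_definition ltranslate ::
    "'a::topological_group_add \<Rightarrow> ('a \<Rightarrow>\<^sub>C complex) \<Rightarrow> ('a \<Rightarrow>\<^sub>C complex)"
  is "\<lambda>s f t. f (s + t)"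
proof -
  fix s :: 'a and f :: "'a \<Rightarrow> complex"
  assume f: "f \<in> bcontfun"
  have "continuous_on UNIV (\<lambda>t. s + t)"
    by (intro continuous_intros)
  then have "continuous_on UNIV (\<lambda>t. f (s + t))"
    using f continuous_on_compose2[of UNIV f UNIV "\<lambda>t. s + t"] by (simp add: bcontfun_def)
  moreover have "bounded (range (\<lambda>t. f (s + t)))"
    using f by (rule_tac bounded_subset[of "range f"]) (auto simp: bcontfun_def)
  ultimately show "(\<lambda>t. f (s + t)) \<in> bcontfun" by (simp add: bcontfun_def)
qed

definition WAP :: "('a::topological_group_add \<Rightarrow>\<^sub>C complex) set" where
  "WAP = {f. compactin CB_weak_topology
               (CB_weak_topology closure_of range (\<lambda>s. ltranslate s f))}"


section \<open>The Eberlein algebra\<close>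

definition positive_definite :: "('a::group_add \<Rightarrow> complex) \<Rightarrow> bool" where
  "positive_definite \<phi> \<longleftrightarrow>
     (\<forall>(n::nat) (s :: nat \<Rightarrow> 'a) (c :: nat \<Rightarrow> complex).
        (\<Sum>i<n. \<Sum>j<n. c i * cnj (c j) * \<phi> (- s j + s i)) \<in> \<real>\<^sub>\<ge>\<^sub>0)"

lemma positive_definite_bounded:
  assumes "positive_definite \<phi>"
  shows "cmod (\<phi> s) \<le> Re (\<phi> 0)"
proof -
  have two: "a * cnj a * \<phi> 0 + a * cnj b * \<phi> (- s) + (b * cnj a * \<phi> s + b * cnj b * \<phi> 0) \<in> \<real>\<^sub>\<ge>\<^sub>0"
    for a b
    using assms[unfolded positive_definite_def, rule_format,
        of "\<lambda>i. if i = 0 then a else b" "\<lambda>i. if i = 0 then 0 else s" 2]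
    by (simp add: numeral_2_eq_2 add.assoc)
  have "\<phi> 0 \<in> \<real>\<^sub>\<ge>\<^sub>0" using two[of 1 0] by simp
  then have im0: "Im (\<phi> 0) = 0" and re0: "Re (\<phi> 0) \<ge> 0"
    by (auto simp: complex_nonneg_Reals_iff)
  have "Im (\<phi> (- s)) = - Im (\<phi> s)"
    using two[of 1 1] im0 by (simp add: complex_nonneg_Reals_iff)
  moreover have "Re (\<phi> (- s)) = Re (\<phi> s)"
    using two[of 1 \<i>] im0 by (simp add: complex_nonneg_Reals_iff)
  ultimately have conj: "\<phi> (- s) = cnj (\<phi> s)"
    by (simp add: complex_eq_iff)
  show ?thesis
  proof (cases "\<phi> s = 0")
    case True
    then show ?thesis using re0 by simp
  next
    case False
    define a where "a = - sgn (\<phi> s)"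
    have a1: "a * cnj a = 1"
      using False by (simp add: a_def complex_norm_square[symmetric] norm_sgn)
    have "\<phi> s * cnj (\<phi> s) = complex_of_real ((cmod (\<phi> s))\<^sup>2)"
      by (rule complex_norm_square[symmetric])
    then have a2: "cnj a * \<phi> s = - complex_of_real (cmod (\<phi> s))"
      using False by (simp add: a_def sgn_eq field_simps power2_eq_square)
    have "a * cnj (\<phi> s) = cnj (cnj a * \<phi> s)" by simp
    also have "\<dots> = - complex_of_real (cmod (\<phi> s))" by (simp add: a2)
    finally have "\<phi> 0 - cmod (\<phi> s) + (- cmod (\<phi> s) + \<phi> 0) \<in> \<real>\<^sub>\<ge>\<^sub>0"
      using two[of a 1] a1 a2 conj by simp
    then show ?thesis by (simp add: complex_nonneg_Reals_iff)
  qed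
qed

text \<open>
  Restricting to members of \<^typ>\<open>'a \<Rightarrow>\<^sub>C complex\<close> in the next definition loses no continuous
  positive definite function, since all of them are bounded:
\<close>

lemma continuous_positive_definite_bcontfun:
  "continuous_on UNIV \<phi> \<Longrightarrow> positive_definite \<phi> \<Longrightarrow> \<phi> \<in> bcontfun"
  using bcontfun_normI positive_definite_bounded by blast

definition Fourier_Stieltjes :: "('a::topological_group_add \<Rightarrow>\<^sub>C complex) set" where
  "Fourier_Stieltjes = CB.span {f. positive_definite (apply_bcontfun f)}"

definition Eberlein :: "('a::topological_group_add \<Rightarrow>\<^sub>C complex) set" where
  "Eberlein = closure Fourier_Stieltjes"


section \<open>Quotients of spaces of bounded continuous functions\<close>

text \<open>
  The elements of \<open>V/W\<close> are the cosets \<open>f +o W\<close>. Their sum is the elementwise sum \<open>+\<close> of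
  \<^theory>\<open>HOL-Library.Set_Algebras\<close>. In a scalar multiple, \<open>W\<close> is added again because
  \<open>0\<close> times a coset has to be \<open>W\<close> and not \<open>{0}\<close>.
\<close>

definition CB_quotient ::
    "('a::topological_space \<Rightarrow>\<^sub>C complex) set \<Rightarrow> ('a \<Rightarrow>\<^sub>C complex) set \<Rightarrow> ('a \<Rightarrow>\<^sub>C complex) set set" where
  "CB_quotient V W = (\<lambda>f. f +o W) ` V"

definition coset_scale ::
    "('a::topological_space \<Rightarrow>\<^sub>C complex) set \<Rightarrow> complex \<Rightarrow> ('a \<Rightarrow>\<^sub>C complex) set \<Rightarrow> ('a \<Rightarrow>\<^sub>C complex) set" where
  "coset_scale W c A = cscale c ` A + W"

definition coset_norm :: "('a::topological_space \<Rightarrow>\<^sub>C complex) set \<Rightarrow> real" where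
  "coset_norm A = (INF f\<in>A. norm f)"

definition linear_isometry_linf_quotient ::
    "'i set \<Rightarrow> ('a::topological_space \<Rightarrow>\<^sub>C complex) set \<Rightarrow> ('a \<Rightarrow>\<^sub>C complex) set
      \<Rightarrow> (('i \<Rightarrow> complex) \<Rightarrow> ('a \<Rightarrow>\<^sub>C complex) set) \<Rightarrow> bool" where
  "linear_isometry_linf_quotient I V W \<Psi> \<longleftrightarrow>
     (\<forall>x\<in>linf I. \<Psi> x \<in> CB_quotient V W) \<and>
     (\<forall>x\<in>linf I. \<forall>y\<in>linf I. \<Psi> (\<lambda>i. x i + y i) = \<Psi> x + \<Psi> y) \<and>
     (\<forall>c. \<forall>x\<in>linf I. \<Psi> (\<lambda>i. c * x i) = coset_scale W c (\<Psi> x)) \<and>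
     (\<forall>x\<in>linf I. coset_norm (\<Psi> x) = linf_norm I x)"

end

theory Submission
  imports Defs "HOL-Library.Ramsey"
begin

text \<open>
  In multiplicative notation, the isometry sends a bounded family \<open>\<xi>\<close> to the coset of
  \<open>f = \<Sum>\<^sub>p c\<^sub>p h(p\<^sup>-\<^sup>1 \<cdot>)\<close>, a sum of translates of one bump function \<open>h\<close> over a very sparse
  set of points \<open>p\<close>. For every \<open>i < \<kappa>\<close> and every \<open>n\<close> there is a grid of \<open>n\<^sup>2\<close> points
  \<open>p = y\<^sub>l x\<^sub>k\<close>, on which \<open>c\<^sub>p\<close> is \<open>\<xi>\<^sub>i\<close> times the conjugate entry of the \<open>n \<times> n\<close> Fourier
  matrix. Clearly \<open>\<parallel>f\<parallel> \<le> \<parallel>\<xi>\<parallel>\<close>, and the proof rests on three facts.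

  \<^item> \<^emph>\<open>Distance.\<close> The Fourier matrix has unimodular entries, but its operator norm is only \<open>\<surd>n\<close>.
    Hence its pairing with the values \<open>\<phi>(y\<^sub>l x\<^sub>k)\<close> of a positive definite \<open>\<phi>\<close> is at most
    \<open>n\<^bsup>3/2\<^esup> \<phi>(e)\<close>, whereas its pairing with \<open>f\<close> is \<open>n\<^sup>2 \<xi>\<^sub>i\<close>. For large \<open>n\<close> this forces every
    element of \<open>f + Eberlein\<close> to have norm at least \<open>\<bar>\<xi>\<^sub>i\<bar>\<close> (\<open>norm_ge_of_fourier_values\<close>).

  \<^item> \<^emph>\<open>Weak almost periodicity.\<close> If \<open>f\<close> is uniformly continuous on both sides and its support \<open>E\<close>
    meets \<open>gE\<close> and \<open>Eg\<close> in relatively compact sets for all \<open>g\<close> outside a compact set, then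
    translates of \<open>f\<close> by elements tending to infinity are, up to one function supported on a
    compact set, almost disjoint. Sums of many of them stay bounded, so no functional can
    distinguish them from their pointwise limit (\<open>WAP_if_almost_disjoint_translates\<close>).

  \<^item> \<^emph>\<open>Sparse grids.\<close> The grids are chosen by transfinite recursion of length \<open>\<kappa>\<close>. The points
    chosen before a given stage are fewer than \<open>\<kappa>\<close>, so the translates of a compact set by
    words of bounded length in them do not cover the group, and new points can avoid all of
    these translates. The one difficulty is a quotient \<open>y x x'\<^sup>-\<^sup>1 y\<^sup>-\<^sup>1\<close>, a conjugate of an element
    \<open>x x'\<^sup>-\<^sup>1\<close> that is already fixed when \<open>y\<close> is chosen: it may lie among the old words for all
    \<open>y\<close>. A pigeonhole argument and Ramsey's theorem solve this (\<open>ex_generic_grid\<close>).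

  Uniform continuity of \<open>f\<close> from the left needs a bump function that is invariant under inner
  automorphisms. With a Haar measure one could take \<open>1\<^sub>U * 1\<^sub>U\<close> for a compact invariant
  neighbourhood \<open>U\<close>. The substitute used here is an upper content defined by covering numbers,
  which is invariant under conjugation for the simple reason that it is a limit superior
  (\<open>IN_group_central_bump\<close>).
\<close>

section \<open>Neighbourhoods and compact sets in a topological group\<close>

lemma compact_set_plus:
  fixes A B :: "'a::topological_group_add set"
  assumes "compact A" "compact B"
  shows "compact (A + B)"
proof -
  have "continuous_on (A \<times> B) (\<lambda>(x, y). x + y)"
    by (auto simp: split_beta intro!: continuous_intros)
  then show ?thesis
    unfolding set_plus_image using assms by (intro compact_continuous_image compact_Times)
qed

lemma compact_uminus_image:
  fixes A :: "'a::topological_group_add set"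
  shows "compact A \<Longrightarrow> compact (uminus ` A)"
  by (intro compact_continuous_image continuous_intros)

lemma open_uminus_image:
  fixes A :: "'a::topological_group_add set"
  assumes "open A"
  shows "open (uminus ` A)"
proof -
  have "uminus ` A = uminus -` A"
    by (force simp: image_iff intro: minus_minus[symmetric])
  then show ?thesis
    using assms by (auto intro!: open_vimage continuous_intros)
qed

lemma mem_translate_iff: "x \<in> {g} + A \<longleftrightarrow> - g + x \<in> A" for x :: "'a::group_add"
  by (force simp: set_plus_def add.assoc[symmetric])

lemma mem_conj_iff: "x \<in> (\<lambda>x. g + x - g) ` A \<longleftrightarrow> - g + x + g \<in> A" for x :: "'a::group_add"
proof
  assume "- g + x + g \<in> A"
  moreover have "x = g + (- g + x + g) - g"
    by (simp add: add.assoc diff_conv_add_uminus del: add_uminus_conv_diff)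
  ultimately show "x \<in> (\<lambda>x. g + x - g) ` A" by blast
qed (auto simp: add.assoc diff_conv_add_uminus simp del: add_uminus_conv_diff)

lemma set_plus3_elim:
  assumes "t \<in> A + B + C"
  obtains a b c where "t = a + b + c" "a \<in> A" "b \<in> B" "c \<in> C"
  using assms by (auto elim!: set_plus_elim)

lemma open_translate:
  fixes A :: "'a::topological_group_add set"
  assumes "open A"
  shows "open ({g} + A)"
proof -
  have "{g} + A = (\<lambda>x. - g + x) -` A"
    using mem_translate_iff by fastforce
  then show ?thesis
    using assms by (auto intro!: open_vimage continuous_intros)
qed

lemma open_conj_image:
  fixes A :: "'a::topological_group_add set"
  assumes "open A"
  shows "open ((\<lambda>x. g + x - g) ` A)"
proof -
  have "(\<lambda>x. g + x - g) ` A = (\<lambda>x. - g + x + g) -` A"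
    using mem_conj_iff by fastforce
  then show ?thesis
    using assms by (auto intro!: open_vimage continuous_intros)
qed

lemma compact_conj_image:
  fixes A :: "'a::topological_group_add set"
  shows "compact A \<Longrightarrow> compact ((\<lambda>x. g + x - g) ` A)"
  unfolding diff_conv_add_uminus by (intro compact_continuous_image continuous_intros)

lemma symmetric_nbhd:
  fixes N :: "'a::topological_group_add set"
  assumes "open N" "0 \<in> N"
  obtains O' where "open O'" "0 \<in> O'" "uminus ` O' = O'" "O' \<subseteq> N"
proof
  show "open (N \<inter> uminus ` N)" using assms by (intro open_Int open_uminus_image)
  show "0 \<in> N \<inter> uminus ` N" using assms by (auto simp: image_iff intro: bexI[of _ 0])
  show "uminus ` (N \<inter> uminus ` N) = N \<inter> uminus ` N" by force
qed auto

lemma two_sided_thickening: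
  fixes X :: "'a::topological_group_add set"
  assumes "compact X" "open D" "X \<subseteq> D"
  obtains O' where "open O'" "0 \<in> O'" "uminus ` O' = O'" "O' + X + O' \<subseteq> D"
proof -
  have "\<exists>N M. open N \<and> 0 \<in> N \<and> open M \<and> x \<in> M \<and> N + M + N \<subseteq> D" if "x \<in> X" for x
  proof -
    let ?f = "\<lambda>(a, y, b). a + y + b :: 'a"
    have "open (?f -` D)"
      using assms(2) by (auto simp: split_beta intro!: open_vimage continuous_intros)
    moreover have "(0, x, 0) \<in> ?f -` D" using that assms(3) by auto
    ultimately obtain N1 R where 1: "open N1" "open R" "(0, x, 0) \<in> N1 \<times> R" "N1 \<times> R \<subseteq> ?f -` D"
      by (rule open_prod_elim)
    then obtain M N2 where 2: "open M" "open N2" "(x, 0) \<in> M \<times> N2" "M \<times> N2 \<subseteq> R"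
      by (elim open_prod_elim[of R "(x, 0)"]) auto
    have "(N1 \<inter> N2) + M + (N1 \<inter> N2) \<subseteq> D"
    proof
      fix w assume "w \<in> (N1 \<inter> N2) + M + (N1 \<inter> N2)"
      then obtain a y b where "w = a + y + b" "a \<in> N1 \<inter> N2" "y \<in> M" "b \<in> N1 \<inter> N2"
        by (auto elim!: set_plus_elim)
      moreover from this have "(a, y, b) \<in> ?f -` D" using 1(4) 2(4) by blast
      ultimately show "w \<in> D" by simp
    qed
    then show ?thesis using 1 2 by (intro exI[of _ "N1 \<inter> N2"] exI[of _ M]) auto
  qed
  then obtain N M where NM: "\<And>x. x \<in> X \<Longrightarrow> open (N x)" "\<And>x. x \<in> X \<Longrightarrow> 0 \<in> N x"
    "\<And>x. x \<in> X \<Longrightarrow> open (M x)" "\<And>x. x \<in> X \<Longrightarrow> x \<in> M x"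
    "\<And>x. x \<in> X \<Longrightarrow> N x + M x + N x \<subseteq> D" by metis
  obtain F where F: "F \<subseteq> X" "finite F" "X \<subseteq> (\<Union>x\<in>F. M x)"
    by (rule compactE_image[OF assms(1), of X M]) (use NM in auto)
  have "open (\<Inter>x\<in>F. N x)" using F NM by (intro open_INT) auto
  moreover have "0 \<in> (\<Inter>x\<in>F. N x)" using F NM by auto
  ultimately obtain O' where O': "open O'" "0 \<in> O'" "uminus ` O' = O'" "O' \<subseteq> (\<Inter>x\<in>F. N x)"
    by (rule symmetric_nbhd)
  have "O' + X + O' \<subseteq> D"
  proof
    fix w assume "w \<in> O' + X + O'"
    then obtain a y b where w: "w = a + y + b" "a \<in> O'" "y \<in> X" "b \<in> O'"
      by (auto elim!: set_plus_elim)
    then obtain x where "x \<in> F" "y \<in> M x" using F by auto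
    with w O' have "w \<in> N x + M x + N x" by (auto intro!: set_plus_intro)
    with \<open>x \<in> F\<close> show "w \<in> D" using NM F by blast
  qed
  with O' that show thesis by blast
qed

lemma small_nbhd:
  fixes D :: "'a::topological_group_add set"
  assumes "open D" "0 \<in> D"
  obtains O' where "open O'" "0 \<in> O'" "uminus ` O' = O'" "O' + O' \<subseteq> D"
proof -
  obtain O' where "open O'" "0 \<in> O'" "uminus ` O' = O'" "O' + {0} + O' \<subseteq> D"
    by (rule two_sided_thickening[of "{0}" D]) (use assms in auto)
  moreover have "O' + {0} = O'" using add_0_right[of O'] by (simp add: set_zero)
  ultimately show thesis using that by simp
qed

lemma disjoint_compact_separation:
  fixes X Y :: "'a::t2_space set"
  assumes "compact X" "compact Y" "X \<inter> Y = {}"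
  obtains D E where "open D" "open E" "X \<subseteq> D" "Y \<subseteq> E" "D \<inter> E = {}"
proof -
  have "Hausdorff_space (euclidean :: 'a topology)"
    using Hausdorff_space_def disjnt_def hausdorff by (metis (no_types, lifting) open_openin)
  then show thesis
    by (rule Hausdorff_space_compact_separation[of _ X Y])
       (use assms that in \<open>auto simp: disjnt_def\<close>)
qed

lemma compact_split_Un:
  fixes A :: "'a::t2_space set"
  assumes "compact A" "A \<subseteq> D \<union> E" "open D" "open E"
  obtains A1 A2 where "A = A1 \<union> A2" "compact A1" "compact A2" "A1 \<subseteq> D" "A2 \<subseteq> E"
proof -
  obtain P Q where "open P" "open Q" "A - D \<subseteq> P" "A - E \<subseteq> Q" "P \<inter> Q = {}"
    by (rule disjoint_compact_separation[of "A - D" "A - E"])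
       (use assms in \<open>auto intro: compact_diff\<close>)
  then show thesis
    using assms by (intro that[of "A - P" "A - Q"]) (auto intro: compact_diff)
qed

section \<open>Covering numbers\<close>

definition coverable :: "'a::group_add set \<Rightarrow> 'a set \<Rightarrow> bool" where
  "coverable V A \<longleftrightarrow> (\<exists>S. finite S \<and> A \<subseteq> S + V)"

definition covnum :: "'a::group_add set \<Rightarrow> 'a set \<Rightarrow> nat" where
  "covnum V A = Inf (card ` {S. finite S \<and> A \<subseteq> S + V})"

lemma compact_coverable:
  fixes A :: "'a::topological_group_add set"
  assumes "compact A" "open V" "0 \<in> V"
  shows "coverable V A"
proof -
  have "A \<subseteq> (\<Union>a\<in>A. {a} + V)"
    using assms(3) by (auto simp: mem_translate_iff)
  then obtain F where "F \<subseteq> A" "finite F" "A \<subseteq> (\<Union>a\<in>F. {a} + V)"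
    by (rule compactE_image[OF assms(1), of A "\<lambda>a. {a} + V", rotated])
       (use assms(2) open_translate in auto)
  moreover have "(\<Union>a\<in>F. {a} + V) = F + V" by (auto simp: set_plus_def)
  ultimately show ?thesis unfolding coverable_def by blast
qed

lemma coverable_mono: "coverable V B \<Longrightarrow> A \<subseteq> B \<Longrightarrow> coverable V A"
  unfolding coverable_def by blast

lemma covnum_le: "finite S \<Longrightarrow> A \<subseteq> S + V \<Longrightarrow> covnum V A \<le> card S"
  unfolding covnum_def by (rule wellorder_Inf_le1) blast

lemma covnum_witness:
  assumes "coverable V A"
  obtains S where "finite S" "A \<subseteq> S + V" "card S = covnum V A"
proof -
  have "covnum V A \<in> card ` {S. finite S \<and> A \<subseteq> S + V}"
    unfolding covnum_def by (rule Inf_nat_def1) (use assms in \<open>auto simp: coverable_def\<close>)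
  with that show thesis by fastforce
qed

lemma covnum_mono: "coverable V B \<Longrightarrow> A \<subseteq> B \<Longrightarrow> covnum V A \<le> covnum V B"
  by (metis covnum_le covnum_witness subset_trans)

lemma covnum_Un:
  assumes "coverable V A" "coverable V B"
  shows "covnum V (A \<union> B) \<le> covnum V A + covnum V B"
proof -
  obtain S where S: "finite S" "A \<subseteq> S + V" "card S = covnum V A" using assms(1) by (rule covnum_witness)
  obtain T where T: "finite T" "B \<subseteq> T + V" "card T = covnum V B" using assms(2) by (rule covnum_witness)
  have "S + V \<subseteq> (S \<union> T) + V" "T + V \<subseteq> (S \<union> T) + V"
    by (intro set_plus_mono2 Un_upper1 Un_upper2 order_refl)+
  then have "covnum V (A \<union> B) \<le> card (S \<union> T)"
    using S T by (intro covnum_le) auto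
  also have "\<dots> \<le> card S + card T" by (rule card_Un_le)
  finally show ?thesis using S T by simp
qed

lemma covnum_subset_plus:
  assumes "coverable V B" "finite F" "A \<subseteq> F + B"
  shows "covnum V A \<le> card F * covnum V B"
proof -
  obtain S where S: "finite S" "B \<subseteq> S + V" "card S = covnum V B" using assms(1) by (rule covnum_witness)
  have "F + B \<subseteq> F + S + V" using S(2) by (simp add: add.assoc set_plus_mono2)
  then have "covnum V A \<le> card (F + S)"
    using S assms by (intro covnum_le) (auto simp: finite_set_plus)
  also have "\<dots> \<le> card (F \<times> S)"
    unfolding set_plus_image using assms S by (intro card_image_le) auto
  finally show ?thesis using S by (simp add: card_cartesian_product)
qed

lemma covnum_translate: "coverable V A \<Longrightarrow> covnum V ({g} + A) \<le> covnum V A"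
  using covnum_subset_plus[of V A "{g}" "{g} + A"] by simp

lemma covnum_pos:
  assumes "coverable V A" "A \<noteq> {}"
  shows "covnum V A > 0"
  using covnum_witness[OF assms(1)] assms(2)
  by (metis card_gt_0_iff ex_in_conv set_plus_elim subsetD)

lemma covnum_conj_le:
  fixes A :: "'a::group_add set"
  assumes "coverable V A"
  shows "covnum ((\<lambda>x. g + x - g) ` V) ((\<lambda>x. g + x - g) ` A) \<le> covnum V A"
proof -
  obtain S where S: "finite S" "A \<subseteq> S + V" "card S = covnum V A" using assms by (rule covnum_witness)
  let ?c = "\<lambda>x. g + x - g"
  have "?c ` A \<subseteq> ?c ` S + ?c ` V"
  proof clarify
    fix a assume "a \<in> A"
    then obtain s v where "a = s + v" "s \<in> S" "v \<in> V" using S by (auto elim!: set_plus_elim)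
    moreover have "?c (s + v) = ?c s + ?c v" by (simp add: diff_conv_add_uminus add.assoc del: add_uminus_conv_diff)
    ultimately show "?c a \<in> ?c ` S + ?c ` V" by (auto intro: set_plus_intro)
  qed
  then have "covnum (?c ` V) (?c ` A) \<le> card (?c ` S)" using S by (intro covnum_le) auto
  also have "\<dots> \<le> card S" using S by (intro card_image_le)
  finally show ?thesis using S by simp
qed

lemma covnum_separated_sum:
  fixes T :: "'i \<Rightarrow> 'a::group_add set"
  assumes "finite I" "coverable W (\<Union>i\<in>I. T i)"
    and sep: "\<And>i j s. i \<in> I \<Longrightarrow> j \<in> I \<Longrightarrow> i \<noteq> j \<Longrightarrow> ({s} + W) \<inter> T i \<noteq> {} \<Longrightarrow> ({s} + W) \<inter> T j = {}"
  shows "(\<Sum>i\<in>I. covnum W (T i)) \<le> covnum W (\<Union>i\<in>I. T i)"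
proof -
  obtain S where S: "finite S" "(\<Union>i\<in>I. T i) \<subseteq> S + W" "card S = covnum W (\<Union>i\<in>I. T i)"
    using assms(2) by (rule covnum_witness)
  define R where "R i = {s\<in>S. ({s} + W) \<inter> T i \<noteq> {}}" for i
  have "covnum W (T i) \<le> card (R i)" if "i \<in> I" for i
  proof (rule covnum_le)
    show "finite (R i)" using S by (simp add: R_def)
    show "T i \<subseteq> R i + W"
    proof
      fix t assume t: "t \<in> T i"
      with S(2) that obtain s w where sw: "t = s + w" "s \<in> S" "w \<in> W" by (auto elim!: set_plus_elim)
      then have "t \<in> ({s} + W) \<inter> T i" using t by (auto simp: mem_translate_iff add.assoc[symmetric])
      then have "s \<in> R i" using sw by (auto simp: R_def)
      then show "t \<in> R i + W" using sw by auto
    qed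
  qed
  then have "(\<Sum>i\<in>I. covnum W (T i)) \<le> (\<Sum>i\<in>I. card (R i))" by (rule sum_mono)
  also have "\<dots> = card (\<Union>i\<in>I. R i)"
    using assms(1) S sep by (subst card_UN_disjoint) (auto simp: R_def, blast)
  also have "\<dots> \<le> card S" using S by (intro card_mono) (auto simp: R_def)
  finally show ?thesis using S by simp
qed

text \<open>
  This inequality does the work of Fubini's theorem. Cover \<open>U\<close> economically by \<open>W\<close>-translates
  with centres \<open>y\<close> and the product set by \<open>V\<close>-translates with centres \<open>x\<close>, and count the pairs
  for which \<open>x + V\<close> meets \<open>y + A\<close>. It compares the size of \<open>A\<close> at one scale with the size of
  its inverse at any other scale, up to thickening.
\<close>

lemma covnum_double_counting:
  fixes A U V W :: "'a::group_add set"
  assumes cU: "coverable W U" and cT: "coverable V (U + uminus ` W + A)"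
    and cA: "\<And>B. B \<subseteq> V + uminus ` A + W \<Longrightarrow> coverable W B"
  shows "covnum W U * covnum V A \<le> covnum V (U + uminus ` W + A) * covnum W (V + uminus ` A + W)"
proof -
  obtain Y where Y: "finite Y" "U \<subseteq> Y + W" "card Y = covnum W U" using cU by (rule covnum_witness)
  obtain X where X: "finite X" "U + uminus ` W + A \<subseteq> X + V" "card X = covnum V (U + uminus ` W + A)"
    using cT by (rule covnum_witness)
  have Y_min: "y \<in> U + uminus ` W" if "y \<in> Y" for y
  proof (rule ccontr)
    assume *: "y \<notin> U + uminus ` W"
    have "U \<subseteq> (Y - {y}) + W"
    proof
      fix u assume "u \<in> U"
      then obtain y' w where yw: "u = y' + w" "y' \<in> Y" "w \<in> W" using Y by (auto elim!: set_plus_elim)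
      have "u + - w \<in> U + uminus ` W" using \<open>u \<in> U\<close> yw(3) by (intro set_plus_intro) auto
      then have "y' \<in> U + uminus ` W" by (simp add: yw(1))
      then have "y' \<in> Y - {y}" using yw(2) * by auto
      then show "u \<in> (Y - {y}) + W" unfolding yw(1) using yw(3) by (rule set_plus_intro)
    qed
    then have "covnum W U \<le> card (Y - {y})" using Y by (intro covnum_le) auto
    then show False using Y that by (metis card_Diff1_less leD)
  qed
  define hit where "hit y x \<longleftrightarrow> ({x} + V) \<inter> ({y} + A) \<noteq> {}" for x y
  \<comment> \<open>The \<open>V\<close>-translates that meet \<open>y + A\<close> cover it.\<close>
  have row: "covnum V A \<le> card {x\<in>X. hit y x}" if "y \<in> Y" for y
  proof -
    have "A \<subseteq> (\<lambda>x. - y + x) ` {x\<in>X. hit y x} + V"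
    proof
      fix a assume "a \<in> A"
      then have "y + a \<in> U + uminus ` W + A" using Y_min[OF that] by (auto intro: set_plus_intro)
      with X(2) have "y + a \<in> X + V" by blast
      then obtain x v where xv: "y + a = x + v" "x \<in> X" "v \<in> V" by (rule set_plus_elim)
      then have "hit y x" using \<open>a \<in> A\<close> by (auto simp: hit_def set_plus_def)
      moreover have "a = (- y + x) + v" using xv(1) by (metis add.assoc add_0_left left_minus)
      ultimately show "a \<in> (\<lambda>x. - y + x) ` {x\<in>X. hit y x} + V" using xv
        by (auto intro!: set_plus_intro)
    qed
    then have "covnum V A \<le> card ((\<lambda>x. - y + x) ` {x\<in>X. hit y x})" using X by (intro covnum_le) auto
    also have "\<dots> \<le> card {x\<in>X. hit y x}" using X by (intro card_image_le) auto
    finally show ?thesis .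
  qed
  \<comment> \<open>The \<open>W\<close>-translates with centres in a column fill out a translate of the last set. If they
    were more numerous than necessary, then \<open>Y\<close> would not be a minimal cover of \<open>U\<close>.\<close>
  have col: "card {y\<in>Y. hit y x} \<le> covnum W (V + uminus ` A + W)" for x
  proof -
    obtain Z where Z: "finite Z" "V + uminus ` A + W \<subseteq> Z + W" "card Z = covnum W (V + uminus ` A + W)"
      using cA[OF order_refl] by (rule covnum_witness)
    let ?H = "{y\<in>Y. hit y x}"
    have "?H + W \<subseteq> {x} + (V + uminus ` A + W)"
    proof
      fix t assume "t \<in> ?H + W"
      then obtain y w where yw: "t = y + w" "y \<in> Y" "hit y x" "w \<in> W" by (auto elim!: set_plus_elim)
      then obtain v a where va: "x + v = y + a" "v \<in> V" "a \<in> A" by (auto simp: hit_def set_plus_def)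
      have "t = x + (v + - a + w)"
        using va(1) yw(1) by (metis add.assoc add.right_inverse add_0_right)
      then show "t \<in> {x} + (V + uminus ` A + W)" using va yw
        by (auto intro!: set_plus_intro simp del: add_uminus_conv_diff)
    qed
    moreover have "{x} + (V + uminus ` A + W) \<subseteq> {x} + (Z + W)"
      using Z(2) by (rule set_plus_mono2[OF order_refl])
    ultimately have HW: "?H + W \<subseteq> ({x} + Z) + W" by (simp add: add.assoc)
    have "U \<subseteq> ((Y - ?H) \<union> ({x} + Z)) + W"
    proof
      fix u assume "u \<in> U"
      then obtain y w where yw: "u = y + w" "y \<in> Y" "w \<in> W" using Y by (auto elim!: set_plus_elim)
      show "u \<in> ((Y - ?H) \<union> ({x} + Z)) + W"
      proof (cases "y \<in> ?H")
        case True
        then have "u \<in> ?H + W" unfolding yw(1) using yw(3) by (rule set_plus_intro)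
        with HW have "u \<in> ({x} + Z) + W" by blast
        moreover have "({x} + Z) + W \<subseteq> ((Y - ?H) \<union> ({x} + Z)) + W"
          by (rule set_plus_mono2[OF Un_upper2 order_refl])
        ultimately show ?thesis by blast
      next
        case False
        then show ?thesis unfolding yw(1) using yw by (intro set_plus_intro) auto
      qed
    qed
    then have "card Y \<le> card ((Y - ?H) \<union> ({x} + Z))"
      using Y Z by (auto intro!: covnum_le simp: finite_set_plus)
    also have "\<dots> \<le> card (Y - ?H) + card ({x} + Z)" by (rule card_Un_le)
    also have "card ({x} + Z) \<le> card Z"
    proof -
      have "{x} + Z = (\<lambda>z. x + z) ` Z" by (auto simp: set_plus_def)
      then show ?thesis using card_image_le[OF Z(1), of "(+) x"] by simp
    qed
    also have "card (Y - ?H) = card Y - card ?H" using Y by (intro card_Diff_subset) auto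
    finally have "card Y \<le> card Y - card ?H + card Z" by simp
    moreover have "card ?H \<le> card Y" using Y by (intro card_mono) auto
    ultimately show ?thesis using Z by linarith
  qed
  have "covnum W U * covnum V A = (\<Sum>y\<in>Y. covnum V A)" using Y by simp
  also have "\<dots> \<le> (\<Sum>y\<in>Y. card {x\<in>X. hit y x})" using row by (rule sum_mono)
  also have "\<dots> = (\<Sum>x\<in>X. card {y\<in>Y. hit y x})"
    using Y X by (intro sum_multicount_gen) auto
  also have "\<dots> \<le> (\<Sum>x\<in>X. covnum W (V + uminus ` A + W))" using col by (rule sum_mono)
  finally show ?thesis using X by simp
qed

section \<open>A central uniformly continuous bump function\<close>

definition nbhd0 :: "'a::topological_group_add set \<Rightarrow> bool" where
  "nbhd0 V \<longleftrightarrow> open V \<and> 0 \<in> V"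

lemma nbhd0_conj: "nbhd0 V \<Longrightarrow> nbhd0 ((\<lambda>x. g + x - g) ` V)"
  by (auto simp: nbhd0_def mem_conj_iff open_conj_image)

lemma conj_image_conj_image: "(\<lambda>x. g + x - g) ` (\<lambda>x. - g + x - - g) ` V = V" for g :: "'a::group_add"
proof -
  have "x \<in> (\<lambda>x. g + x - g) ` (\<lambda>x. - g + x - - g) ` V \<longleftrightarrow> x \<in> V" for x
    unfolding mem_conj_iff by (simp add: add.assoc diff_conv_add_uminus del: add_uminus_conv_diff)
  then show ?thesis by blast
qed

locale invariant_nbhd =
  fixes U :: "'a::{topological_group_add, t2_space} set"
  assumes compact_U: "compact U" and zero_U: "0 \<in> interior U"
    and sym_U: "uminus ` U = U" and conj_U: "(\<lambda>x. g + x - g) ` U = U"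
begin

abbreviation "B \<equiv> interior U"

lemma B_subset_U: "B \<subseteq> U" by (rule interior_subset)

lemma conj_B: "(\<lambda>x. g + x - g) ` B = B"
proof -
  have *: "(\<lambda>x. g + x - g) ` B \<subseteq> B" for g
  proof (rule interior_maximal)
    show "(\<lambda>x. g + x - g) ` B \<subseteq> U" using conj_U[of g] B_subset_U by blast
  qed (simp add: open_conj_image)
  have "B = (\<lambda>x. g + x - g) ` (\<lambda>x. - g + x - - g) ` B" by (simp only: conj_image_conj_image)
  also have "\<dots> \<subseteq> (\<lambda>x. g + x - g) ` B" using *[of "- g"] by (rule image_mono)
  finally show ?thesis using * by blast
qed

lemma nbhd0_B: "nbhd0 B"
  using zero_U by (simp add: nbhd0_def)

lemma coverable_compact: "compact A \<Longrightarrow> nbhd0 V \<Longrightarrow> coverable V A"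
  using compact_coverable by (auto simp: nbhd0_def)

lemma covnum_U_pos: "nbhd0 V \<Longrightarrow> covnum V U > 0"
  using covnum_pos coverable_compact compact_U zero_U B_subset_U by blast

text \<open>
  The upper content of \<open>A\<close> is the limit superior of \<open>(A : V) / (U : V)\<close> as \<open>V\<close> shrinks to the
  identity, and \<open>thin \<epsilon> A\<close> bounds it by \<open>\<epsilon>\<close>. A limit along an ultrafilter would be additive on
  disjoint compact sets, but its invariance under conjugation would amount to unimodularity. The limit superior is only
  subadditive, but conjugation by \<open>g\<close> merely permutes the small neighbourhoods \<open>V\<close> and fixes \<open>U\<close>.
\<close>

definition thin :: "real \<Rightarrow> 'a set \<Rightarrow> bool" where
  "thin \<epsilon> A \<longleftrightarrow> (\<exists>N. nbhd0 N \<and>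
     (\<forall>V. nbhd0 V \<and> V \<subseteq> N \<longrightarrow> real (covnum V A) \<le> \<epsilon> * real (covnum V U)))"

lemma thin_Un:
  assumes "thin \<epsilon> A" "thin \<delta> A'" "compact A" "compact A'"
  shows "thin (\<epsilon> + \<delta>) (A \<union> A')"
proof -
  obtain N where N: "nbhd0 N" "\<And>V. nbhd0 V \<Longrightarrow> V \<subseteq> N \<Longrightarrow> real (covnum V A) \<le> \<epsilon> * real (covnum V U)"
    using assms(1) by (auto simp: thin_def)
  obtain M where M: "nbhd0 M" "\<And>V. nbhd0 V \<Longrightarrow> V \<subseteq> M \<Longrightarrow> real (covnum V A') \<le> \<delta> * real (covnum V U)"
    using assms(2) by (auto simp: thin_def)
  have "real (covnum V (A \<union> A')) \<le> (\<epsilon> + \<delta>) * real (covnum V U)" if "nbhd0 V" "V \<subseteq> N \<inter> M" for V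
    using N(2)[of V] M(2)[of V] that
      covnum_Un[OF coverable_compact[OF assms(3) that(1)] coverable_compact[OF assms(4) that(1)]]
    by (simp add: distrib_right)
  moreover have "nbhd0 (N \<inter> M)" using N M by (auto simp: nbhd0_def)
  ultimately show ?thesis unfolding thin_def by blast
qed

lemma thin_translate:
  assumes "thin \<epsilon> A" "compact A"
  shows "thin \<epsilon> ({g} + A)"
proof -
  obtain N where N: "nbhd0 N" "\<And>V. nbhd0 V \<Longrightarrow> V \<subseteq> N \<Longrightarrow> real (covnum V A) \<le> \<epsilon> * real (covnum V U)"
    using assms(1) by (auto simp: thin_def)
  have "real (covnum V ({g} + A)) \<le> \<epsilon> * real (covnum V U)" if "nbhd0 V" "V \<subseteq> N" for V
    using N(2)[OF that] covnum_translate[OF coverable_compact[OF assms(2) that(1)], of g] by linarith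
  with N(1) show ?thesis unfolding thin_def by blast
qed

lemma thin_conj:
  assumes "thin \<epsilon> A" "compact A" "\<epsilon> \<ge> 0"
  shows "thin \<epsilon> ((\<lambda>x. g + x - g) ` A)"
proof -
  obtain N where N: "nbhd0 N" "\<And>V. nbhd0 V \<Longrightarrow> V \<subseteq> N \<Longrightarrow> real (covnum V A) \<le> \<epsilon> * real (covnum V U)"
    using assms(1) by (auto simp: thin_def)
  let ?c = "\<lambda>x. g + x - g" and ?d = "\<lambda>x. - g + x - - g"
  have "real (covnum V (?c ` A)) \<le> \<epsilon> * real (covnum V U)" if V: "nbhd0 V" "V \<subseteq> ?c ` N" for V
  proof -
    have dV: "nbhd0 (?d ` V)" using V(1) by (rule nbhd0_conj)
    have "?d ` V \<subseteq> ?d ` ?c ` N" using V(2) by (rule image_mono)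
    also have "\<dots> = N" using conj_image_conj_image[of "- g" N] by simp
    finally have "?d ` V \<subseteq> N" .
    then have "real (covnum (?d ` V) A) \<le> \<epsilon> * real (covnum (?d ` V) U)" using N(2) dV by blast
    moreover have "covnum V (?c ` A) \<le> covnum (?d ` V) A"
      using covnum_conj_le[OF coverable_compact[OF assms(2) dV], of g] conj_image_conj_image[of g V] by simp
    moreover have "covnum (?d ` V) U \<le> covnum V U"
      using covnum_conj_le[OF coverable_compact[OF compact_U V(1)], of "- g"] conj_U[of "- g"] by simp
    then have "\<epsilon> * real (covnum (?d ` V) U) \<le> \<epsilon> * real (covnum V U)"
      using assms(3) by (intro mult_left_mono) auto
    ultimately show ?thesis by linarith
  qed
  with nbhd0_conj[OF N(1)] show ?thesis unfolding thin_def by blast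
qed

lemma thin_lower_bound:
  assumes "compact A" "0 \<in> interior A"
  obtains m where "m > 0" "\<And>\<epsilon>. thin \<epsilon> A \<Longrightarrow> m \<le> \<epsilon>"
proof -
  have "coverable (interior A) U" using assms compact_U by (intro coverable_compact) (auto simp: nbhd0_def)
  then obtain F where F: "finite F" "U \<subseteq> F + interior A" by (auto simp: coverable_def)
  then have FA: "U \<subseteq> F + A" using set_plus_mono2[OF order_refl interior_subset] by blast
  have "F \<noteq> {}" using F zero_U B_subset_U by (auto elim!: set_plus_elim)
  then have cF: "card F > 0" using F by (simp add: card_gt_0_iff)
  show thesis
  proof
    show "1 / real (card F) > 0" using cF by simp
    fix \<epsilon> assume "thin \<epsilon> A"
    then obtain V where V: "nbhd0 V" "real (covnum V A) \<le> \<epsilon> * real (covnum V U)"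
      by (auto simp: thin_def)
    have "covnum V U \<le> card F * covnum V A"
      using covnum_subset_plus[OF coverable_compact[OF assms(1) V(1)] F(1) FA] .
    then have "real (covnum V U) \<le> real (card F) * real (covnum V A)" by (metis of_nat_le_iff of_nat_mult)
    also have "\<dots> \<le> real (card F) * (\<epsilon> * real (covnum V U))" using V(2) by (intro mult_left_mono) auto
    finally have "1 * real (covnum V U) \<le> (real (card F) * \<epsilon>) * real (covnum V U)" by (simp add: mult.assoc)
    then have "1 \<le> real (card F) * \<epsilon>" using covnum_U_pos[OF V(1)]
      by (metis mult_le_cancel_right_pos of_nat_0_less_iff)
    then show "1 / real (card F) \<le> \<epsilon>" using cF by (simp add: field_simps)
  qed
qed

text \<open>
  A trace of additivity. Sets that are not \<open>\<epsilon>\<close>-thin have large covering numbers, but each at a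
  scale \<open>V\<close> of its own. The double counting inequality turns these into lower bounds at one common
  scale \<open>W\<close>, chosen so fine that the covering numbers of the disjoint sets add up.
\<close>

lemma fat_disjoint_bound:
  obtains C where "C > 0" "\<And>\<epsilon> \<A>. finite \<A> \<Longrightarrow> disjoint \<A> \<Longrightarrow>
    (\<And>A. A \<in> \<A> \<Longrightarrow> compact A \<and> A \<subseteq> U \<and> \<not> thin \<epsilon> A) \<Longrightarrow> real (card \<A>) * \<epsilon> \<le> C"
proof -
  \<comment> \<open>All thickenings take place in \<open>U + U + U\<close>, which is larger than \<open>U\<close> by a bounded factor \<open>m\<close>.\<close>
  let ?U3 = "U + U + U"
  have cU3: "compact ?U3" using compact_U by (intro compact_set_plus)
  obtain F where F: "finite F" "?U3 \<subseteq> F + B"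
    using coverable_compact[OF cU3 nbhd0_B] by (auto simp: coverable_def)
  then have FU: "?U3 \<subseteq> F + U" using set_plus_mono2[OF order_refl B_subset_U] by blast
  define m where "m = real (card F)"
  have m0: "m \<ge> 0" by (simp add: m_def)
  have U3: "real (covnum V ?U3) \<le> m * real (covnum V U)" if "nbhd0 V" for V
    using covnum_subset_plus[OF coverable_compact[OF compact_U that] F(1) FU]
    by (simp add: m_def of_nat_mult[symmetric] del: of_nat_mult)
  have main: "real (card \<A>) * \<epsilon> \<le> m * m + 1"
    if \<A>: "finite \<A>" "disjoint \<A>" and fat: "\<And>A. A \<in> \<A> \<Longrightarrow> compact A \<and> A \<subseteq> U \<and> \<not> thin \<epsilon> A" for \<epsilon> \<A>
  proof -
    have "\<exists>N. nbhd0 N \<and> (\<forall>s. ({s} + N) \<inter> (N + uminus ` A + N) = {} \<or> ({s} + N) \<inter> (N + uminus ` A' + N) = {})"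
      if "A \<in> \<A>" "A' \<in> \<A>" "A \<noteq> A'" for A A'
    proof -
      have "uminus ` A \<inter> uminus ` A' = {}"
      proof -
        have "A \<inter> A' = {}" using \<A>(2) that unfolding disjoint_def by blast
        then show ?thesis by auto
      qed
      moreover have "compact (uminus ` A)" "compact (uminus ` A')"
        using fat that by (auto intro: compact_uminus_image)
      ultimately obtain D E where DE: "open D" "open E" "uminus ` A \<subseteq> D" "uminus ` A' \<subseteq> E" "D \<inter> E = {}"
        using disjoint_compact_separation by metis
      obtain P where P: "open P" "0 \<in> P" "P + uminus ` A + P \<subseteq> D"
        using two_sided_thickening[OF _ DE(1,3)] \<open>compact (uminus ` A)\<close> by metis
      obtain Q where Q: "open Q" "0 \<in> Q" "Q + uminus ` A' + Q \<subseteq> E"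
        using two_sided_thickening[OF _ DE(2,4)] \<open>compact (uminus ` A')\<close> by metis
      obtain N where N: "open N" "0 \<in> N" "uminus ` N = N" "N + N \<subseteq> P \<inter> Q"
        using small_nbhd[of "P \<inter> Q"] P Q by blast
      have NPQ: "n \<in> P \<inter> Q" "n + - n' \<in> P \<inter> Q" if "n \<in> N" "n' \<in> N" for n n'
      proof -
        have "n + 0 \<in> N + N" using that N by (intro set_plus_intro)
        then show "n \<in> P \<inter> Q" using N by auto
        have "- n' \<in> N" using that N(3) by blast
        then have "n + - n' \<in> N + N" using that by (intro set_plus_intro)
        then show "n + - n' \<in> P \<inter> Q" using N by blast
      qed
      have in_thick: "s \<in> R + Z + R"
        if hit: "({s} + N) \<inter> (N + Z + N) \<noteq> {}" and R: "R = P \<or> R = Q" for s Z R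
      proof -
        obtain t where "t \<in> ({s} + N) \<inter> (N + Z + N)"
          using hit unfolding ex_in_conv[symmetric] ..
        then have "t \<in> {s} + N" "t \<in> N + Z + N" by auto
        define n where "n = - s + t"
        have n: "t = s + n" "n \<in> N"
          using \<open>t \<in> {s} + N\<close> by (simp_all add: n_def mem_translate_iff add.assoc[symmetric])
        obtain n1 z n2 where nz: "t = n1 + z + n2" "n1 \<in> N" "z \<in> Z" "n2 \<in> N"
          using \<open>t \<in> N + Z + N\<close> by (rule set_plus3_elim)
        have "s = t + - n" by (simp add: n(1))
        also have "\<dots> = n1 + z + (n2 + - n)" unfolding nz(1) by (rule add.assoc)
        finally have s: "s = n1 + z + (n2 + - n)" .
        have "n1 \<in> R" "n2 + - n \<in> R" using NPQ n nz R by blast+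
        then show ?thesis unfolding s using nz(3) by (intro set_plus_intro)
      qed
      have "({s} + N) \<inter> (N + uminus ` A + N) = {} \<or> ({s} + N) \<inter> (N + uminus ` A' + N) = {}" for s
        using in_thick[of s "uminus ` A" P] in_thick[of s "uminus ` A'" Q] P(3) Q(3) DE(5) by blast
      then show ?thesis using N by (auto simp: nbhd0_def)
    qed
    then obtain N where N: "\<And>A A'. A \<in> \<A> \<Longrightarrow> A' \<in> \<A> \<Longrightarrow> A \<noteq> A' \<Longrightarrow> nbhd0 (N A A')"
      "\<And>A A' s. A \<in> \<A> \<Longrightarrow> A' \<in> \<A> \<Longrightarrow> A \<noteq> A' \<Longrightarrow>
        ({s} + N A A') \<inter> (N A A' + uminus ` A + N A A') = {} \<or> ({s} + N A A') \<inter> (N A A' + uminus ` A' + N A A') = {}"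
      by metis
    define W where "W = B \<inter> (\<Inter>(A, A') \<in> {(A, A'). A \<in> \<A> \<and> A' \<in> \<A> \<and> A \<noteq> A'}. N A A')"
    have "finite {(A, A'). A \<in> \<A> \<and> A' \<in> \<A> \<and> A \<noteq> A'}"
      by (rule finite_subset[of _ "\<A> \<times> \<A>"]) (use \<A> in auto)
    then have W: "nbhd0 W" using N(1) zero_U unfolding W_def nbhd0_def by (auto intro!: open_Int open_INT)
    have WB: "W \<subseteq> B" by (auto simp: W_def)
    have WU: "W \<subseteq> U" using WB B_subset_U by blast
    have WN: "W \<subseteq> N A A'" if "A \<in> \<A>" "A' \<in> \<A>" "A \<noteq> A'" for A A'
      using that by (auto simp: W_def)
    have "\<exists>V. nbhd0 V \<and> V \<subseteq> W \<and> real (covnum V A) > \<epsilon> * real (covnum V U)" if "A \<in> \<A>" for A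
      using fat[OF that] W unfolding thin_def by (meson not_le)
    then obtain V where V: "\<And>A. A \<in> \<A> \<Longrightarrow> nbhd0 (V A)" "\<And>A. A \<in> \<A> \<Longrightarrow> V A \<subseteq> W"
      "\<And>A. A \<in> \<A> \<Longrightarrow> real (covnum (V A) A) > \<epsilon> * real (covnum (V A) U)" by metis
    define T where "T A = V A + uminus ` A + W" for A
    have mA: "uminus ` A \<subseteq> U" if "A \<in> \<A>" for A using fat[OF that] sym_U by blast
    have TU: "T A \<subseteq> ?U3" if "A \<in> \<A>" for A
      unfolding T_def using V(2)[OF that] WU mA[OF that] by (intro set_plus_mono2) auto
    \<comment> \<open>The inverses \<open>- A\<close>, thickened by \<open>V A\<close> and \<open>W\<close>, have a proportion \<open>\<epsilon> / m\<close> of \<open>U\<close> at scale \<open>W\<close>.\<close>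
    have each: "\<epsilon> * real (covnum W U) \<le> m * real (covnum W (T A))" if "A \<in> \<A>" for A
    proof -
      have AU: "U + uminus ` W + A \<subseteq> ?U3"
        using fat[OF that] WU sym_U by (intro set_plus_mono2) auto
      have "covnum W U * covnum (V A) A \<le> covnum (V A) (U + uminus ` W + A) * covnum W (T A)"
        unfolding T_def
      proof (rule covnum_double_counting)
        show "coverable W U" using compact_U W by (rule coverable_compact)
        show "coverable (V A) (U + uminus ` W + A)"
          using coverable_compact[OF cU3 V(1)[OF that]] AU by (rule coverable_mono)
        show "coverable W B'" if "B' \<subseteq> V A + uminus ` A + W" for B'
          using coverable_compact[OF cU3 W] that TU[OF \<open>A \<in> \<A>\<close>] unfolding T_def
          by (meson coverable_mono subset_trans)
      qed
      also have "\<dots> \<le> covnum (V A) ?U3 * covnum W (T A)"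
        using covnum_mono[OF coverable_compact[OF cU3 V(1)[OF that]] AU] by (rule mult_right_mono) simp
      finally have "real (covnum W U) * real (covnum (V A) A) \<le> real (covnum (V A) ?U3) * real (covnum W (T A))"
        by (metis of_nat_le_iff of_nat_mult)
      also have "\<dots> \<le> (m * real (covnum (V A) U)) * real (covnum W (T A))"
        using U3[OF V(1)[OF that]] by (intro mult_right_mono) auto
      finally have 1: "real (covnum W U) * real (covnum (V A) A) \<le> (m * real (covnum W (T A))) * real (covnum (V A) U)"
        by (simp add: mult_ac)
      have "real (covnum W U) * (\<epsilon> * real (covnum (V A) U)) \<le> real (covnum W U) * real (covnum (V A) A)"
        using V(3)[OF that] by (intro mult_left_mono) auto
      with 1 have "(\<epsilon> * real (covnum W U)) * real (covnum (V A) U) \<le> (m * real (covnum W (T A))) * real (covnum (V A) U)"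
        by (simp add: mult_ac)
      then show ?thesis using covnum_U_pos[OF V(1)[OF that]] by simp
    qed
    have TW: "T A \<subseteq> N A A' + uminus ` A + N A A'" "T A \<subseteq> N A' A + uminus ` A + N A' A"
      if "A \<in> \<A>" "A' \<in> \<A>" "A \<noteq> A'" for A A'
    proof -
      have "W \<subseteq> N A A'" "W \<subseteq> N A' A" using WN that by metis+
      moreover from this have "V A \<subseteq> N A A'" "V A \<subseteq> N A' A" using V(2)[OF that(1)] by blast+
      ultimately have sub: "W \<subseteq> N A A'" "W \<subseteq> N A' A" "V A \<subseteq> N A A'" "V A \<subseteq> N A' A" by auto
      show "T A \<subseteq> N A A' + uminus ` A + N A A'"
        unfolding T_def by (rule set_plus_mono2[OF set_plus_mono2[OF sub(3) order_refl] sub(1)])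
      show "T A \<subseteq> N A' A + uminus ` A + N A' A"
        unfolding T_def by (rule set_plus_mono2[OF set_plus_mono2[OF sub(4) order_refl] sub(2)])
    qed
    have "(\<Sum>A\<in>\<A>. covnum W (T A)) \<le> covnum W (\<Union>A\<in>\<A>. T A)"
    proof (rule covnum_separated_sum)
      show "coverable W (\<Union>A\<in>\<A>. T A)"
        using coverable_compact[OF cU3 W] by (rule coverable_mono) (use TU in blast)
      fix A A' s assume A: "A \<in> \<A>" "A' \<in> \<A>" "A \<noteq> A'" and hit: "({s} + W) \<inter> T A \<noteq> {}"
      have sub: "{s} + W \<subseteq> {s} + N A A'" using WN[OF A] by (intro set_plus_mono2) auto
      have "({s} + W) \<inter> T A \<subseteq> ({s} + N A A') \<inter> (N A A' + uminus ` A + N A A')"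
        by (rule Int_mono[OF sub TW(1)[OF A]])
      with hit have "({s} + N A A') \<inter> (N A A' + uminus ` A + N A A') \<noteq> {}"
        by (metis subset_empty)
      with N(2)[OF A, of s] have "({s} + N A A') \<inter> (N A A' + uminus ` A' + N A A') = {}" by metis
      moreover have "({s} + W) \<inter> T A' \<subseteq> ({s} + N A A') \<inter> (N A A' + uminus ` A' + N A A')"
        by (rule Int_mono[OF sub TW(2)[OF A(2,1) A(3)[symmetric]]])
      ultimately show "({s} + W) \<inter> T A' = {}" by (metis subset_empty)
    qed (use \<A> in auto)
    also have "\<dots> \<le> covnum W ?U3"
      using coverable_compact[OF cU3 W] by (rule covnum_mono) (use TU in blast)
    finally have sum_le: "real (\<Sum>A\<in>\<A>. covnum W (T A)) \<le> m * real (covnum W U)" using U3[OF W] by linarith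
    have "real (card \<A>) * (\<epsilon> * real (covnum W U)) = (\<Sum>A\<in>\<A>. \<epsilon> * real (covnum W U))" by simp
    also have "\<dots> \<le> (\<Sum>A\<in>\<A>. m * real (covnum W (T A)))" using each by (rule sum_mono)
    also have "\<dots> = m * real (\<Sum>A\<in>\<A>. covnum W (T A))" by (simp add: sum_distrib_left)
    also have "\<dots> \<le> m * (m * real (covnum W U))" using sum_le m0 by (rule mult_left_mono)
    finally have "(real (card \<A>) * \<epsilon>) * real (covnum W U) \<le> (m * m) * real (covnum W U)" by (simp add: mult_ac)
    then show ?thesis using covnum_U_pos[OF W] by simp
  qed
  show thesis
  proof
    show "m * m + 1 > 0" using m0 by (simp add: add_nonneg_pos)
  qed (rule main)
qed

text \<open>
  The union of a maximal disjoint family of compact sets that are not thin leaves room for thin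
  compact sets only.
\<close>

lemma inner_regularity:
  assumes "\<epsilon> > 0"
  obtains A where "compact A" "A \<subseteq> B" "\<And>A'. compact A' \<Longrightarrow> A' \<subseteq> B - A \<Longrightarrow> thin \<epsilon> A'"
proof -
  obtain C where C: "C > 0" "\<And>\<epsilon> \<A>. finite \<A> \<Longrightarrow> disjoint \<A> \<Longrightarrow>
    (\<And>A. A \<in> \<A> \<Longrightarrow> compact A \<and> A \<subseteq> U \<and> \<not> thin \<epsilon> A) \<Longrightarrow> real (card \<A>) * \<epsilon> \<le> C"
    using fat_disjoint_bound by metis
  define fam where "fam \<A> \<longleftrightarrow> finite \<A> \<and> disjoint \<A> \<and> (\<forall>A\<in>\<A>. compact A \<and> A \<subseteq> B \<and> \<not> thin \<epsilon> A)" for \<A>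
  have "card \<A> \<le> nat \<lceil>C / \<epsilon>\<rceil>" if "fam \<A>" for \<A>
  proof -
    have "real (card \<A>) * \<epsilon> \<le> C" using that B_subset_U by (intro C(2)) (auto simp: fam_def)
    then have "real (card \<A>) \<le> C / \<epsilon>" using assms by (simp add: field_simps)
    then show ?thesis by linarith
  qed
  moreover have "fam {}" by (simp add: fam_def)
  ultimately have "\<exists>\<A>. fam \<A> \<and> (\<forall>\<B>. fam \<B> \<longrightarrow> card \<B> \<le> card \<A>)"
    by (intro ex_has_greatest_nat[of fam "{}" card "Suc (nat \<lceil>C / \<epsilon>\<rceil>)"]) (auto intro: le_imp_less_Suc)
  then obtain \<A> where \<A>: "fam \<A>" "\<And>\<B>. fam \<B> \<Longrightarrow> card \<B> \<le> card \<A>" by auto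
  show thesis
  proof
    show "compact (\<Union>\<A>)" "\<Union>\<A> \<subseteq> B" using \<A>(1) by (auto simp: fam_def)
    fix A' assume A': "compact A'" "A' \<subseteq> B - \<Union>\<A>"
    show "thin \<epsilon> A'"
    proof (rule ccontr)
      assume fat: "\<not> thin \<epsilon> A'"
      have "A' \<noteq> {}"
      proof
        assume "A' = {}"
        have "covnum V {} = 0" for V :: "'a set" using covnum_le[of "{}" "{}" V] by simp
        then have "thin \<epsilon> A'" unfolding thin_def \<open>A' = {}\<close> using nbhd0_B assms by auto
        with fat show False by simp
      qed
      then have "A' \<notin> \<A>" using A' by auto
      have "fam (insert A' \<A>)"
        using \<A>(1) A' fat unfolding fam_def by (auto simp: disjoint_def disjnt_def pairwise_insert)
      then have "card (insert A' \<A>) \<le> card \<A>" by (rule \<A>(2))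
      then show False using \<A>(1) \<open>A' \<notin> \<A>\<close> by (simp add: fam_def)
    qed
  qed
qed

text \<open>
  Inner regularity speaks only about compact subsets of the open set \<open>B - A\<close>. This definition
  extends the bound to arbitrary sets, as an outer measure extends a content on open sets.
\<close>

definition outer_thin :: "real \<Rightarrow> 'a set \<Rightarrow> bool" where
  "outer_thin \<epsilon> E \<longleftrightarrow> (\<exists>D. open D \<and> E \<subseteq> D \<and> (\<forall>A. compact A \<and> A \<subseteq> D \<longrightarrow> thin \<epsilon> A))"

lemma outer_thinE:
  assumes "outer_thin \<epsilon> E"
  obtains D where "open D" "E \<subseteq> D" "\<And>A. compact A \<Longrightarrow> A \<subseteq> D \<Longrightarrow> thin \<epsilon> A"
proof -
  from assms obtain D where D: "open D \<and> E \<subseteq> D \<and> (\<forall>A. compact A \<and> A \<subseteq> D \<longrightarrow> thin \<epsilon> A)"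
    unfolding outer_thin_def ..
  show thesis by (rule that[OF D[THEN conjunct1] D[THEN conjunct2, THEN conjunct1]]) (use D in blast)
qed

lemma outer_thinI:
  "open D \<Longrightarrow> E \<subseteq> D \<Longrightarrow> (\<And>A. compact A \<Longrightarrow> A \<subseteq> D \<Longrightarrow> thin \<epsilon> A) \<Longrightarrow> outer_thin \<epsilon> E"
  unfolding outer_thin_def by (intro exI[of _ D]) simp

lemma outer_thin_mono:
  assumes "outer_thin \<epsilon> E" "E' \<subseteq> E"
  shows "outer_thin \<epsilon> E'"
proof (rule outer_thinE[OF assms(1)])
  fix D assume D: "open D" "E \<subseteq> D" "\<And>A. compact A \<Longrightarrow> A \<subseteq> D \<Longrightarrow> thin \<epsilon> A"
  show ?thesis by (rule outer_thinI[OF D(1) order_trans[OF assms(2) D(2)] D(3)])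
qed

lemma outer_thin_Un:
  assumes "outer_thin \<epsilon> E" "outer_thin \<delta> E'"
  shows "outer_thin (\<epsilon> + \<delta>) (E \<union> E')"
proof -
  obtain D where D: "open D" "E \<subseteq> D" "\<And>A. compact A \<Longrightarrow> A \<subseteq> D \<Longrightarrow> thin \<epsilon> A"
    using outer_thinE[OF assms(1)] by metis
  obtain D' where D': "open D'" "E' \<subseteq> D'" "\<And>A. compact A \<Longrightarrow> A \<subseteq> D' \<Longrightarrow> thin \<delta> A"
    using outer_thinE[OF assms(2)] by metis
  have "thin (\<epsilon> + \<delta>) A" if A: "compact A" "A \<subseteq> D \<union> D'" for A
  proof -
    obtain A1 A2 where "A = A1 \<union> A2" "compact A1" "compact A2" "A1 \<subseteq> D" "A2 \<subseteq> D'"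
      using compact_split_Un[OF A D(1) D'(1)] .
    then show ?thesis using D(3) D'(3) thin_Un by metis
  qed
  then show ?thesis
    by (rule outer_thinI[OF open_Un[OF D(1) D'(1)] Un_mono[OF D(2) D'(2)]])
qed

lemma outer_thin_translate:
  assumes "outer_thin \<epsilon> E"
  shows "outer_thin \<epsilon> ({g} + E)"
proof -
  obtain D where D: "open D" "E \<subseteq> D" "\<And>A. compact A \<Longrightarrow> A \<subseteq> D \<Longrightarrow> thin \<epsilon> A"
    using outer_thinE[OF assms(1)] by metis
  have "thin \<epsilon> A" if A: "compact A" "A \<subseteq> {g} + D" for A
  proof -
    have "{- g} + A \<subseteq> {- g} + ({g} + D)" using A by (intro set_plus_mono2) auto
    also have "\<dots> = D" by (auto simp: add.assoc[symmetric] set_plus_def)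
    finally have "thin \<epsilon> ({- g} + A)" using A by (intro D(3) compact_set_plus) auto
    then have "thin \<epsilon> ({g} + ({- g} + A))" by (rule thin_translate) (use A in \<open>auto intro: compact_set_plus\<close>)
    moreover have "{g} + ({- g} + A) = A" by (auto simp: add.assoc[symmetric] set_plus_def)
    ultimately show ?thesis by simp
  qed
  moreover have "{g} + E \<subseteq> {g} + D" using D by (intro set_plus_mono2) auto
  ultimately show ?thesis using outer_thinI[OF open_translate[OF D(1)]] by simp
qed

lemma outer_thin_conj:
  assumes "outer_thin \<epsilon> E" "\<epsilon> \<ge> 0"
  shows "outer_thin \<epsilon> ((\<lambda>x. g + x - g) ` E)"
proof -
  let ?c = "\<lambda>x. g + x - g" and ?d = "\<lambda>x. - g + x - - g"
  obtain D where D: "open D" "E \<subseteq> D" "\<And>A. compact A \<Longrightarrow> A \<subseteq> D \<Longrightarrow> thin \<epsilon> A"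
    using outer_thinE[OF assms(1)] by metis
  have "thin \<epsilon> A" if A: "compact A" "A \<subseteq> ?c ` D" for A
  proof -
    have "?d ` A \<subseteq> ?d ` ?c ` D" using A by (intro image_mono)
    also have "\<dots> = D" using conj_image_conj_image[of "- g" D] by simp
    finally have "thin \<epsilon> (?d ` A)" using A by (intro D(3) compact_conj_image)
    then have "thin \<epsilon> (?c ` ?d ` A)" using compact_conj_image[OF A(1)] assms(2) by (rule thin_conj)
    then show ?thesis by (simp only: conj_image_conj_image)
  qed
  moreover have "?c ` E \<subseteq> ?c ` D" using D by (intro image_mono)
  ultimately show ?thesis using outer_thinI[OF open_conj_image[OF D(1)]] by simp
qed


text \<open>
  The content of \<open>B - (t + B)\<close>. As a function of \<open>t\<close> it is subadditive, invariant under conjugation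
  and small near the identity, which is all that a bump function needs.
\<close>

definition displacement :: "'a \<Rightarrow> real" where
  "displacement t = Inf {\<epsilon>. 0 \<le> \<epsilon> \<and> outer_thin \<epsilon> (B - ({t} + B))}"

lemma outer_thin_B: "outer_thin 1 B"
proof -
  have "thin 1 A" if A: "compact A" "A \<subseteq> B" for A
  proof -
    have "real (covnum V A) \<le> 1 * real (covnum V U)" if "nbhd0 V" for V
      using covnum_mono[OF coverable_compact[OF compact_U that], of A] A(2) B_subset_U by simp
    then show ?thesis unfolding thin_def using nbhd0_B by blast
  qed
  then show ?thesis by (rule outer_thinI[OF open_interior order_refl])
qed

lemma displacement_set_nonempty: "{\<epsilon>. 0 \<le> \<epsilon> \<and> outer_thin \<epsilon> (B - ({t} + B))} \<noteq> {}"
proof -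
  have "outer_thin 1 (B - ({t} + B))" using outer_thin_B Diff_subset by (rule outer_thin_mono)
  then have "\<exists>\<epsilon>\<ge>0. outer_thin \<epsilon> (B - ({t} + B))" by (intro exI[of _ 1] conjI) simp_all
  then show ?thesis by (simp only: Collect_empty_eq) blast
qed

lemma displacement_nonneg: "displacement t \<ge> 0"
  unfolding displacement_def by (rule cInf_greatest[OF displacement_set_nonempty]) blast

lemma displacement_le:
  assumes "0 \<le> \<epsilon>" "outer_thin \<epsilon> (B - ({t} + B))"
  shows "displacement t \<le> \<epsilon>"
  unfolding displacement_def
proof (rule cInf_lower)
  show "bdd_below {\<epsilon>. 0 \<le> \<epsilon> \<and> outer_thin \<epsilon> (B - ({t} + B))}"
    by (rule bdd_belowI[of _ 0]) blast
qed (use assms in blast)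

lemma displacement_witness:
  assumes "displacement t < \<delta>"
  obtains \<epsilon> where "0 \<le> \<epsilon>" "\<epsilon> < \<delta>" "outer_thin \<epsilon> (B - ({t} + B))"
  using cInf_lessD[OF displacement_set_nonempty assms[unfolded displacement_def]] that by blast

lemma displacement_add: "displacement (s + t) \<le> displacement s + displacement t"
proof (rule field_le_epsilon)
  fix e :: real assume "e > 0"
  obtain \<epsilon> where \<epsilon>: "0 \<le> \<epsilon>" "\<epsilon> < displacement s + e / 2" "outer_thin \<epsilon> (B - ({s} + B))"
    using displacement_witness[of s "displacement s + e / 2"] \<open>e > 0\<close> by auto
  obtain \<delta> where \<delta>: "0 \<le> \<delta>" "\<delta> < displacement t + e / 2" "outer_thin \<delta> (B - ({t} + B))"
    using displacement_witness[of t "displacement t + e / 2"] \<open>e > 0\<close> by auto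
  have "B - ({s + t} + B) \<subseteq> (B - ({s} + B)) \<union> ({s} + (B - ({t} + B)))"
    by (auto simp: mem_translate_iff minus_add add.assoc diff_conv_add_uminus simp del: add_uminus_conv_diff)
  then have "outer_thin (\<epsilon> + \<delta>) (B - ({s + t} + B))"
    using outer_thin_Un[OF \<epsilon>(3) outer_thin_translate[OF \<delta>(3)]] outer_thin_mono by metis
  then have "displacement (s + t) \<le> \<epsilon> + \<delta>" using \<epsilon> \<delta> by (intro displacement_le) auto
  with \<epsilon> \<delta> show "displacement (s + t) \<le> displacement s + displacement t + e" by linarith
qed

lemma displacement_conj_le: "displacement (g + t - g) \<le> displacement t"
proof (rule field_le_epsilon)
  fix e :: real assume "e > 0"
  obtain \<epsilon> where \<epsilon>: "0 \<le> \<epsilon>" "\<epsilon> < displacement t + e" "outer_thin \<epsilon> (B - ({t} + B))"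
    using displacement_witness[of t "displacement t + e"] \<open>e > 0\<close> by auto
  have conj_mem: "- g + y + g \<in> B \<longleftrightarrow> y \<in> B" for y
    using mem_conj_iff[of y g B] conj_B[of g] by simp
  have "B - ({g + t - g} + B) \<subseteq> (\<lambda>x. g + x - g) ` (B - ({t} + B))"
  proof
    fix x assume "x \<in> B - ({g + t - g} + B)"
    then have x: "x \<in> B" "- (g + t - g) + x \<notin> B" by (auto simp: mem_translate_iff)
    have "- t + (- g + x + g) = - g + (- (g + t - g) + x) + g"
      by (simp add: minus_add diff_conv_add_uminus add.assoc del: add_uminus_conv_diff)
    then show "x \<in> (\<lambda>x. g + x - g) ` (B - ({t} + B))"
      using x conj_mem[of x] conj_mem[of "- (g + t - g) + x"] by (simp only: mem_conj_iff Diff_iff mem_translate_iff) simp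
  qed
  then have "outer_thin \<epsilon> (B - ({g + t - g} + B))"
    using outer_thin_conj[OF \<epsilon>(3,1)] outer_thin_mono by metis
  then have "displacement (g + t - g) \<le> \<epsilon>" using \<epsilon> by (intro displacement_le) auto
  with \<epsilon> show "displacement (g + t - g) \<le> displacement t + e" by linarith
qed

lemma displacement_conj: "displacement (g + t - g) = displacement t"
proof (rule antisym)
  have "t = - g + (g + t - g) - - g"
    by (simp add: diff_conv_add_uminus add.assoc del: add_uminus_conv_diff)
  then show "displacement t \<le> displacement (g + t - g)"
    using displacement_conj_le[of "- g" "g + t - g"] by simp
qed (rule displacement_conj_le)

text \<open>
  Most of \<open>B\<close> lies in a compact set \<open>A\<close>, and \<open>A\<close> stays inside \<open>t + B\<close> for small \<open>t\<close>.
\<close>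

lemma displacement_small:
  assumes "\<epsilon> > 0"
  obtains N where "open N" "0 \<in> N" "uminus ` N = N" "\<And>t. t \<in> N \<Longrightarrow> displacement t \<le> \<epsilon>"
proof -
  obtain A where A: "compact A" "A \<subseteq> B" "\<And>A'. compact A' \<Longrightarrow> A' \<subseteq> B - A \<Longrightarrow> thin \<epsilon> A'"
    using inner_regularity[OF assms] by metis
  obtain N where N: "open N" "0 \<in> N" "uminus ` N = N" "N + A + N \<subseteq> B"
    using two_sided_thickening[OF A(1) open_interior A(2)] by metis
  show thesis
  proof (rule that[OF N(1-3)])
    fix t assume "t \<in> N"
    have "A \<subseteq> {t} + B"
    proof
      fix a assume "a \<in> A"
      moreover have "- t \<in> N" using \<open>t \<in> N\<close> N(3) by blast
      ultimately have "- t + a + 0 \<in> N + A + N" using N(2) by (intro set_plus_intro)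
      then show "a \<in> {t} + B" using N(4) by (auto simp: mem_translate_iff)
    qed
    then have sub: "B - ({t} + B) \<subseteq> B - A" by (rule Diff_mono[OF order_refl])
    have "outer_thin \<epsilon> (B - A)"
      by (rule outer_thinI[OF open_Diff[OF open_interior compact_imp_closed[OF A(1)]] order_refl A(3)])
    from outer_thin_mono[OF this sub] show "displacement t \<le> \<epsilon>" using assms by (intro displacement_le) auto
  qed
qed

lemma displacement_zero: "displacement 0 = 0"
proof (rule antisym[OF field_le_epsilon displacement_nonneg])
  fix e :: real assume "e > 0"
  then obtain N where "0 \<in> N" "\<And>t. t \<in> N \<Longrightarrow> displacement t \<le> e"
    using displacement_small by metis
  then show "displacement 0 \<le> 0 + e" by simp
qed

text \<open>
  If \<open>t\<close> is outside \<open>U + U\<close>, then \<open>t + B\<close> misses \<open>B\<close>, and all of \<open>B\<close> is displaced.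
\<close>

lemma displacement_lower_bound:
  obtains m where "m > 0" "\<And>t. t \<notin> U + U \<Longrightarrow> displacement t \<ge> m"
proof -
  obtain N where N: "open N" "0 \<in> N" "uminus ` N = N" "N + N \<subseteq> B"
    using small_nbhd[of B] zero_U by auto
  have cl: "closure N \<subseteq> B"
  proof
    fix x assume "x \<in> closure N"
    moreover have "x \<in> {x} + N" using N(2) by (simp add: mem_translate_iff)
    ultimately have "({x} + N) \<inter> closure N \<noteq> {}" by blast
    then have "({x} + N) \<inter> N \<noteq> {}" by (simp add: open_Int_closure_eq_empty[OF open_translate[OF N(1)]])
    then obtain y where y: "y \<in> {x} + N" "y \<in> N" by (meson IntD1 IntD2 all_not_in_conv)
    then have "- x + y \<in> N" by (simp add: mem_translate_iff)
    moreover have "x = y + - (- x + y)" by (simp add: minus_add)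
    ultimately obtain n where n: "x = y + - n" "n \<in> N" "y \<in> N" using y by metis
    then have "- n \<in> N" using N(3) by blast
    then show "x \<in> B" using n N(4) by (metis set_plus_intro subsetD)
  qed
  have "compact (closure N)"
    using compact_Int_closed[OF compact_U closed_closure, of N] cl B_subset_U by (simp add: Int_absorb1 subset_trans)
  moreover have "0 \<in> interior (closure N)"
    using interior_maximal[OF closure_subset N(1)] N(2) by blast
  ultimately obtain m where m: "m > 0" "\<And>\<epsilon>. thin \<epsilon> (closure N) \<Longrightarrow> m \<le> \<epsilon>"
    using thin_lower_bound by metis
  show thesis
  proof
    fix t assume t: "t \<notin> U + U"
    have "B - ({t} + B) = B"
    proof -
      have False if x: "x \<in> B" "x \<in> {t} + B" for x
      proof -
        obtain b where "x = t + b" "b \<in> B" using x by (auto elim!: set_plus_elim)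
        then have "t = x + - b" by simp
        moreover have "- b \<in> U" using \<open>b \<in> B\<close> B_subset_U sym_U by blast
        ultimately show False using t x B_subset_U by (metis set_plus_intro subsetD)
      qed
      then show ?thesis by blast
    qed
    show "m \<le> displacement t"
    proof (rule ccontr)
      assume "\<not> m \<le> displacement t"
      then obtain \<epsilon> where \<epsilon>: "\<epsilon> < m" "outer_thin \<epsilon> (B - ({t} + B))"
        using displacement_witness[of t m] by auto
      then obtain D where "B \<subseteq> D" "\<And>A. compact A \<Longrightarrow> A \<subseteq> D \<Longrightarrow> thin \<epsilon> A"
        using \<open>B - ({t} + B) = B\<close> outer_thinE by metis
      then have "thin \<epsilon> (closure N)" using cl \<open>compact (closure N)\<close> by blast
      then show False using m(2) \<epsilon>(1) by force
    qed
  qed (rule m)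
qed

end

definition invariant_compact_nbhd :: "'a::topological_group_add set \<Rightarrow> bool" where
  "invariant_compact_nbhd K \<longleftrightarrow> compact K \<and> 0 \<in> interior K \<and> uminus ` K = K \<and>
     (\<forall>g. (\<lambda>x. g + x - g) ` K = K)"

text \<open>
  The bump is \<open>1 - displacement / m\<close>, cut off at \<open>0\<close>. The compact set \<open>K\<close> cannot be prescribed: a
  group with a compact invariant neighbourhood of the identity need not have small ones. In the
  last clause the neighbourhood \<open>N\<close> serves all \<open>g\<close>, so it controls left and right translates of
  all functions \<open>h(p\<^sup>-\<^sup>1 \<cdot>)\<close> at once.
\<close>

lemma IN_group_central_bump:
  assumes "IN_group TYPE('a::{topological_group_add, t2_space})"
  obtains h :: "'a::{topological_group_add, t2_space} \<Rightarrow> real" and K where "invariant_compact_nbhd K"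
    "h 0 = 1" "\<And>t. 0 \<le> h t" "\<And>t. h t \<le> 1" "\<And>t. t \<notin> K \<Longrightarrow> h t = 0"
    "\<And>\<epsilon>. \<epsilon> > 0 \<Longrightarrow> \<exists>N. open N \<and> 0 \<in> N \<and> (\<forall>v\<in>N. \<forall>g t. \<bar>h (g + v - g + t) - h t\<bar> \<le> \<epsilon>)"
proof -
  obtain U0 :: "'a set" where U0: "compact U0" "0 \<in> interior U0" "\<And>g. (\<lambda>x. g + x - g) ` U0 = U0"
    using assms unfolding IN_group_def by blast
  define U where "U = U0 \<inter> uminus ` U0"
  have conj_iff: "- g + x + g \<in> U0 \<longleftrightarrow> x \<in> U0" for g x
    using mem_conj_iff[of x g U0] U0(3)[of g] by simp
  have mem_uminus: "x \<in> uminus ` S \<longleftrightarrow> - x \<in> S" for x :: 'a and S by force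
  interpret invariant_nbhd U
  proof
    show "compact U" unfolding U_def
      using U0 by (intro compact_Int compact_uminus_image) auto
    have "open (interior U0 \<inter> uminus ` interior U0)" by (intro open_Int open_uminus_image) auto
    moreover have "interior U0 \<inter> uminus ` interior U0 \<subseteq> U"
      unfolding U_def by (rule Int_mono[OF interior_subset image_mono[OF interior_subset]])
    ultimately have "interior U0 \<inter> uminus ` interior U0 \<subseteq> interior U" by (rule interior_maximal[rotated])
    moreover have "0 \<in> interior U0 \<inter> uminus ` interior U0" using U0(2) by (simp add: mem_uminus)
    ultimately show "0 \<in> interior U" by (rule subsetD)
    show "uminus ` U = U" by (auto simp: U_def mem_uminus)
    fix g
    have "x \<in> (\<lambda>x. g + x - g) ` U \<longleftrightarrow> x \<in> U" for x
    proof -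
      have "- (- g + x + g) = - g + - x + g" by (simp add: minus_add add.assoc)
      then show ?thesis using conj_iff[of g x] conj_iff[of g "- x"] by (simp add: U_def mem_conj_iff mem_uminus)
    qed
    then show "(\<lambda>x. g + x - g) ` U = U" by blast
  qed
  obtain m where m: "m > 0" "\<And>t. t \<notin> U + U \<Longrightarrow> displacement t \<ge> m" using displacement_lower_bound by metis
  define h where "h t = max 0 (1 - displacement t / m)" for t
  have "U \<subseteq> U + U"
    using zero_U B_subset_U by (metis add_0_left set_plus_intro subsetD subsetI)
  show thesis
  proof
    have "(\<lambda>x. g + x - g) ` (U + U) = U + U" for g
    proof -
      have "x \<in> U + U" if x: "- g + x + g \<in> U + U" for x g
      proof -
        obtain u v where uv: "- g + x + g = u + v" "u \<in> U" "v \<in> U" using x by (rule set_plus_elim)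
        have "x = g + (- g + x + g) - g" by (simp add: diff_conv_add_uminus add.assoc del: add_uminus_conv_diff)
        also have "\<dots> = (g + u - g) + (g + v - g)" unfolding uv(1)
          by (simp add: diff_conv_add_uminus add.assoc del: add_uminus_conv_diff)
        also have "\<dots> \<in> U + U" using uv conj_U[of g] by (intro set_plus_intro) blast+
        finally show ?thesis .
      qed
      note * = this
      have "- g + x + g \<in> U + U" if "x \<in> U + U" for x
        using *[of "- g" "- g + x + g"] that by (simp add: add.assoc)
      with *[of g] show ?thesis using mem_conj_iff[of _ g "U + U"] by blast
    qed
    moreover have "uminus ` (U + U) = U + U"
    proof -
      have *: "- x \<in> U + U" if x: "x \<in> U + U" for x
      proof -
        obtain u v where uv: "x = u + v" "u \<in> U" "v \<in> U" using x by (rule set_plus_elim)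
        have "- v + - u \<in> U + U" using uv sym_U by (intro set_plus_intro) blast+
        then show ?thesis by (simp add: uv minus_add)
      qed
      have "x \<in> uminus ` (U + U)" if "x \<in> U + U" for x
        using *[OF that] by (simp add: mem_uminus)
      with * show ?thesis by blast
    qed
    moreover have "0 \<in> interior (U + U)"
      using zero_U interior_mono[OF \<open>U \<subseteq> U + U\<close>] by blast
    ultimately show "invariant_compact_nbhd (U + U)"
      using compact_set_plus[OF compact_U compact_U] by (auto simp: invariant_compact_nbhd_def)
    show "h 0 = 1" by (simp add: h_def displacement_zero)
    show "0 \<le> h t" for t by (simp add: h_def)
    show "h t \<le> 1" for t using displacement_nonneg m(1) by (simp add: h_def)
    show "h t = 0" if "t \<notin> U + U" for t using m(1) m(2)[OF that] by (simp add: h_def)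
    fix \<epsilon> :: real assume "\<epsilon> > 0"
    obtain N where N: "open N" "0 \<in> N" "uminus ` N = N" "\<And>t. t \<in> N \<Longrightarrow> displacement t \<le> \<epsilon> * m"
      using displacement_small[OF mult_pos_pos[OF \<open>\<epsilon> > 0\<close> m(1)]] by metis
    have "\<bar>h (g + v - g + t) - h t\<bar> \<le> \<epsilon>" if "v \<in> N" for v g t
    proof -
      let ?w = "g + v - g"
      have "- v \<in> N" using that N(3) by blast
      have "displacement (?w + t) \<le> displacement v + displacement t"
        using displacement_add[of ?w t] displacement_conj[of g v] by simp
      moreover have "displacement t \<le> displacement (- v) + displacement (?w + t)"
      proof -
        have "t = (g + - v - g) + (?w + t)"
          by (simp add: diff_conv_add_uminus add.assoc del: add_uminus_conv_diff)
        then show ?thesis using displacement_add[of "g + - v - g" "?w + t"] displacement_conj[of g "- v"] by simp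
      qed
      ultimately have "\<bar>displacement (?w + t) - displacement t\<bar> \<le> \<epsilon> * m"
        using N(4)[OF that] N(4)[OF \<open>- v \<in> N\<close>] by linarith
      then have "\<bar>displacement (?w + t) - displacement t\<bar> / m \<le> \<epsilon>"
        using m(1) by (simp only: pos_divide_le_eq)
      then have "\<bar>displacement (?w + t) / m - displacement t / m\<bar> \<le> \<epsilon>"
        using m(1) by (simp only: diff_divide_distrib[symmetric] abs_divide abs_of_pos)
      then show ?thesis unfolding h_def by linarith
    qed
    then show "\<exists>N. open N \<and> 0 \<in> N \<and> (\<forall>v\<in>N. \<forall>g t. \<bar>h (g + v - g + t) - h t\<bar> \<le> \<epsilon>)"
      by (intro exI[of _ N] conjI N(1,2) ballI allI)
  qed
qed

section \<open>A criterion for weak almost periodicity\<close>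

lemma CB_functional_linear:
  assumes "CB_functional \<phi>"
  shows "\<phi> (f + g) = \<phi> f + \<phi> g" "\<phi> (f - g) = \<phi> f - \<phi> g" "\<phi> 0 = 0"
    "\<phi> (\<Sum>i\<in>I. u i) = (\<Sum>i\<in>I. \<phi> (u i))"
proof -
  interpret Vector_Spaces.linear cscale "(*)" \<phi> using assms by (simp add: CB_functional_def)
  show "\<phi> (f + g) = \<phi> f + \<phi> g" "\<phi> (f - g) = \<phi> f - \<phi> g" "\<phi> 0 = 0"
    "\<phi> (\<Sum>i\<in>I. u i) = (\<Sum>i\<in>I. \<phi> (u i))"
    by (rule add diff zero sum)+
qed

lemma CB_functional_bound:
  assumes "CB_functional \<phi>"
  obtains C where "C > 0" "\<And>f. cmod (\<phi> f) \<le> C * norm f"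
proof -
  obtain C where C: "\<And>f. cmod (\<phi> f) \<le> C * norm f" using assms by (auto simp: CB_functional_def)
  show thesis
  proof
    show "cmod (\<phi> f) \<le> (\<bar>C\<bar> + 1) * norm f" for f
      using C[of f] mult_right_mono[of C "\<bar>C\<bar> + 1" "norm f"] norm_ge_zero[of f] by linarith
  qed simp
qed

lemma CB_functional_eval: "CB_functional (\<lambda>f. apply_bcontfun f t)"
proof -
  have "Vector_Spaces.linear cscale (*) (\<lambda>f. apply_bcontfun f t)"
    unfolding Vector_Spaces.linear_def module_hom_def module_hom_axioms_def
    by (auto simp: plus_bcontfun.rep_eq cscale.rep_eq intro: CB.module_axioms CB.vector_space_axioms
        vector_space_over_itself.vector_space_axioms vector_space_over_itself.module_axioms)
  moreover have "\<exists>C. \<forall>f. cmod (apply_bcontfun f t) \<le> C * norm f"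
    by (rule exI[of _ 1]) (simp add: norm_bounded)
  ultimately show ?thesis by (simp add: CB_functional_def)
qed

lemma topspace_CB_weak_topology: "topspace (CB_weak_topology :: ('a::topological_space \<Rightarrow>\<^sub>C complex) topology) = UNIV"
proof -
  have "(UNIV :: ('a \<Rightarrow>\<^sub>C complex) set) \<in> {\<phi> -` V | \<phi> V. CB_functional \<phi> \<and> open V}"
    using CB_functional_eval open_UNIV by (metis (mono_tags, lifting) mem_Collect_eq vimage_UNIV)
  then show ?thesis unfolding CB_weak_topology_def by auto
qed

lemma Hausdorff_CB_weak_topology: "Hausdorff_space (CB_weak_topology :: ('a::topological_space \<Rightarrow>\<^sub>C complex) topology)"
  unfolding Hausdorff_space_def
proof (intro allI impI)
  fix f g :: "'a \<Rightarrow>\<^sub>C complex"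
  assume "f \<in> topspace CB_weak_topology \<and> g \<in> topspace CB_weak_topology \<and> f \<noteq> g"
  then obtain t where "apply_bcontfun f t \<noteq> apply_bcontfun g t" by (metis bcontfun_eqI)
  then obtain V W where VW: "open V" "open W" "apply_bcontfun f t \<in> V" "apply_bcontfun g t \<in> W" "V \<inter> W = {}"
    using hausdorff by metis
  let ?e = "\<lambda>f::'a \<Rightarrow>\<^sub>C complex. apply_bcontfun f t"
  have "openin CB_weak_topology (?e -` S)" if "open S" for S
    unfolding CB_weak_topology_def using that CB_functional_eval
    by (intro topology_generated_by_Basis) blast
  then show "\<exists>U V. openin CB_weak_topology U \<and> openin CB_weak_topology V \<and> f \<in> U \<and> g \<in> V \<and> disjnt U V"
    using VW by (intro exI[of _ "?e -` V"] exI[of _ "?e -` W"]) (auto simp: disjnt_def)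
qed

text \<open>
  The canonical image of \<open>f\<close> in the bidual, as a point of the product of all scalar fields. The
  index set consists of all maps to the scalars, so that the product is a full function type;
  coordinates that do not belong to a functional carry the value \<open>0\<close>.
\<close>

definition bidual :: "('a::topological_space \<Rightarrow>\<^sub>C complex) \<Rightarrow> (('a \<Rightarrow>\<^sub>C complex) \<Rightarrow> complex) \<Rightarrow> complex" where
  "bidual f \<phi> = (if CB_functional \<phi> then \<phi> f else 0)"

lemma inj_bidual: "bidual f = bidual g \<Longrightarrow> f = g"
proof (rule bcontfun_eqI)
  fix t assume "bidual f = bidual g"
  then have "bidual f (\<lambda>f. apply_bcontfun f t) = bidual g (\<lambda>f. apply_bcontfun f t)" by simp
  then show "apply_bcontfun f t = apply_bcontfun g t" by (simp add: bidual_def CB_functional_eval)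
qed

lemma compact_closure_bidual:
  fixes M :: "('a::topological_space \<Rightarrow>\<^sub>C complex) set"
  assumes "\<And>f. f \<in> M \<Longrightarrow> norm f \<le> c"
  shows "compact (closure (bidual ` M))"
proof -
  have "\<exists>C. \<forall>f. CB_functional \<phi> \<longrightarrow> cmod (\<phi> f) \<le> C * norm f \<and> C > 0" for \<phi> :: "('a \<Rightarrow>\<^sub>C complex) \<Rightarrow> complex"
    using CB_functional_bound by metis
  then obtain C where C: "\<And>\<phi> f. CB_functional \<phi> \<Longrightarrow> cmod (\<phi> f) \<le> C \<phi> * norm f"
    "\<And>\<phi> :: ('a \<Rightarrow>\<^sub>C complex) \<Rightarrow> complex. CB_functional \<phi> \<Longrightarrow> C \<phi> > 0" by metis
  let ?Box = "PiE UNIV (\<lambda>\<phi> :: ('a \<Rightarrow>\<^sub>C complex) \<Rightarrow> complex. cball (0::complex) (\<bar>C \<phi>\<bar> * \<bar>c\<bar>))"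
  have "compactin (product_topology (\<lambda>\<phi>. euclidean) UNIV) ?Box"
    by (simp add: compactin_PiE)
  then have Box: "compact ?Box" by (simp add: euclidean_product_topology)
  have "bidual ` M \<subseteq> ?Box"
  proof -
    have "cmod (bidual f \<phi>) \<le> \<bar>C \<phi>\<bar> * \<bar>c\<bar>" if "f \<in> M" for f \<phi>
    proof (cases "CB_functional \<phi>")
      case True
      have "cmod (\<phi> f) \<le> C \<phi> * norm f" by (rule C(1)[OF True])
      also have "\<dots> \<le> \<bar>C \<phi>\<bar> * \<bar>c\<bar>" using assms[OF that] by (intro mult_mono) auto
      finally show ?thesis using True by (simp add: bidual_def)
    qed (simp add: bidual_def)
    then show ?thesis by (auto simp: PiE_UNIV_domain)
  qed
  then have "closure (bidual ` M) \<subseteq> ?Box"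
  proof (rule closure_minimal)
    have "closedin (product_topology (\<lambda>\<phi>. euclidean) UNIV) ?Box"
      by (simp add: closedin_product_topology)
    then show "closed ?Box" by (simp add: euclidean_product_topology)
  qed
  with Box show ?thesis by (metis closed_closure compact_Int_closed inf.absorb_iff2)
qed

text \<open>
  By Tychonoff's theorem a bounded set has compact closure in the product. If that closure consists
  of evaluations at elements of the space, it is a weakly compact set of elements.
\<close>

lemma weakly_compact_closure:
  fixes M :: "('a::topological_space \<Rightarrow>\<^sub>C complex) set"
  assumes bdd: "\<And>f. f \<in> M \<Longrightarrow> norm f \<le> c"
    and lim: "\<And>\<Lambda>. \<Lambda> \<in> closure (bidual ` M) \<Longrightarrow> \<exists>g. \<Lambda> = bidual g"
  shows "compactin CB_weak_topology (CB_weak_topology closure_of M)"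
proof -
  let ?Q = "closure (bidual ` M)"
  obtain R where R: "\<And>\<Lambda>. \<Lambda> \<in> ?Q \<Longrightarrow> bidual (R \<Lambda>) = \<Lambda>" using lim by metis
  have "continuous_map (top_of_set ?Q) CB_weak_topology R"
    unfolding CB_weak_topology_def
  proof (rule continuous_on_generated_topo)
    fix S :: "('a \<Rightarrow>\<^sub>C complex) set" assume "S \<in> {\<phi> -` V | \<phi> V. CB_functional \<phi> \<and> open V}"
    then obtain \<phi> V where S: "S = \<phi> -` V" "CB_functional \<phi>" "open V" by auto
    have "\<phi> (R \<Lambda>) = \<Lambda> \<phi>" if "\<Lambda> \<in> ?Q" for \<Lambda>
      using fun_cong[OF R[OF that], of \<phi>] S(2) by (simp add: bidual_def)
    then have "R -` S \<inter> ?Q = ?Q \<inter> (\<lambda>\<Lambda>. \<Lambda> \<phi>) -` V" unfolding S(1) by auto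
    moreover have "open ((\<lambda>\<Lambda>. \<Lambda> \<phi>) -` V)"
      by (rule open_vimage[OF S(3)]) (rule continuous_on_product_coordinates)
    ultimately show "openin (top_of_set ?Q) (R -` S \<inter> topspace (top_of_set ?Q))"
      by (simp add: openin_open_Int)
  next
    show "R ` topspace (top_of_set ?Q) \<subseteq> \<Union> {\<phi> -` V | \<phi> V. CB_functional \<phi> \<and> open V}"
      using topspace_CB_weak_topology[where ?'a='a] unfolding CB_weak_topology_def by simp
  qed
  moreover have "compactin (top_of_set ?Q) ?Q"
    using compact_closure_bidual[of M c] bdd by (simp add: compactin_subtopology)
  ultimately have cRQ: "compactin CB_weak_topology (R ` ?Q)" by (rule image_compactin[rotated])
  have "M \<subseteq> R ` ?Q"
  proof
    fix f assume "f \<in> M"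
    then have Q: "bidual f \<in> ?Q" by (rule subsetD[OF closure_subset imageI])
    have "R (bidual f) = f" by (rule inj_bidual[OF R[OF Q]])
    then show "f \<in> R ` ?Q" using imageI[OF Q, of R] by simp
  qed
  then have "CB_weak_topology closure_of M \<subseteq> R ` ?Q"
    using compactin_imp_closedin[OF Hausdorff_CB_weak_topology cRQ] by (rule closure_of_minimal)
  with cRQ show ?thesis by (rule closed_compactin) simp
qed

lemma uniform_limit_on_compact:
  fixes f :: "'a::topological_group_add \<Rightarrow> complex"
  assumes T: "compact T"
    and lim: "\<And>t. ((\<lambda>s. f (s + t)) \<longlongrightarrow> g t) F"
    and unif: "\<And>\<epsilon>. \<epsilon> > 0 \<Longrightarrow> \<exists>N. open N \<and> 0 \<in> N \<and> (\<forall>v\<in>N. \<forall>t. cmod (f (t + v) - f t) \<le> \<epsilon>)"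
    and unif_g: "\<And>\<epsilon>. \<epsilon> > 0 \<Longrightarrow> \<exists>N. open N \<and> 0 \<in> N \<and> (\<forall>v\<in>N. \<forall>t. cmod (g (t + v) - g t) \<le> \<epsilon>)"
    and "\<epsilon> > 0"
  shows "eventually (\<lambda>s. \<forall>t\<in>T. cmod (f (s + t) - g t) \<le> \<epsilon>) F"
proof -
  obtain N1 where N1: "open N1" "0 \<in> N1" "\<And>v t. v \<in> N1 \<Longrightarrow> cmod (f (t + v) - f t) \<le> \<epsilon> / 3"
    using unif[of "\<epsilon> / 3"] \<open>\<epsilon> > 0\<close> by auto
  obtain N2 where N2: "open N2" "0 \<in> N2" "\<And>v t. v \<in> N2 \<Longrightarrow> cmod (g (t + v) - g t) \<le> \<epsilon> / 3"
    using unif_g[of "\<epsilon> / 3"] \<open>\<epsilon> > 0\<close> by auto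
  let ?M = "\<lambda>t. (\<lambda>x. - t + x) -` (N1 \<inter> N2)"
  have "open (?M t)" for t using N1 N2 by (intro open_vimage open_Int continuous_intros)
  moreover have "T \<subseteq> (\<Union>t\<in>T. ?M t)" using N1(2) N2(2) by auto
  ultimately obtain D where D: "D \<subseteq> T" "finite D" "T \<subseteq> (\<Union>t\<in>D. ?M t)"
    by (rule compactE_image[OF T])
  have "eventually (\<lambda>s. \<forall>t\<in>D. cmod (f (s + t) - g t) < \<epsilon> / 3) F"
    using tendstoD[OF lim, of "\<epsilon> / 3"] \<open>\<epsilon> > 0\<close>
    by (intro eventually_ball_finite[OF D(2)] ballI) (simp only: dist_norm zero_less_divide_iff, simp)
  then show ?thesis
  proof (rule eventually_mono)
    fix s assume s: "\<forall>t\<in>D. cmod (f (s + t) - g t) < \<epsilon> / 3"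
    show "\<forall>t\<in>T. cmod (f (s + t) - g t) \<le> \<epsilon>"
    proof
      fix t assume "t \<in> T"
      then obtain d where d: "d \<in> D" "- d + t \<in> N1 \<inter> N2" using D(3) by auto
      have td: "d + (- d + t) = t" by (simp add: add.assoc[symmetric])
      have 1: "cmod (f (s + t) - f (s + d)) \<le> \<epsilon> / 3"
        using N1(3)[of "- d + t" "s + d"] d(2) by (simp add: add.assoc td)
      have 2: "cmod (g t - g d) \<le> \<epsilon> / 3" using N2(3)[of "- d + t" d] d(2) by (simp add: td)
      have 3: "cmod (f (s + d) - g d) < \<epsilon> / 3" using s d(1) by blast
      have "f (s + t) - g t = (f (s + t) - f (s + d)) + (f (s + d) - g d) - (g t - g d)" by simp
      also have "cmod \<dots> \<le> cmod (f (s + t) - f (s + d)) + cmod (f (s + d) - g d) + cmod (g t - g d)"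
        using norm_triangle_ineq4 norm_triangle_ineq by (meson add_right_mono order_trans)
      finally show "cmod (f (s + t) - g t) \<le> \<epsilon>" using 1 2 3 by linarith
    qed
  qed
qed

text \<open>
  Only the first two indices with a nonzero value can contribute more than \<open>1 / n\<close>.
\<close>

lemma bounded_overlap_sum:
  fixes u :: "nat \<Rightarrow> 'a \<Rightarrow> real"
  assumes nonneg: "\<And>k. 0 \<le> u k t" and c: "\<And>k. u k t \<le> c" and "n > 0"
    and third: "\<And>i j k. i < j \<Longrightarrow> j < k \<Longrightarrow> k < n \<Longrightarrow> u i t \<noteq> 0 \<Longrightarrow> u j t \<noteq> 0 \<Longrightarrow> u k t \<le> 1 / real n"
  shows "(\<Sum>k<n. u k t) \<le> 2 * c + 1"
proof -
  define S where "S = {k. k < n \<and> u k t > 1 / real n}"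
  have fS: "finite S" by (simp add: S_def)
  have c0: "c \<ge> 0" using nonneg[of 0] c[of 0] by linarith
  have cS: "card S \<le> 2"
  proof (rule ccontr)
    assume "\<not> card S \<le> 2"
    then obtain T where T: "T \<subseteq> S" "card T = 3" using obtain_subset_with_card_n[of 3 S] by auto
    then have fT: "finite T" using fS finite_subset by blast
    define i where "i = Min T"
    have i: "i \<in> T" using T fT by (auto simp: i_def intro!: Min_in)
    define k where "k = Max T"
    have k: "k \<in> T" using T fT by (auto simp: k_def intro!: Max_in)
    have "card (T - {i, k}) > 0"
    proof -
      have "card T \<le> card ((T - {i, k}) \<union> {i, k})" using fT by (intro card_mono) auto
      also have "\<dots> \<le> card (T - {i, k}) + card {i, k}" by (rule card_Un_le)
      finally have "card T \<le> card (T - {i, k}) + card {i, k}" .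
      moreover have "card {i, k} \<le> 2" by (simp add: card_insert_if)
      ultimately show ?thesis using T by linarith
    qed
    then obtain j where j: "j \<in> T" "j \<noteq> i" "j \<noteq> k" by (auto simp: card_gt_0_iff)
    have "i \<le> j" "j \<le> k" using j fT by (auto simp: i_def k_def)
    with j have "i < j" "j < k" by auto
    moreover have pos: "1 / real n > 0" using \<open>n > 0\<close> by simp
    have "u x t > 1 / real n" "x < n" if "x \<in> T" for x using T that by (auto simp: S_def)
    with i j k pos have "u i t \<noteq> 0" "u j t \<noteq> 0" "k < n" "u k t > 1 / real n" by force+
    ultimately show False using third[of i j k] by linarith
  qed
  have "(\<Sum>k<n. u k t) \<le> (\<Sum>k<n. (if k \<in> S then c else 0) + 1 / real n)"
    using c nonneg \<open>n > 0\<close> by (intro sum_mono) (auto simp: S_def intro: add_increasing2 add_increasing order_trans)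
  also have "\<dots> = c * real (card S) + 1"
    using \<open>n > 0\<close> by (simp add: sum.distrib sum.If_cases S_def Int_def conj_commute lessThan_def)
  also have "\<dots> \<le> c * 2 + 1" using cS c0 by (intro add_right_mono mult_left_mono) auto
  finally show ?thesis by (simp add: mult.commute)
qed

lemma apply_bcontfun_sum: "apply_bcontfun (\<Sum>i\<in>I. u i) t = (\<Sum>i\<in>I. apply_bcontfun (u i) t)"
  by (induction I rule: infinite_finite_induct) (auto simp: plus_bcontfun.rep_eq)

definition uniformly_continuous_left :: "('a::topological_group_add \<Rightarrow> complex) \<Rightarrow> bool" where
  "uniformly_continuous_left f \<longleftrightarrow>
     (\<forall>\<epsilon>>0. \<exists>N. open N \<and> 0 \<in> N \<and> (\<forall>v\<in>N. \<forall>t. cmod (f (v + t) - f t) \<le> \<epsilon>))"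

definition uniformly_continuous_right :: "('a::topological_group_add \<Rightarrow> complex) \<Rightarrow> bool" where
  "uniformly_continuous_right f \<longleftrightarrow>
     (\<forall>\<epsilon>>0. \<exists>N. open N \<and> 0 \<in> N \<and> (\<forall>v\<in>N. \<forall>t. cmod (f (t + v) - f t) \<le> \<epsilon>))"

lemma uniformly_continuous_right_continuous:
  fixes g :: "'a::topological_group_add \<Rightarrow> complex"
  assumes "uniformly_continuous_right g"
  shows "continuous_on UNIV g"
  unfolding continuous_on_def
proof (rule ballI)
  fix t0
  show "(g \<longlongrightarrow> g t0) (at t0)"
  proof (rule tendstoI)
    fix e :: real assume "e > 0"
    then obtain N where N: "open N" "0 \<in> N" "\<And>v t. v \<in> N \<Longrightarrow> cmod (g (t + v) - g t) \<le> e / 2"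
      using assms unfolding uniformly_continuous_right_def by (metis half_gt_zero)
    have "dist (g t) (g t0) < e" if "t \<in> (\<lambda>t. - t0 + t) -` N" for t
    proof -
      have "t0 + (- t0 + t) = t" by (simp add: add.assoc[symmetric])
      then show ?thesis using N(3)[of "- t0 + t" t0] that \<open>e > 0\<close> by (simp add: dist_norm)
    qed
    moreover have "open ((\<lambda>t. - t0 + t) -` N)" using N(1) by (intro open_vimage continuous_intros)
    moreover have "t0 \<in> (\<lambda>t. - t0 + t) -` N" using N(2) by simp
    ultimately show "eventually (\<lambda>t. dist (g t) (g t0) < e) (at t0)"
      unfolding eventually_at_topological by (intro exI[of _ "(\<lambda>t. - t0 + t) -` N"]) simp
  qed
qed

lemma eventually_escapes_compact:
  assumes "\<And>x. inf (nhds x) F = bot" "compact C"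
  shows "eventually (\<lambda>x. x \<notin> C) F"
proof (rule ccontr)
  assume *: "\<not> eventually (\<lambda>x. x \<notin> C) F"
  have "inf F (principal C) \<noteq> bot"
  proof
    assume "inf F (principal C) = bot"
    then have "eventually (\<lambda>x. False) (inf F (principal C))" by simp
    then show False using * by (simp add: eventually_inf_principal)
  qed
  moreover have "eventually (\<lambda>x. x \<in> C) (inf F (principal C))" by (simp add: eventually_inf_principal)
  ultimately obtain x where "inf (nhds x) (inf F (principal C)) \<noteq> bot"
    using assms(2) unfolding compact_filter by blast
  moreover have "inf (nhds x) (inf F (principal C)) = bot"
    using assms(1)[of x] by (metis inf_assoc inf_bot_left)
  ultimately show False by simp
qed

lemma ltranslate_tendsto:
  fixes f :: "'a::topological_group_add \<Rightarrow>\<^sub>C complex"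
  assumes \<phi>: "CB_functional \<phi>" and left: "uniformly_continuous_left (apply_bcontfun f)"
  shows "((\<lambda>s. \<phi> (ltranslate s f)) \<longlongrightarrow> \<phi> (ltranslate s0 f)) (nhds s0)"
proof (rule tendstoI)
  fix e :: real assume "e > 0"
  obtain C where C: "C > 0" "\<And>f. cmod (\<phi> f) \<le> C * norm f" using CB_functional_bound[OF \<phi>] by metis
  have "e / (2 * C) > 0" using \<open>e > 0\<close> C(1) by simp
  then obtain N where N: "open N" "0 \<in> N"
    "\<And>v t. v \<in> N \<Longrightarrow> cmod (apply_bcontfun f (v + t) - apply_bcontfun f t) \<le> e / (2 * C)"
    using left unfolding uniformly_continuous_left_def by metis
  have "dist (\<phi> (ltranslate s f)) (\<phi> (ltranslate s0 f)) < e" if "s \<in> (\<lambda>s. s - s0) -` N" for s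
  proof -
    have "norm (ltranslate s f - ltranslate s0 f) \<le> e / (2 * C)"
    proof (rule norm_bound)
      fix t
      have "s - s0 + (s0 + t) = s + t" by (simp add: add.assoc[symmetric])
      then show "norm (apply_bcontfun (ltranslate s f - ltranslate s0 f) t) \<le> e / (2 * C)"
        using N(3)[of "s - s0" "s0 + t"] that by (simp add: minus_bcontfun.rep_eq ltranslate.rep_eq)
    qed
    then have "C * norm (ltranslate s f - ltranslate s0 f) \<le> C * (e / (2 * C))"
      using C(1) by (intro mult_left_mono) auto
    then have "cmod (\<phi> (ltranslate s f - ltranslate s0 f)) \<le> e / 2"
      using C(2)[of "ltranslate s f - ltranslate s0 f"] C(1) by simp
    then show ?thesis using \<open>e > 0\<close> by (simp add: dist_norm CB_functional_linear(2)[OF \<phi>])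
  qed
  moreover have "open ((\<lambda>s. s - s0) -` N)"
    unfolding diff_conv_add_uminus using N(1) by (intro open_vimage continuous_intros)
  moreover have "s0 \<in> (\<lambda>s. s - s0) -` N" using N(2) by simp
  ultimately show "eventually (\<lambda>s. dist (\<phi> (ltranslate s f)) (\<phi> (ltranslate s0 f)) < e) (nhds s0)"
    unfolding eventually_nhds by (intro exI[of _ "(\<lambda>s. s - s0) -` N"]) simp
qed

text \<open>
  If \<open>F\<close> has a cluster point \<open>s0\<close>, the limit is the translate by \<open>s0\<close>. Otherwise \<open>F\<close> escapes from
  every compact set. Then the pointwise limit \<open>g\<close> has compact support, because \<open>s + t0\<close> and
  \<open>s + t\<close> lie in the support of \<open>f\<close> for \<open>s\<close> arbitrarily far away only if \<open>- t0 + t \<in> K\<close>. Suppose a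
  functional saw a difference \<open>L \<noteq> 0\<close> between \<open>g\<close> and the limit of the translates. Choose
  translates \<open>\<sigma> 0, \<sigma> 1, \<dots>\<close> one after the other, each so far away that it is small, up to \<open>g\<close>, on
  the compact sets on which two of its predecessors are both nonzero. Then the sum of \<open>n\<close>
  differences has norm at most \<open>2 * norm f + 1\<close>, although the functional has absolute value at
  least \<open>n * \<bar>L\<bar> / 2\<close> on it.
\<close>

lemma almost_disjoint_translates_weak_limit:
  fixes f :: "'a::topological_group_add \<Rightarrow>\<^sub>C complex" and F :: "'a filter"
  defines "f' \<equiv> apply_bcontfun f"
  assumes F: "F \<noteq> bot"
    and lim: "\<And>\<phi>. CB_functional \<phi> \<Longrightarrow> ((\<lambda>s. \<phi> (ltranslate s f)) \<longlongrightarrow> \<Lambda> \<phi>) F"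
    and left: "uniformly_continuous_left f'" and right: "uniformly_continuous_right f'"
    and K: "compact K"
    and almost_disjoint_left: "\<And>z. z \<notin> K \<Longrightarrow> \<exists>T. compact T \<and> {x. f' x \<noteq> 0 \<and> f' (z + x) \<noteq> 0} \<subseteq> T"
    and almost_disjoint_right: "\<And>z. z \<notin> K \<Longrightarrow> \<exists>T. compact T \<and> {x. f' x \<noteq> 0 \<and> f' (x + z) \<noteq> 0} \<subseteq> T"
  shows "\<exists>g. \<forall>\<phi>. CB_functional \<phi> \<longrightarrow> \<Lambda> \<phi> = \<phi> g"
proof (cases "\<exists>s0. inf (nhds s0) F \<noteq> bot")
  case True
  then obtain s0 where s0: "inf (nhds s0) F \<noteq> bot" by blast
  have "\<Lambda> \<phi> = \<phi> (ltranslate s0 f)" if "CB_functional \<phi>" for \<phi>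
    using tendsto_unique[OF s0 tendsto_mono[OF inf_le2 lim[OF that]]
        tendsto_mono[OF inf_le1 ltranslate_tendsto[OF that left[unfolded f'_def]]]] .
  then show ?thesis by blast
next
  case False
  then have escape: "eventually (\<lambda>s. s \<notin> C) F" if "compact C" for C
    using eventually_escapes_compact[OF _ that] by blast
  define g where "g t = \<Lambda> (\<lambda>h. apply_bcontfun h t)" for t
  have g: "((\<lambda>s. f' (s + t)) \<longlongrightarrow> g t) F" for t
    using lim[OF CB_functional_eval[of t]] by (simp add: g_def f'_def ltranslate.rep_eq)
  have f'_le: "cmod (f' t) \<le> norm f" for t unfolding f'_def by (rule norm_bounded)
  have g_le: "cmod (g t) \<le> norm f" for t
    by (rule tendsto_upperbound[OF tendsto_norm[OF g] _ F]) (simp add: f'_le)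
  have right_g: "uniformly_continuous_right g"
    unfolding uniformly_continuous_right_def
  proof (intro allI impI)
    fix \<epsilon> :: real assume "\<epsilon> > 0"
    then obtain N where N: "open N" "0 \<in> N" "\<And>v t. v \<in> N \<Longrightarrow> cmod (f' (t + v) - f' t) \<le> \<epsilon>"
      using right unfolding uniformly_continuous_right_def by metis
    have "cmod (g (t + v) - g t) \<le> \<epsilon>" if "v \<in> N" for v t
    proof (rule tendsto_upperbound[OF tendsto_norm[OF tendsto_diff[OF g g]] _ F])
      show "eventually (\<lambda>s. cmod (f' (s + (t + v)) - f' (s + t)) \<le> \<epsilon>) F"
        using N(3)[OF that] by (simp add: add.assoc[symmetric])
    qed
    with N show "\<exists>N. open N \<and> 0 \<in> N \<and> (\<forall>v\<in>N. \<forall>t. cmod (g (t + v) - g t) \<le> \<epsilon>)" by blast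
  qed
  define G where "G = Bcontfun g"
  have G: "apply_bcontfun G = g"
    unfolding G_def
    by (rule Bcontfun_inverse, rule bcontfun_normI[OF uniformly_continuous_right_continuous[OF right_g] g_le])
  have uniform: "eventually (\<lambda>s. \<forall>t\<in>T. cmod (f' (s + t) - g t) \<le> \<epsilon>) F" if "compact T" "\<epsilon> > 0" for T \<epsilon>
    by (rule uniform_limit_on_compact[OF that(1) g _ _ that(2)])
       (use right right_g in \<open>simp_all add: uniformly_continuous_right_def\<close>)
  have "\<exists>D. compact D \<and> (\<forall>t. g t \<noteq> 0 \<longrightarrow> t \<in> D)"
  proof (cases "\<exists>t0. g t0 \<noteq> 0")
    case True
    then obtain t0 where t0: "g t0 \<noteq> 0" by blast
    have "t \<in> {t0} + K" if t: "g t \<noteq> 0" for t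
    proof (rule ccontr)
      assume "t \<notin> {t0} + K"
      then have "- t0 + t \<notin> K" by (simp add: mem_translate_iff)
      then obtain T where T: "compact T" "{x. f' x \<noteq> 0 \<and> f' (x + (- t0 + t)) \<noteq> 0} \<subseteq> T"
        using almost_disjoint_right by blast
      have "compact (T + {- t0})" using T(1) by (intro compact_set_plus) auto
      then have "eventually (\<lambda>s. s \<notin> T + {- t0}) F" by (rule escape)
      moreover have "eventually (\<lambda>s. f' (s + t0) \<noteq> 0) F" using g t0 by (rule tendsto_imp_eventually_ne)
      moreover have "eventually (\<lambda>s. f' (s + t) \<noteq> 0) F" using g t by (rule tendsto_imp_eventually_ne)
      ultimately have "eventually (\<lambda>s. False) F"
      proof eventually_elim
        case (elim s)
        have "s + t0 + (- t0 + t) = s + t" by (simp add: add.assoc[symmetric])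
        with elim T(2) have "s + t0 \<in> T" by auto
        then have "s + t0 + - t0 \<in> T + {- t0}" by (intro set_plus_intro) auto
        with elim show False by simp
      qed
      with F show False by simp
    qed
    moreover have "compact ({t0} + K)" using K by (intro compact_set_plus) auto
    ultimately show ?thesis by blast
  qed (use compact_empty in blast)
  then obtain D where D: "compact D" "\<And>t. g t \<noteq> 0 \<Longrightarrow> t \<in> D" by blast
  have "\<Lambda> \<phi> = \<phi> G" if \<phi>: "CB_functional \<phi>" for \<phi>
  proof (rule ccontr)
    assume "\<Lambda> \<phi> \<noteq> \<phi> G"
    define L where "L = \<Lambda> \<phi> - \<phi> G"
    have L: "cmod L > 0" using \<open>\<Lambda> \<phi> \<noteq> \<phi> G\<close> by (simp add: L_def)
    obtain C where C: "C > 0" "\<And>f. cmod (\<phi> f) \<le> C * norm f" using CB_functional_bound[OF \<phi>] by metis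
    define c where "c = 2 * norm f + 1"
    have c0: "c > 0" by (simp add: c_def add_nonneg_pos)
    obtain n :: nat where n: "real n > 2 * C * c / cmod L" using reals_Archimedean2 by blast
    have "2 * C * c / cmod L > 0" using C(1) c0 L by simp
    with n have n0: "n > 0" by (metis of_nat_0_less_iff order_less_trans)
    have nL: "C * c < real n * (cmod L / 2)" using n L by (simp add: field_simps)
    \<comment> \<open>The requirements on \<open>\<sigma> k = s\<close> when \<open>\<sigma> i\<close> is known for \<open>i < k\<close>. Each of them holds
      eventually along \<open>F\<close>.\<close>
    define P where "P \<sigma> k s \<longleftrightarrow> cmod (\<phi> (ltranslate s f) - \<phi> G - L) < cmod L / 2 \<and>
      (\<forall>t\<in>D. cmod (f' (s + t) - g t) \<le> 1 / real n) \<and> (\<forall>i<k. \<sigma> i - s \<notin> K) \<and>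
      (\<forall>j<k. \<forall>i<k. \<sigma> i - \<sigma> j \<notin> K \<longrightarrow> (\<forall>t. f' (\<sigma> i + t) \<noteq> 0 \<longrightarrow> f' (\<sigma> j + t) \<noteq> 0 \<longrightarrow> cmod (f' (s + t) - g t) \<le> 1 / real n))"
      for \<sigma> :: "nat \<Rightarrow> 'a" and k s
    have "\<exists>\<sigma>. \<forall>k. P \<sigma> k (\<sigma> k)"
    proof (rule dependent_wf_choice[OF wf_less_than])
      show "P \<sigma> k s = P \<tau> k s" if "\<And>z. (z, k) \<in> less_than \<Longrightarrow> \<sigma> z = \<tau> z" for \<sigma> \<tau> k s
        using that unfolding P_def by auto
      fix k :: nat and \<sigma> :: "nat \<Rightarrow> 'a"
      have 1: "eventually (\<lambda>s. cmod (\<phi> (ltranslate s f) - \<phi> G - L) < cmod L / 2) F"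
      proof -
        have "((\<lambda>s. \<phi> (ltranslate s f) - \<phi> G) \<longlongrightarrow> L) F"
          unfolding L_def by (intro tendsto_diff lim \<phi> tendsto_const)
        from tendstoD[OF this, of "cmod L / 2"] L show ?thesis by (simp add: dist_norm)
      qed
      have 2: "eventually (\<lambda>s. \<forall>t\<in>D. cmod (f' (s + t) - g t) \<le> 1 / real n) F"
        using n0 by (intro uniform D(1)) simp
      have 3: "eventually (\<lambda>s. \<forall>i\<in>{..<k}. \<sigma> i - s \<notin> K) F"
      proof (intro eventually_ball_finite ballI)
        fix i
        have "compact (uminus ` K + {\<sigma> i})" using K by (intro compact_set_plus compact_uminus_image) auto
        from escape[OF this] show "eventually (\<lambda>s. \<sigma> i - s \<notin> K) F"
        proof eventually_elim
          case (elim s)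
          show ?case
          proof
            assume "\<sigma> i - s \<in> K"
            then have "- (\<sigma> i - s) + \<sigma> i \<in> uminus ` K + {\<sigma> i}"
              by (intro set_plus_intro imageI) simp_all
            then have "s \<in> uminus ` K + {\<sigma> i}" by simp
            with elim show False ..
          qed
        qed
      qed simp
      have 4: "eventually (\<lambda>s. \<forall>j\<in>{..<k}. \<forall>i\<in>{..<k}. \<sigma> i - \<sigma> j \<notin> K \<longrightarrow>
        (\<forall>t. f' (\<sigma> i + t) \<noteq> 0 \<longrightarrow> f' (\<sigma> j + t) \<noteq> 0 \<longrightarrow> cmod (f' (s + t) - g t) \<le> 1 / real n)) F"
      proof (intro eventually_ball_finite ballI)
        fix i j
        show "eventually (\<lambda>s. \<sigma> i - \<sigma> j \<notin> K \<longrightarrow>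
          (\<forall>t. f' (\<sigma> i + t) \<noteq> 0 \<longrightarrow> f' (\<sigma> j + t) \<noteq> 0 \<longrightarrow> cmod (f' (s + t) - g t) \<le> 1 / real n)) F"
        proof (cases "\<sigma> i - \<sigma> j \<in> K")
          case False
          then obtain T where T: "compact T" "{x. f' x \<noteq> 0 \<and> f' (\<sigma> i - \<sigma> j + x) \<noteq> 0} \<subseteq> T"
            using almost_disjoint_left by blast
          have "compact ({- \<sigma> j} + T)" using T(1) by (intro compact_set_plus) auto
          then have "eventually (\<lambda>s. \<forall>t\<in>{- \<sigma> j} + T. cmod (f' (s + t) - g t) \<le> 1 / real n) F"
            using n0 by (intro uniform) simp_all
          then show ?thesis
          proof eventually_elim
            case (elim s)
            have "t \<in> {- \<sigma> j} + T" if "f' (\<sigma> i + t) \<noteq> 0" "f' (\<sigma> j + t) \<noteq> 0" for t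
            proof -
              have "\<sigma> i - \<sigma> j + (\<sigma> j + t) = \<sigma> i + t" by (simp add: add.assoc[symmetric])
              with that T(2) have "\<sigma> j + t \<in> T" by auto
              then show ?thesis by (simp add: mem_translate_iff)
            qed
            with elim show ?case by blast
          qed
        qed simp
      qed simp_all
      have "eventually (P \<sigma> k) F" using 1 2 3 4 unfolding P_def by eventually_elim auto
      then show "\<exists>s. P \<sigma> k s" using F eventually_happens by blast
    qed
    then obtain \<sigma> where \<sigma>: "\<And>k. P \<sigma> k (\<sigma> k)" by blast
    define u where "u k t = cmod (f' (\<sigma> k + t) - g t)" for k t
    have sum_le: "(\<Sum>k<n. u k t) \<le> c" for t
    proof (cases "t \<in> D")
      case True
      have "(\<Sum>k<n. u k t) \<le> (\<Sum>k<n. 1 / real n)"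
        using \<sigma> True by (intro sum_mono) (simp add: P_def u_def)
      also have "\<dots> = 1" using n0 by simp
      finally show ?thesis unfolding c_def using norm_ge_zero[of f] by linarith
    next
      case False
      then have g0: "g t = 0" using D(2) by blast
      show ?thesis unfolding c_def
      proof (rule bounded_overlap_sum[OF _ _ n0])
        fix i j k assume ijk: "i < j" "j < k" "k < n" "u i t \<noteq> 0" "u j t \<noteq> 0"
        have "\<sigma> i - \<sigma> j \<notin> K" using \<sigma>[of j] ijk(1) by (simp add: P_def)
        moreover have "f' (\<sigma> i + t) \<noteq> 0" "f' (\<sigma> j + t) \<noteq> 0" using ijk(4,5) g0 by (simp_all add: u_def)
        ultimately show "u k t \<le> 1 / real n"
          using \<sigma>[of k] ijk(1,2) less_trans[OF ijk(1,2)] unfolding P_def u_def by blast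
      qed (use f'_le g0 in \<open>simp_all add: u_def\<close>)
    qed
    let ?S = "\<Sum>k<n. ltranslate (\<sigma> k) f - G"
    have "norm ?S \<le> c"
    proof (rule norm_bound)
      fix t
      have "norm (apply_bcontfun ?S t) = cmod (\<Sum>k<n. f' (\<sigma> k + t) - g t)"
        by (simp add: apply_bcontfun_sum minus_bcontfun.rep_eq ltranslate.rep_eq G f'_def del: sum_subtractf)
      also have "\<dots> \<le> (\<Sum>k<n. u k t)" unfolding u_def by (rule norm_sum)
      finally show "norm (apply_bcontfun ?S t) \<le> c" using sum_le[of t] by linarith
    qed
    then have "C * norm ?S \<le> C * c" using C(1) by (intro mult_left_mono) auto
    then have upper: "cmod (\<phi> ?S) \<le> C * c" using C(2)[of ?S] by linarith
    have "\<phi> ?S - of_nat n * L = (\<Sum>k<n. \<phi> (ltranslate (\<sigma> k) f) - \<phi> G - L)"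
      by (simp add: CB_functional_linear[OF \<phi>] sum_subtractf)
    also have "cmod \<dots> \<le> (\<Sum>k<n. cmod L / 2)"
      using \<sigma> by (intro sum_norm_le) (simp add: P_def less_imp_le)
    finally have "cmod (\<phi> ?S - of_nat n * L) \<le> real n * (cmod L / 2)" by simp
    moreover have "cmod (of_nat n * L) \<le> cmod (\<phi> ?S) + cmod (\<phi> ?S - of_nat n * L)"
      by (metis norm_minus_commute norm_triangle_sub)
    ultimately have "real n * cmod L \<le> C * c + real n * (cmod L / 2)"
      using upper by (simp add: norm_mult)
    with nL show False by simp
  qed
  then show ?thesis by blast
qed

lemma WAP_if_almost_disjoint_translates:
  fixes f :: "'a::topological_group_add \<Rightarrow>\<^sub>C complex"
  defines "f' \<equiv> apply_bcontfun f"
  assumes left: "uniformly_continuous_left f'" and right: "uniformly_continuous_right f'"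
    and K: "compact K"
    and almost_disjoint_left: "\<And>z. z \<notin> K \<Longrightarrow> \<exists>T. compact T \<and> {x. f' x \<noteq> 0 \<and> f' (z + x) \<noteq> 0} \<subseteq> T"
    and almost_disjoint_right: "\<And>z. z \<notin> K \<Longrightarrow> \<exists>T. compact T \<and> {x. f' x \<noteq> 0 \<and> f' (x + z) \<noteq> 0} \<subseteq> T"
  shows "f \<in> WAP"
  unfolding WAP_def mem_Collect_eq
proof (rule weakly_compact_closure)
  fix h assume "h \<in> range (\<lambda>s. ltranslate s f)"
  then show "norm h \<le> norm f" by (auto intro!: norm_bound simp: ltranslate.rep_eq norm_bounded)
next
  fix \<Lambda> assume \<Lambda>: "\<Lambda> \<in> closure (bidual ` range (\<lambda>s. ltranslate s f))"
  let ?b = "\<lambda>s. bidual (ltranslate s f)"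
  define F where "F = filtercomap ?b (nhds \<Lambda>)"
  have "F \<noteq> bot" unfolding F_def
  proof (rule filtercomap_neq_bot)
    fix P assume "eventually P (nhds \<Lambda>)"
    then obtain S where S: "open S" "\<Lambda> \<in> S" "\<And>x. x \<in> S \<Longrightarrow> P x" by (auto simp: eventually_nhds)
    then have "S \<inter> bidual ` range (\<lambda>s. ltranslate s f) \<noteq> {}"
      using \<Lambda> open_Int_closure_eq_empty[OF S(1)] by blast
    with S(3) show "\<exists>s. P (?b s)" by blast
  qed
  moreover have tend: "((\<lambda>s. ?b s \<phi>) \<longlongrightarrow> \<Lambda> \<phi>) F" for \<phi>
  proof (rule topological_tendstoI)
    fix S :: "complex set" assume "open S" "\<Lambda> \<phi> \<in> S"
    have "open ((\<lambda>x. x \<phi>) -` S)"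
      by (rule open_vimage[OF \<open>open S\<close>]) (rule continuous_on_product_coordinates)
    then have "eventually (\<lambda>x. x \<in> (\<lambda>x. x \<phi>) -` S) (nhds \<Lambda>)"
      using \<open>\<Lambda> \<phi> \<in> S\<close> by (intro eventually_nhds_in_open) simp_all
    from eventually_filtercomapI[OF this, of ?b] show "eventually (\<lambda>s. ?b s \<phi> \<in> S) F"
      unfolding F_def by simp
  qed
  have "((\<lambda>s. \<phi> (ltranslate s f)) \<longlongrightarrow> \<Lambda> \<phi>) F" if "CB_functional \<phi>" for \<phi>
    using tend[of \<phi>] that by (simp add: bidual_def)
  ultimately obtain g where g: "\<And>\<phi>. CB_functional \<phi> \<Longrightarrow> \<Lambda> \<phi> = \<phi> g"
    using almost_disjoint_translates_weak_limit[OF _ _ left[unfolded f'_def] right[unfolded f'_def] K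
        almost_disjoint_left[unfolded f'_def] almost_disjoint_right[unfolded f'_def], of F \<Lambda>] by metis
  have "\<Lambda> \<phi> = bidual g \<phi>" for \<phi>
  proof (cases "CB_functional \<phi>")
    case False
    have "\<Lambda> \<phi> = 0"
      using tendsto_unique[OF \<open>F \<noteq> bot\<close> tend[of \<phi>]] False by (simp add: bidual_def)
    with False show ?thesis by (simp add: bidual_def)
  qed (simp add: bidual_def g)
  then show "\<exists>g. \<Lambda> = bidual g" by blast
qed

section \<open>Sets of fewer than \<open>\<kappa>\<close> elements\<close>

definition few :: "'i set \<Rightarrow> 'b set \<Rightarrow> bool" where
  "few I A \<longleftrightarrow> |A| <o |I|"

lemma few_finite: "infinite I \<Longrightarrow> finite A \<Longrightarrow> few I A"
  unfolding few_def by (rule finite_ordLess_infinite) (simp_all add: card_of_well_order_on Field_card_of)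

lemma few_subset: "few I B \<Longrightarrow> A \<subseteq> B \<Longrightarrow> few I A"
  unfolding few_def using card_of_mono1 ordLeq_ordLess_trans by blast

lemma few_image: "few I A \<Longrightarrow> few I (f ` A)"
  unfolding few_def using card_of_image ordLeq_ordLess_trans by blast

lemma few_Un: "infinite I \<Longrightarrow> few I A \<Longrightarrow> few I B \<Longrightarrow> few I (A \<union> B)"
  unfolding few_def by (rule card_of_Un_ordLess_infinite)

lemma few_Times:
  assumes "infinite I" "few I A" "few I B"
  shows "few I (A \<times> B)"
proof (cases "finite A \<and> finite B")
  case True
  with assms(1) show ?thesis by (intro few_finite) auto
next
  case False
  let ?C = "A <+> B"
  have inf: "infinite ?C" using False by (auto simp: finite_Plus_iff)
  have C: "|?C| <o |I|" using assms unfolding few_def by (intro card_of_Plus_ordLess_infinite)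
  have "|A \<times> B| \<le>o |?C \<times> ?C|"
    by (rule ordLeq_transitive[OF card_of_Times_mono1[OF card_of_Plus1] card_of_Times_mono2[OF card_of_Plus2]])
  moreover have "|?C \<times> ?C| =o |?C|" using inf by (rule card_of_Times_same_infinite)
  ultimately have "|A \<times> B| \<le>o |?C|" by (rule ordLeq_ordIso_trans)
  then show ?thesis unfolding few_def using C by (rule ordLeq_ordLess_trans)
qed

text \<open>
  This also holds if \<open>I\<close> is countable or of singular cardinality, because a union of finite sets
  over an infinite index set is no larger than the index set.
\<close>

lemma few_UN_finite:
  assumes "infinite I" "few I S" "\<And>s. s \<in> S \<Longrightarrow> finite (f s)"
  shows "few I (\<Union>s\<in>S. f s)"
proof (cases "finite S")
  case True
  with assms show ?thesis by (intro few_finite) auto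
next
  case False
  have "|\<Union>s\<in>S. f s| \<le>o |S|"
  proof (rule card_of_UNION_ordLeq_infinite[OF False])
    show "|S| \<le>o |S|" by (rule ordIso_imp_ordLeq[OF card_of_refl])
    show "\<forall>s\<in>S. |f s| \<le>o |S|"
      using few_finite[OF False assms(3)] unfolding few_def by (blast intro: ordLess_imp_ordLeq)
  qed
  then show ?thesis using assms(2) unfolding few_def by (rule ordLeq_ordLess_trans)
qed

lemma few_set_plus:
  assumes "infinite I" "few I A" "few I B"
  shows "few I (A + B)"
  unfolding set_plus_image by (intro few_image few_Times assms)

lemma few_lists_length:
  assumes "infinite I" "few I A"
  shows "few I {xs. set xs \<subseteq> A \<and> length xs = n}"
proof (induction n)
  case 0
  have "{xs. set xs \<subseteq> A \<and> length xs = 0} = {[]}" by auto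
  then show ?case using assms(1) by (simp add: few_finite)
next
  case (Suc n)
  have "{xs. set xs \<subseteq> A \<and> length xs = Suc n} \<subseteq> (\<lambda>(a, xs). a # xs) ` (A \<times> {xs. set xs \<subseteq> A \<and> length xs = n})"
    by (auto simp: length_Suc_conv)
  with few_image[OF few_Times[OF assms Suc]] show ?case by (rule few_subset)
qed

lemma ex_sequence_avoiding:
  assumes "\<And>S. finite S \<Longrightarrow> \<exists>y. P S y"
  shows "\<exists>y. \<forall>k::nat. P (y ` {..<k}) (y k)"
proof (rule dependent_wf_choice[OF wf_less_than])
  show "P (f ` {..<k}) r = P (g ` {..<k}) r" if "\<And>z. (z, k) \<in> less_than \<Longrightarrow> f z = g z" for f g k r
  proof -
    have "f ` {..<k} = g ` {..<k}" using that by (intro image_cong) auto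
    then show ?thesis by simp
  qed
qed (use assms in simp)

section \<open>Grids all of whose differences avoid a small set\<close>

definition conj_invariant :: "'a::group_add set \<Rightarrow> bool" where
  "conj_invariant S \<longleftrightarrow> (\<forall>g. \<forall>x\<in>S. g + x - g \<in> S)"

lemma conj_invariantD:
  assumes "conj_invariant S" "x \<in> S"
  shows "g + x - g \<in> S" "- g + x + g \<in> S"
  using assms unfolding conj_invariant_def
  by (blast, metis diff_minus_eq_add)

lemma conj_invariant_plus:
  assumes "conj_invariant S" "conj_invariant T"
  shows "conj_invariant (S + T)"
  unfolding conj_invariant_def
proof (intro allI ballI)
  fix g x assume "x \<in> S + T"
  then obtain s t where st: "x = s + t" "s \<in> S" "t \<in> T" by (rule set_plus_elim)
  have "g + x - g = (g + s - g) + (g + t - g)" unfolding st(1)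
    by (simp add: diff_conv_add_uminus add.assoc del: add_uminus_conv_diff)
  also have "\<dots> \<in> S + T" by (intro set_plus_intro conj_invariantD assms st)
  finally show "g + x - g \<in> S + T" .
qed

lemma conj_invariant_commute:
  assumes "conj_invariant S"
  shows "S + A = A + S"
proof -
  have "s + a = a + (- a + s + a)" "a + s = (a + s - a) + a" for s a :: 'a
    by (simp_all add: add.assoc)
  note eq = this
  show ?thesis
  proof (intro equalityI subsetI)
    fix x assume "x \<in> S + A"
    then obtain s a where sa: "x = s + a" "s \<in> S" "a \<in> A" by (rule set_plus_elim)
    have "x = a + (- a + s + a)" by (rule trans[OF sa(1) eq(1)])
    also have "\<dots> \<in> A + S" by (intro set_plus_intro conj_invariantD assms sa)
    finally show "x \<in> A + S" .
  next
    fix x assume "x \<in> A + S"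
    then obtain a s where as: "x = a + s" "a \<in> A" "s \<in> S" by (rule set_plus_elim)
    have "x = (a + s - a) + a" by (rule trans[OF as(1) eq(2)])
    also have "\<dots> \<in> S + A" by (intro set_plus_intro conj_invariantD assms as)
    finally show "x \<in> S + A" .
  qed
qed

lemma uminus_set_plus_mem:
  assumes "conj_invariant S" "\<And>s. s \<in> S \<Longrightarrow> - s \<in> S" "\<And>a. a \<in> A \<Longrightarrow> - a \<in> A" "x \<in> A + S"
  shows "- x \<in> A + S"
proof -
  obtain a s where as: "x = a + s" "a \<in> A" "s \<in> S" using assms(4) by (rule set_plus_elim)
  have "- x \<in> S + A" unfolding as(1) minus_add by (intro set_plus_intro assms as)
  then show ?thesis by (simp add: conj_invariant_commute[OF assms(1)])
qed

text \<open>
  The property of the compact covering number that the construction uses. It is stated with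
  translates of a single compact neighbourhood, because these are counted by points.
\<close>

locale few_translates_not_covering =
  fixes K :: "'a::{topological_group_add, t2_space} set" and I :: "'i set"
  assumes K: "invariant_compact_nbhd K" and inf: "infinite I"
    and not_covered: "\<And>A :: 'a set. few I A \<Longrightarrow> A + K \<noteq> UNIV"
begin

lemma conj_K: "conj_invariant K"
  using K unfolding invariant_compact_nbhd_def conj_invariant_def by blast

lemma uminus_K: "k \<in> K \<Longrightarrow> - k \<in> K"
  using K unfolding invariant_compact_nbhd_def by blast

lemma zero_K: "0 \<in> K"
  using K interior_subset unfolding invariant_compact_nbhd_def by blast

lemma compact_K: "compact K"
  using K unfolding invariant_compact_nbhd_def by blast

lemma finite_translates_cover:
  assumes "compact C"
  obtains F where "finite F" "C \<subseteq> F + K"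
proof -
  have "coverable (interior K) C"
    using K assms unfolding invariant_compact_nbhd_def by (intro compact_coverable) auto
  then obtain F where "finite F" "C \<subseteq> F + interior K" unfolding coverable_def by blast
  moreover have "F + interior K \<subseteq> F + K" by (rule set_plus_mono2[OF order_refl interior_subset])
  ultimately show thesis using that by blast
qed

text \<open>
  In the construction of a grid, each new element has to avoid finitely many two-sided translates of
  one and the same set \<open>Q + K\<close>.
\<close>

definition negligible :: "'a set \<Rightarrow> 'a set \<Rightarrow> bool" where
  "negligible Q C \<longleftrightarrow> (\<exists>\<F>. finite \<F> \<and> (\<forall>y\<in>C. \<exists>(a, b)\<in>\<F>. y \<in> {a} + (Q + K) + {b}))"

lemma not_negligible_avoid:
  assumes "\<not> negligible Q C" "finite \<F>"
  obtains y where "y \<in> C" "\<And>a b. (a, b) \<in> \<F> \<Longrightarrow> y \<notin> {a} + (Q + K) + {b}"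
proof -
  have "\<not> (\<forall>y\<in>C. \<exists>(a, b)\<in>\<F>. y \<in> {a} + (Q + K) + {b})"
    using assms unfolding negligible_def not_ex de_Morgan_conj by meson
  then obtain y where y: "y \<in> C" "\<not> (\<exists>(a, b)\<in>\<F>. y \<in> {a} + (Q + K) + {b})" by meson
  show thesis by (rule that[OF y(1)]) (use y(2) in blast)
qed

text \<open>
  The family \<open>S\<close> may be of any size below \<open>\<kappa>\<close>, even if \<open>\<kappa>\<close> is singular, since the same \<open>Q\<close> serves
  for all its members.
\<close>

lemma negligible_union_not_UNIV:
  assumes Q: "few I Q" and S: "few I S" and C: "\<And>c. c \<in> S \<Longrightarrow> negligible Q (C c)"
  shows "(\<Union>c\<in>S. C c) \<noteq> UNIV"
proof -
  obtain \<F> where \<F>: "\<And>c. c \<in> S \<Longrightarrow> finite (\<F> c)"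
    "\<And>c y. c \<in> S \<Longrightarrow> y \<in> C c \<Longrightarrow> \<exists>(a, b)\<in>\<F> c. y \<in> {a} + (Q + K) + {b}"
    using C unfolding negligible_def by metis
  define A where "A = (\<lambda>((a, b), q). a + q + b) ` ((\<Union>c\<in>S. \<F> c) \<times> Q)"
  have "few I A" unfolding A_def
    by (intro few_image few_Times inf Q few_UN_finite S \<F>(1))
  moreover have "(\<Union>c\<in>S. C c) \<subseteq> A + K"
  proof
    fix y assume "y \<in> (\<Union>c\<in>S. C c)"
    then obtain c where c: "c \<in> S" "y \<in> C c" by blast
    then obtain a b where ab: "(a, b) \<in> \<F> c" "y \<in> {a} + (Q + K) + {b}" using \<F>(2) by blast
    have "{a} + (Q + K) + {b} = {a} + Q + (K + {b})" by (simp add: add.assoc)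
    also have "\<dots> = {a} + Q + {b} + K" by (simp add: conj_invariant_commute[OF conj_K] add.assoc)
    finally have "y \<in> ({a} + Q + {b}) + K" using ab(2) by simp
    moreover have "{a} + Q + {b} \<subseteq> A"
    proof
      fix t assume "t \<in> {a} + Q + {b}"
      then obtain a' q b' where t: "t = a' + q + b'" "a' \<in> {a}" "q \<in> Q" "b' \<in> {b}" by (rule set_plus3_elim)
      then have "t = (\<lambda>((a, b), q). a + q + b) ((a, b), q)" by simp
      then show "t \<in> A" unfolding A_def by (rule image_eqI) (use ab c t in blast)
    qed
    then have "({a} + Q + {b}) + K \<subseteq> A + K" by (rule set_plus_mono2[OF _ order_refl])
    ultimately show "y \<in> A + K" by blast
  qed
  ultimately show ?thesis using not_covered by blast
qed

lemma UNIV_not_negligible: "few I Q \<Longrightarrow> \<not> negligible Q UNIV"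
  using negligible_union_not_UNIV[of Q "{()}" "\<lambda>_. UNIV"] few_finite[OF inf, of "{()}"] by auto

text \<open>
  Choose the \<open>x i\<close> first and the \<open>y l\<close> afterwards. Whenever the element chosen last occurs once in
  a word, it can be chosen so that the word avoids \<open>Q + K\<close>. The words in which it occurs twice are
  the conjugates \<open>tr y i j\<close> of \<open>x i - x j\<close> by \<open>y\<close>. Colour each \<open>y\<close> by recording which of these
  conjugates lie in \<open>Q + K\<close>, and in which translate of \<open>K\<close>. There are too few colours for all
  colour classes to be negligible, so all \<open>y l\<close> can be taken from one class \<open>C\<close>. By Ramsey's
  theorem one may pass to a set \<open>R\<close> of indices \<open>i\<close> such that either no conjugate lies in \<open>Q + K\<close>,
  and all is well, or all of them do. In the second case two members \<open>y\<close> and \<open>y0\<close> of \<open>C\<close>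
  conjugate \<open>x i - x j\<close> into the same translate of \<open>K\<close>, so \<open>- y0 + y\<close> commutes with it up to
  \<open>K + K\<close>. Then the conjugates by \<open>- y0 + y\<close> avoid \<open>Q + K\<close> because \<open>x i - x j\<close> avoids the larger
  set \<open>Z\<close>.
\<close>

lemma ex_generic_grid:
  assumes "few I Q"
  obtains x y :: "nat \<Rightarrow> 'a" where
    "\<And>i l. i < n \<Longrightarrow> l < n \<Longrightarrow> y l + x i \<notin> Q + K"
    "\<And>i l i' l'. i < n \<Longrightarrow> l < n \<Longrightarrow> i' < n \<Longrightarrow> l' < n \<Longrightarrow> (i, l) \<noteq> (i', l') \<Longrightarrow>
       (y l + x i) - (y l' + x i') \<notin> Q + K \<and> - (y l + x i) + (y l' + x i') \<notin> Q + K"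
proof -
  define Q0 where "Q0 = Q \<union> uminus ` Q"
  have fQ0: "few I Q0" unfolding Q0_def by (intro few_Un few_image inf assms)
  have Q0: "- q \<in> Q0" if "q \<in> Q0" for q using that unfolding Q0_def by force
  obtain F where F: "finite F" "K + K + K \<subseteq> F + K"
    using finite_translates_cover[of "K + K + K"] compact_K compact_set_plus by metis
  \<comment> \<open>The set \<open>Z = Q1 + K\<close> is symmetric and leaves a margin of \<open>K + K\<close> around \<open>Q + K\<close>.\<close>
  define Q1 where "Q1 = (Q0 + F) \<union> uminus ` (Q0 + F) \<union> Q0"
  have fQ1: "few I Q1" unfolding Q1_def
    by (intro few_Un few_image few_set_plus inf fQ0 few_finite[OF inf F(1)])
  have Q1: "- q \<in> Q1" if "q \<in> Q1" for q using that Q0 unfolding Q1_def by force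
  define Z where "Z = Q1 + K"
  have Z_neg: "- z \<in> Z" if "z \<in> Z" for z
    using uminus_set_plus_mem[OF conj_K uminus_K Q1] that unfolding Z_def by blast
  have Q0K_neg: "- z \<in> Q0 + K" if "z \<in> Q0 + K" for z
    using uminus_set_plus_mem[OF conj_K uminus_K Q0] that by blast
  have Q0K_Z: "Q0 + K \<subseteq> Z" unfolding Z_def Q1_def by (rule set_plus_mono2[OF Un_upper2 order_refl])
  have QK_Q0K: "Q + K \<subseteq> Q0 + K" unfolding Q0_def by (rule set_plus_mono2[OF Un_upper1 order_refl])
  have Q0KKK_Z: "Q0 + K + (K + K) \<subseteq> Z"
  proof -
    have "Q0 + K + (K + K) = Q0 + (K + K + K)" by (simp add: add.assoc)
    also have "\<dots> \<subseteq> Q0 + (F + K)" by (rule set_plus_mono2[OF order_refl F(2)])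
    also have "\<dots> = (Q0 + F) + K" by (simp add: add.assoc)
    also have "\<dots> \<subseteq> Z" unfolding Z_def Q1_def by (rule set_plus_mono2) auto
    finally show ?thesis .
  qed
  have mem_Z: "t \<in> {a} + (Q1 + K) + {b}" if "- a + t - b \<in> Z" for t a b
  proof -
    have "t = a + (- a + t - b) + b" by (simp add: diff_conv_add_uminus add.assoc del: add_uminus_conv_diff)
    moreover have "a + (- a + t - b) + b \<in> {a} + (Q1 + K) + {b}"
      using that unfolding Z_def by (intro set_plus_intro) simp_all
    ultimately show ?thesis by simp
  qed
  obtain r :: nat where r: "\<And>(V :: nat set) E. finite V \<Longrightarrow> r \<le> card V \<Longrightarrow>
      \<exists>R\<subseteq>V. card R = n \<and> clique R E \<or> card R = n \<and> indep R E"
    using ramsey2[of n n, where ?'a = nat] by metis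
  have "\<exists>y. \<forall>x\<in>S. - x + y \<notin> Z \<and> y - x \<notin> Z" if S: "finite S" for S
  proof -
    have "finite ((\<lambda>x. (x, 0)) ` S \<union> (\<lambda>x. (0, x)) ` S)" using S by simp
    then obtain y where y: "\<And>a b. (a, b) \<in> (\<lambda>x. (x, 0)) ` S \<union> (\<lambda>x. (0, x)) ` S \<Longrightarrow> y \<notin> {a} + (Q1 + K) + {b}"
      using not_negligible_avoid[OF UNIV_not_negligible[OF fQ1]] by metis
    have "- x + y \<notin> Z \<and> y - x \<notin> Z" if "x \<in> S" for x
      using y[of x 0] y[of 0 x] mem_Z[of x y 0] mem_Z[of 0 y x] that by auto
    then show ?thesis by blast
  qed
  from ex_sequence_avoiding[of "\<lambda>S y. \<forall>x\<in>S. - x + y \<notin> Z \<and> y - x \<notin> Z", OF this]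
  obtain x where x: "\<forall>k::nat. \<forall>x'\<in>x ` {..<k}. - x' + x k \<notin> Z \<and> x k - x' \<notin> Z" ..
  have x_diff: "- x i + x j \<notin> Z" "x i - x j \<notin> Z" if ij: "i \<noteq> j" for i j
  proof -
    consider "i < j" | "j < i" using ij by linarith
    then have "- x i + x j \<notin> Z \<and> x i - x j \<notin> Z"
    proof cases
      case 1
      then have "- x i + x j \<notin> Z" "x j - x i \<notin> Z" using x[rule_format, of _ j] by auto
      then show ?thesis using Z_neg[of "x i - x j"] by (auto simp: minus_diff_eq)
    next
      case 2
      then have "- x j + x i \<notin> Z" "x i - x j \<notin> Z" using x[rule_format, of _ i] by auto
      then show ?thesis using Z_neg[of "- x i + x j"] by (auto simp: minus_add)
    qed
    then show "- x i + x j \<notin> Z" "x i - x j \<notin> Z" by blast+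
  qed
  define tr where "tr y i j = y + (x i - x j) - y" for y i j
  have tr_neg: "tr y j i = - tr y i j" for y i j
    unfolding tr_def by (simp add: minus_diff_eq minus_add diff_conv_add_uminus add.assoc del: add_uminus_conv_diff)
  define ps where "ps = List.product [0..<r] [0..<r]"
  define pick where "pick t = (SOME q. q \<in> Q0 \<and> t \<in> {q} + K)" for t
  have pick: "pick t \<in> Q0" "t \<in> {pick t} + K" if t: "t \<in> Q0 + K" for t
  proof -
    obtain q k where "t = q + k" "q \<in> Q0" "k \<in> K" using t by (rule set_plus_elim)
    then have "q \<in> Q0 \<and> t \<in> {q} + K" by (simp add: mem_translate_iff)
    then have "pick t \<in> Q0 \<and> t \<in> {pick t} + K" unfolding pick_def by (rule someI)
    then show "pick t \<in> Q0" "t \<in> {pick t} + K" by blast+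
  qed
  define colour where "colour y = map (\<lambda>(i, j). if tr y i j \<in> Q0 + K then Some (pick (tr y i j)) else None) ps" for y
  let ?Col = "{cs. set cs \<subseteq> insert None (Some ` Q0) \<and> length cs = length ps}"
  have "few I (insert None (Some ` Q0))"
    using few_Un[OF inf few_finite[OF inf, of "{None}"] few_image[OF fQ0, of Some]] by simp
  then have "few I ?Col" by (rule few_lists_length[OF inf])
  moreover have "(\<Union>c\<in>?Col. {y. colour y = c}) = UNIV"
  proof -
    have "colour y \<in> ?Col" for y unfolding colour_def using pick(1) by auto
    then show ?thesis by blast
  qed
  ultimately obtain c where c: "\<not> negligible Q1 {y. colour y = c}"
    using negligible_union_not_UNIV[OF fQ1, of ?Col "\<lambda>c. {y. colour y = c}"] by blast
  define C where "C = {y. colour y = c}"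
  have C: "\<not> negligible Q1 C" using c by (simp add: C_def)
  have same: "tr y i j \<in> Q0 + K \<longleftrightarrow> tr y' i j \<in> Q0 + K"
    "tr y i j \<in> Q0 + K \<Longrightarrow> pick (tr y i j) = pick (tr y' i j)"
    if "y \<in> C" "y' \<in> C" "i < r" "j < r" for y y' i j
  proof -
    have "colour y = colour y'" using that by (simp add: C_def)
    then have "(if tr y i j \<in> Q0 + K then Some (pick (tr y i j)) else None) =
      (if tr y' i j \<in> Q0 + K then Some (pick (tr y' i j)) else None)"
      using that(3,4) unfolding colour_def ps_def by (auto simp: map_eq_conv)
    then show "tr y i j \<in> Q0 + K \<longleftrightarrow> tr y' i j \<in> Q0 + K"
      "tr y i j \<in> Q0 + K \<Longrightarrow> pick (tr y i j) = pick (tr y' i j)"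
      by (auto split: if_splits)
  qed
  obtain y0 where y0: "y0 \<in> C" using not_negligible_avoid[OF C, of "{}"] by auto
  define E where "E = {{i, j} | i j. i < r \<and> j < r \<and> tr y0 i j \<in> Q0 + K}"
  have "\<exists>R\<subseteq>{..<r}. card R = n \<and> clique R E \<or> card R = n \<and> indep R E" by (rule r) simp_all
  then obtain R where "R \<subseteq> {..<r} \<and> (card R = n \<and> clique R E \<or> card R = n \<and> indep R E)" ..
  then have R: "R \<subseteq> {..<r}" "card R = n" "clique R E \<or> indep R E" by meson+
  have E: "{i, j} \<in> E \<longleftrightarrow> tr y0 i j \<in> Q0 + K" if "i < r" "j < r" for i j
  proof
    assume "{i, j} \<in> E"
    then obtain i' j' where ij': "{i, j} = {i', j'}" "tr y0 i' j' \<in> Q0 + K" unfolding E_def by blast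
    then consider "i = i'" "j = j'" | "i = j'" "j = i'" by (auto simp only: doubleton_eq_iff)
    then show "tr y0 i j \<in> Q0 + K"
    proof cases
      case 2
      then show ?thesis using Q0K_neg[OF ij'(2)] tr_neg[of y0 j' i'] by simp
    qed (use ij'(2) in simp)
  qed (use that in \<open>unfold E_def, blast\<close>)
  \<comment> \<open>Multiplication by one element \<open>w\<close> makes the conjugates by all members of \<open>C\<close> harmless.\<close>
  have "\<exists>w. \<forall>y\<in>C. \<forall>i\<in>R. \<forall>j\<in>R. i \<noteq> j \<longrightarrow> tr (w + y) i j \<notin> Q0 + K"
    using R(3)
  proof
    assume ind: "indep R E"
    have "tr (0 + y) i j \<notin> Q0 + K" if "y \<in> C" "i \<in> R" "j \<in> R" "i \<noteq> j" for y i j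
    proof -
      have ij: "i < r" "j < r" using that R(1) by auto
      have "{i, j} \<notin> E" using ind that unfolding indep_def by blast
      then show ?thesis using E[OF ij] same(1)[OF y0 that(1) ij] by simp
    qed
    then show ?thesis by blast
  next
    assume cl: "clique R E"
    have "tr (- y0 + y) i j \<notin> Q0 + K" if "y \<in> C" "i \<in> R" "j \<in> R" "i \<noteq> j" for y i j
    proof
      assume bad: "tr (- y0 + y) i j \<in> Q0 + K"
      have ij: "i < r" "j < r" using that R(1) by auto
      have "{i, j} \<in> E" using cl that unfolding clique_def by blast
      then have t0: "tr y0 i j \<in> Q0 + K" using E[OF ij] by simp
      then have t: "tr y i j \<in> Q0 + K" using same(1)[OF y0 that(1) ij] by simp
      define q where "q = pick (tr y0 i j)"
      have "pick (tr y i j) = q" using same(2)[OF y0 that(1) ij t0] by (simp add: q_def)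
      then have k: "- q + tr y i j \<in> K" "- q + tr y0 i j \<in> K"
        using pick(2)[OF t] pick(2)[OF t0] by (simp_all add: q_def mem_translate_iff)
      define k' where "k' = - (- q + tr y0 i j) + (- q + tr y i j)"
      have "k' \<in> K + K" unfolding k'_def by (intro set_plus_intro uminus_K k)
      then have k'': "- (- y0 + k' + y0) \<in> K + K"
        using uminus_set_plus_mem[OF conj_K uminus_K uminus_K]
          conj_invariantD(2)[OF conj_invariant_plus[OF conj_K conj_K]] by blast
      have "tr y i j = tr y0 i j + k'"
        unfolding k'_def by (simp add: minus_add add.assoc)
      then have "- y0 + tr y i j + y0 = (- y0 + tr y0 i j + y0) + (- y0 + k' + y0)"
        by (simp add: add.assoc)
      moreover have "- y0 + tr y0 i j + y0 = x i - x j"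
        unfolding tr_def by (simp add: diff_conv_add_uminus add.assoc del: add_uminus_conv_diff)
      moreover have "tr (- y0 + y) i j = - y0 + tr y i j + y0"
        unfolding tr_def by (simp add: diff_conv_add_uminus minus_add add.assoc del: add_uminus_conv_diff)
      ultimately have "x i - x j = tr (- y0 + y) i j + - (- y0 + k' + y0)"
        by (metis add.assoc add.right_inverse add_0_right)
      also have "\<dots> \<in> Q0 + K + (K + K)" using bad k'' by (rule set_plus_intro)
      finally show False using Q0KKK_Z x_diff(2)[OF that(4)] by blast
    qed
    then show ?thesis by blast
  qed
  then obtain w where w: "\<And>y i j. y \<in> C \<Longrightarrow> i \<in> R \<Longrightarrow> j \<in> R \<Longrightarrow> i \<noteq> j \<Longrightarrow> tr (w + y) i j \<notin> Q0 + K"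
    by blast
  have finR: "finite R" using R(1) finite_subset by blast
  \<comment> \<open>The remaining requirements on \<open>w + y\<close>, given the set \<open>S\<close> of its predecessors: \<open>y\<close> occurs once
    in each of these words.\<close>
  define good where "good S y \<longleftrightarrow> y \<in> C \<and> (\<forall>i\<in>R. w + y + x i \<notin> Z) \<and>
    (\<forall>y'\<in>S. \<forall>i\<in>R. \<forall>j\<in>R. (w + y + x i) - (w + y' + x j) \<notin> Z \<and> - (w + y' + x j) + (w + y + x i) \<notin> Z)" for S y
  have "\<exists>y. good S y" if S: "finite S" for S
  proof -
    let ?\<F> = "(\<lambda>i. (- w, - x i)) ` R \<union>
      (\<lambda>(y', i, j). (- w, w + y' + x j - x i)) ` (S \<times> R \<times> R) \<union>
      (\<lambda>(y', i, j). (- w + (w + y' + x j), - x i)) ` (S \<times> R \<times> R)"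
    have "finite ?\<F>" using S finR by blast
    then obtain y where y: "y \<in> C" "\<And>a b. (a, b) \<in> ?\<F> \<Longrightarrow> y \<notin> {a} + (Q1 + K) + {b}"
      using not_negligible_avoid[OF C] by metis
    have "w + y + x i \<notin> Z" if "i \<in> R" for i
    proof -
      have "(- w, - x i) \<in> ?\<F>" using that by blast
      then show ?thesis using y(2) mem_Z[of "- w" y "- x i"] by auto
    qed
    moreover have "(w + y + x i) - (w + y' + x j) \<notin> Z" if "y' \<in> S" "i \<in> R" "j \<in> R" for y' i j
    proof -
      have "(- w, w + y' + x j - x i) \<in> ?\<F>" using that by force
      then have "- (- w) + y - (w + y' + x j - x i) \<notin> Z" using y(2) mem_Z by blast
      moreover have "- (- w) + y - (w + y' + x j - x i) = (w + y + x i) - (w + y' + x j)"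
        by (simp add: diff_conv_add_uminus minus_add add.assoc del: add_uminus_conv_diff)
      ultimately show ?thesis by simp
    qed
    moreover have "- (w + y' + x j) + (w + y + x i) \<notin> Z" if "y' \<in> S" "i \<in> R" "j \<in> R" for y' i j
    proof -
      have "(- w + (w + y' + x j), - x i) \<in> ?\<F>" using that by force
      then have "- (- w + (w + y' + x j)) + y - - x i \<notin> Z" using y(2) mem_Z by blast
      moreover have "- (- w + (w + y' + x j)) + y - - x i = - (w + y' + x j) + (w + y + x i)"
        by (simp add: diff_conv_add_uminus minus_add add.assoc del: add_uminus_conv_diff)
      ultimately show ?thesis by simp
    qed
    ultimately have "good S y" using y(1) unfolding good_def by blast
    then show ?thesis by blast
  qed
  from ex_sequence_avoiding[of good, OF this]
  obtain y where y: "\<forall>k::nat. good (y ` {..<k}) (y k)" ..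
  obtain e where e: "bij_betw e {0..<n} R" using ex_bij_betw_nat_finite[OF finR] R(2) by auto
  have eR: "e i \<in> R" if "i < n" for i using e that unfolding bij_betw_def by auto
  have e_inj: "e i \<noteq> e j" if "i < n" "j < n" "i \<noteq> j" for i j
    using e that unfolding bij_betw_def inj_on_def by auto
  define x' where "x' i = x (e i)" for i
  define y' where "y' l = w + y l" for l
  have later: "(y' l + x' i) - (y' m + x' j) \<notin> Z \<and> - (y' m + x' j) + (y' l + x' i) \<notin> Z"
    if "m < l" "i < n" "j < n" for l m i j
    using y[rule_format, of l] that eR unfolding good_def x'_def y'_def by blast
  show thesis
  proof
    fix i l assume il: "i < n" "l < n"
    have "y' l + x' i \<notin> Z" using y[rule_format, of l] eR[OF il(1)] unfolding good_def x'_def y'_def by blast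
    then show "y' l + x' i \<notin> Q + K" using QK_Q0K Q0K_Z by blast
    fix i' l' assume il': "i' < n" "l' < n" and ne: "(i, l) \<noteq> (i', l')"
    have "(y' l + x' i) - (y' l' + x' i') \<notin> Q0 + K \<and> - (y' l + x' i) + (y' l' + x' i') \<notin> Q0 + K"
    proof (cases l l' rule: linorder_cases)
      case less
      have "(y' l' + x' i') - (y' l + x' i) \<notin> Q0 + K" "- (y' l + x' i) + (y' l' + x' i') \<notin> Q0 + K"
        using later[OF less il'(1) il(1)] Q0K_Z by blast+
      then show ?thesis using Q0K_neg[of "(y' l + x' i) - (y' l' + x' i')"] by (metis minus_diff_eq)
    next
      case greater
      have "(y' l + x' i) - (y' l' + x' i') \<notin> Q0 + K" "- (y' l' + x' i') + (y' l + x' i) \<notin> Q0 + K"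
        using later[OF greater il(1) il'(1)] Q0K_Z by blast+
      then show ?thesis using Q0K_neg[of "- (y' l + x' i) + (y' l' + x' i')"] by (metis minus_add minus_minus)
    next
      case equal
      with ne have "i \<noteq> i'" by simp
      then have "e i \<noteq> e i'" using e_inj il il' by blast
      have "y l' \<in> C" using y[rule_format, of l'] unfolding good_def by blast
      then have "tr (w + y l') (e i) (e i') \<notin> Q0 + K" using w eR il(1) il'(1) \<open>e i \<noteq> e i'\<close> by blast
      moreover have "(y' l + x' i) - (y' l' + x' i') = tr (w + y l') (e i) (e i')"
        unfolding equal tr_def x'_def y'_def
        by (simp add: diff_conv_add_uminus minus_add add.assoc del: add_uminus_conv_diff)
      moreover have "- (y' l + x' i) + (y' l' + x' i') = - x (e i) + x (e i')"
        unfolding equal x'_def by (simp add: minus_add add.assoc diff_conv_add_uminus del: add_uminus_conv_diff)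
      ultimately show ?thesis using x_diff(1)[OF \<open>e i \<noteq> e i'\<close>] Q0K_Z by auto
    qed
    then show "(y' l + x' i) - (y' l' + x' i') \<notin> Q + K \<and> - (y' l + x' i) + (y' l' + x' i') \<notin> Q + K"
      using QK_Q0K by blast
  qed
qed

section \<open>Scattering the grids\<close>

definition window :: "'a set \<Rightarrow> 'a set" where
  "window A = insert 0 (A \<union> uminus ` A)"

lemma window_mem: "0 \<in> window A" "a \<in> A \<Longrightarrow> a \<in> window A" "a \<in> A \<Longrightarrow> - a \<in> window A"
  by (auto simp: window_def)

abbreviation "K2 \<equiv> K + K"
abbreviation "K4 \<equiv> K2 + K2"

lemma conj_K2: "conj_invariant K2"
  by (rule conj_invariant_plus[OF conj_K conj_K])

lemma uminus_K2: "k \<in> K2 \<Longrightarrow> - k \<in> K2"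
  using uminus_set_plus_mem[OF conj_K uminus_K uminus_K] by blast

lemma zero_K2: "0 \<in> K2"
  using set_plus_intro[OF zero_K zero_K] by simp

text \<open>
  The words of length at most three in the old points and their inverses, thickened by \<open>K4\<close>. Four
  factors \<open>K\<close> suffice since two relations, each with an error in \<open>K + K\<close>, are to be compared.
\<close>

definition blocked :: "'a set \<Rightarrow> 'a set" where
  "blocked A = window A + window A + window A + K4"

lemma blocked_mem:
  assumes "a \<in> window A" "b \<in> window A" "c \<in> window A" "k \<in> K4"
  shows "a + b + c + k \<in> blocked A"
  unfolding blocked_def by (intro set_plus_intro assms)

lemma blocked_subset:
  assumes "few I A"
  obtains Q where "few I Q" "blocked A \<subseteq> Q + K"
proof -
  have "compact K4" by (intro compact_set_plus compact_K)
  then obtain F where F: "finite F" "K4 \<subseteq> F + K" by (rule finite_translates_cover)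
  let ?W = "window A"
  have "few I ?W"
    unfolding window_def
    using few_Un[OF inf few_finite[OF inf, of "{0}"] few_Un[OF inf assms few_image[OF assms, of uminus]]] by simp
  then have "few I (?W + ?W + ?W + F)"
    by (intro few_set_plus inf few_finite[OF inf F(1)])
  moreover have "blocked A \<subseteq> ?W + ?W + ?W + F + K"
  proof -
    have "blocked A \<subseteq> ?W + ?W + ?W + (F + K)"
      unfolding blocked_def by (rule set_plus_mono2[OF order_refl F(2)])
    then show ?thesis by (simp only: add.assoc)
  qed
  ultimately show thesis using that by blast
qed

definition grid :: "(nat \<Rightarrow> 'a) \<times> (nat \<Rightarrow> 'a) \<Rightarrow> nat \<Rightarrow> 'a set" where
  "grid xy n = (\<lambda>(k, l). snd xy l + fst xy k) ` ({..<n} \<times> {..<n})"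

definition scattered_from :: "'a set \<Rightarrow> (nat \<Rightarrow> 'a) \<times> (nat \<Rightarrow> 'a) \<Rightarrow> nat \<Rightarrow> bool" where
  "scattered_from A xy n \<longleftrightarrow> (\<forall>k<n. \<forall>l<n. snd xy l + fst xy k \<notin> blocked A \<and>
     (\<forall>k'<n. \<forall>l'<n. (k, l) \<noteq> (k', l') \<longrightarrow>
        (snd xy l + fst xy k) - (snd xy l' + fst xy k') \<notin> blocked A \<and>
        - (snd xy l + fst xy k) + (snd xy l' + fst xy k') \<notin> blocked A))"

lemma ex_scattered_from:
  assumes "few I A"
  shows "\<exists>xy. scattered_from A xy n"
proof -
  obtain Q where Q: "few I Q" "blocked A \<subseteq> Q + K" using assms by (rule blocked_subset)
  obtain x y :: "nat \<Rightarrow> 'a" where xy: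
    "\<And>i l. i < n \<Longrightarrow> l < n \<Longrightarrow> y l + x i \<notin> Q + K"
    "\<And>i l i' l'. i < n \<Longrightarrow> l < n \<Longrightarrow> i' < n \<Longrightarrow> l' < n \<Longrightarrow> (i, l) \<noteq> (i', l') \<Longrightarrow>
       (y l + x i) - (y l' + x i') \<notin> Q + K \<and> - (y l + x i) + (y l' + x i') \<notin> Q + K"
    using ex_generic_grid[OF Q(1), of n] by metis
  have "scattered_from A (x, y) n"
    unfolding scattered_from_def fst_conv snd_conv
  proof (intro allI impI conjI)
    fix k l assume kl: "k < n" "l < n"
    show "y l + x k \<notin> blocked A" using xy(1)[OF kl] Q(2) by blast
    fix k' l' assume kl': "k' < n" "l' < n" "(k, l) \<noteq> (k', l')"
    show "(y l + x k) - (y l' + x k') \<notin> blocked A" "- (y l + x k) + (y l' + x k') \<notin> blocked A"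
      using xy(2)[OF kl kl'] Q(2) by blast+
  qed
  then show ?thesis by blast
qed

definition index_order :: "('i \<times> nat) rel" where
  "index_order = |I \<times> (UNIV :: nat set)|"

abbreviation before :: "'i \<times> nat \<Rightarrow> ('i \<times> nat) set" where
  "before \<alpha> \<equiv> underS index_order \<alpha>"

lemma Field_index_order: "Field index_order = I \<times> UNIV"
  unfolding index_order_def by (rule Field_card_of)

lemma few_before: "few I (before \<alpha>)"
proof (cases "\<alpha> \<in> Field index_order")
  case True
  have "|before \<alpha>| <o index_order"
    using True unfolding index_order_def by (intro card_of_underS card_of_Card_order)
  moreover have "index_order =o |I|"
    unfolding index_order_def
    using card_of_Times_infinite[OF inf, of "UNIV :: nat set"] inf infinite_iff_card_of_nat by blast
  ultimately show ?thesis unfolding few_def by (rule ordLess_ordIso_trans)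
next
  case False
  then have "before \<alpha> = {}" by (auto simp: underS_def Field_def)
  then show ?thesis using few_finite[OF inf finite.emptyI] by simp
qed

lemma index_order_facts:
  "wf (index_order - Id)"
  "\<alpha> \<in> before \<beta> \<Longrightarrow> \<beta> \<in> before \<gamma> \<Longrightarrow> \<alpha> \<in> before \<gamma>"
  "\<alpha> \<in> Field index_order \<Longrightarrow> \<beta> \<in> Field index_order \<Longrightarrow> \<alpha> = \<beta> \<or> \<alpha> \<in> before \<beta> \<or> \<beta> \<in> before \<alpha>"
proof -
  have wo: "well_order_on (I \<times> (UNIV :: nat set)) index_order"
    unfolding index_order_def by (rule card_of_well_order_on)
  then show "wf (index_order - Id)" unfolding well_order_on_def by blast
  have lin: "linear_order_on (I \<times> (UNIV :: nat set)) index_order" using wo unfolding well_order_on_def by blast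
  then have tr: "trans index_order" and an: "antisym index_order" and to: "total_on (I \<times> UNIV) index_order"
    unfolding linear_order_on_def partial_order_on_def preorder_on_def by blast+
  show "\<alpha> \<in> before \<beta> \<Longrightarrow> \<beta> \<in> before \<gamma> \<Longrightarrow> \<alpha> \<in> before \<gamma>"
    using transD[OF tr] antisymD[OF an] unfolding underS_def by blast
  show "\<alpha> \<in> Field index_order \<Longrightarrow> \<beta> \<in> Field index_order \<Longrightarrow> \<alpha> = \<beta> \<or> \<alpha> \<in> before \<beta> \<or> \<beta> \<in> before \<alpha>"
    using to unfolding total_on_def Field_index_order underS_def by blast
qed

lemma ex_scattered_grids:
  "\<exists>f. \<forall>\<alpha>. scattered_from (\<Union>\<beta>\<in>before \<alpha>. grid (f \<beta>) (snd \<beta>)) (f \<alpha>) (snd \<alpha>)"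
proof (rule dependent_wf_choice[OF index_order_facts(1)])
  show "scattered_from (\<Union>\<beta>\<in>before \<alpha>. grid (f \<beta>) (snd \<beta>)) xy (snd \<alpha>) =
      scattered_from (\<Union>\<beta>\<in>before \<alpha>. grid (g \<beta>) (snd \<beta>)) xy (snd \<alpha>)"
    if eq: "\<And>\<beta>. (\<beta>, \<alpha>) \<in> index_order - Id \<Longrightarrow> f \<beta> = g \<beta>" for f g \<alpha> xy
  proof -
    have "f \<beta> = g \<beta>" if "\<beta> \<in> before \<alpha>" for \<beta>
      using that by (intro eq) (auto simp: underS_def)
    then have "(\<Union>\<beta>\<in>before \<alpha>. grid (f \<beta>) (snd \<beta>)) = (\<Union>\<beta>\<in>before \<alpha>. grid (g \<beta>) (snd \<beta>))"
      by (intro SUP_cong) simp_all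
    then show ?thesis by simp
  qed
  show "\<exists>xy. scattered_from (\<Union>\<beta>\<in>before \<alpha>. grid (f \<beta>) (snd \<beta>)) xy (snd \<alpha>)" for \<alpha> f
    by (intro ex_scattered_from few_UN_finite inf few_before) (simp add: grid_def)
qed

text \<open>
  The index \<open>((i, n), k, l)\<close> stands for the point in row \<open>k\<close> and column \<open>l\<close> of the \<open>n \<times> n\<close> grid
  that belongs to \<open>i\<close>.
\<close>

definition grid_indices :: "(('i \<times> nat) \<times> nat \<times> nat) set" where
  "grid_indices = {(\<alpha>, k, l). fst \<alpha> \<in> I \<and> k < snd \<alpha> \<and> l < snd \<alpha>}"

text \<open>
  For bumps supported in \<open>p \<tau> + K\<close>, the first clause makes the supports disjoint, and the others say
  that the union of the supports almost avoids its left and its right translate by \<open>z\<close>.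
\<close>

definition scattered :: "(('i \<times> nat) \<times> nat \<times> nat \<Rightarrow> 'a) \<Rightarrow> bool" where
  "scattered p \<longleftrightarrow>
     (\<forall>\<tau>\<in>grid_indices. \<forall>\<tau>'\<in>grid_indices. - p \<tau> + p \<tau>' \<in> K2 \<longrightarrow> \<tau> = \<tau>') \<and>
     (\<forall>z. z \<notin> K2 \<longrightarrow> (\<exists>S. finite S \<and> (\<forall>\<tau>\<in>grid_indices. \<forall>\<tau>'\<in>grid_indices.
        - p \<tau> + z + p \<tau>' \<in> K2 \<longrightarrow> p \<tau> \<in> S \<or> p \<tau>' \<in> S))) \<and>
     (\<forall>z. z \<notin> K2 \<longrightarrow> (\<exists>S. finite S \<and> (\<forall>\<tau>\<in>grid_indices. \<forall>\<tau>'\<in>grid_indices.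
        - p \<tau>' + p \<tau> + z \<in> K2 \<longrightarrow> p \<tau> \<in> S \<or> p \<tau>' \<in> S)))"

text \<open>
  Suppose that translation by \<open>z\<close>, on the left or on the right, carries one of the points \<open>p \<tau>\<close> and
  \<open>p \<tau>'\<close> to the other, up to \<open>K + K\<close>. Then \<open>z\<close> determines the later of the
  two grids that are involved. For if it did the same with \<open>p \<sigma>\<close> and \<open>p \<sigma>'\<close>, both in grids
  before the later one of the first pair, then comparing the two expressions for \<open>z\<close> would put a
  point, or a quotient of two points, of that later grid into the set that it has to avoid. So all
  such pairs have a point in one finite grid.
\<close>

lemma ex_scattered_points:
  obtains x y :: "'i \<times> nat \<Rightarrow> nat \<Rightarrow> 'a" and p where
    "\<And>\<alpha> k l. p (\<alpha>, k, l) = y \<alpha> l + x \<alpha> k" "scattered p"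
proof -
  obtain f where f: "\<forall>\<alpha>. scattered_from (\<Union>\<beta>\<in>before \<alpha>. grid (f \<beta>) (snd \<beta>)) (f \<alpha>) (snd \<alpha>)"
    using ex_scattered_grids ..
  define p where "p \<tau> = (case \<tau> of (\<alpha>, k, l) \<Rightarrow> snd (f \<alpha>) l + fst (f \<alpha>) k)" for \<tau>
  define A where "A \<alpha> = (\<Union>\<beta>\<in>before \<alpha>. grid (f \<beta>) (snd \<beta>))" for \<alpha>
  have fst_Field: "fst \<tau> \<in> Field index_order" if "\<tau> \<in> grid_indices" for \<tau>
    using that unfolding grid_indices_def Field_index_order by (auto simp: mem_Times_iff)
  have p_grid: "p \<tau> \<in> grid (f (fst \<tau>)) (snd (fst \<tau>))" if "\<tau> \<in> grid_indices" for \<tau>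
    using that unfolding grid_indices_def p_def grid_def by force
  have p_A: "p \<tau> \<in> A \<alpha>" if "\<tau> \<in> grid_indices" "fst \<tau> \<in> before \<alpha>" for \<tau> \<alpha>
    using p_grid[OF that(1)] that(2) unfolding A_def by blast
  have not_blocked: "p \<tau> \<notin> blocked (A (fst \<tau>))" if "\<tau> \<in> grid_indices" for \<tau>
    using f[rule_format, of "fst \<tau>"] that
    unfolding scattered_from_def A_def[symmetric] grid_indices_def p_def by (auto split: prod.splits)
  have diff_not_blocked: "p \<tau> - p \<tau>' \<notin> blocked (A \<alpha>) \<and> - p \<tau> + p \<tau>' \<notin> blocked (A \<alpha>)"
    if T: "\<tau> \<in> grid_indices" "\<tau>' \<in> grid_indices" and eq: "fst \<tau> = \<alpha>" "fst \<tau>' = \<alpha>" and ne: "\<tau> \<noteq> \<tau>'" for \<tau> \<tau>' \<alpha>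
  proof -
    obtain k l where kl: "\<tau> = (\<alpha>, k, l)" using eq(1) by (metis prod.collapse)
    obtain k' l' where kl': "\<tau>' = (\<alpha>, k', l')" using eq(2) by (metis prod.collapse)
    have less: "k < snd \<alpha>" "l < snd \<alpha>" "k' < snd \<alpha>" "l' < snd \<alpha>"
      using T unfolding grid_indices_def kl kl' by auto
    have "(k, l) \<noteq> (k', l')" using ne kl kl' by simp
    then show ?thesis
      using f[rule_format, of \<alpha>] less unfolding scattered_from_def A_def[symmetric] kl kl' p_def
      by (simp only: prod.case) blast
  qed
  have K4: "k + k' \<in> K4" if "k \<in> K2" "k' \<in> K2" for k k' using that by (rule set_plus_intro)
  have K24: "k \<in> K4" if "k \<in> K2" for k using set_plus_intro[OF that zero_K2] by simp
  have window_later: "p \<tau> \<in> window (A \<alpha>)" "- p \<tau> \<in> window (A \<alpha>)" if "\<tau> \<in> grid_indices" "fst \<tau> \<in> before \<alpha>" for \<tau> \<alpha>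
    using window_mem(2,3)[OF p_A[OF that]] by blast+

  have separated: "\<tau> = \<tau>'"
    if T: "\<tau> \<in> grid_indices" "\<tau>' \<in> grid_indices" and k: "- p \<tau> + p \<tau>' \<in> K2" for \<tau> \<tau>'
  proof (rule ccontr)
    assume ne: "\<tau> \<noteq> \<tau>'"
    define k0 where "k0 = - p \<tau> + p \<tau>'"
    have k0: "k0 \<in> K4" "- k0 \<in> K4" using k K24 uminus_K2 unfolding k0_def by blast+
    have eqs: "p \<tau>' = p \<tau> + 0 + 0 + k0" "p \<tau> = p \<tau>' + 0 + 0 + - k0" "k0 = 0 + 0 + 0 + k0"
      unfolding k0_def by (simp_all add: minus_add add.assoc[symmetric] diff_conv_add_uminus del: add_uminus_conv_diff)
    consider "fst \<tau> = fst \<tau>'" | "fst \<tau> \<in> before (fst \<tau>')" | "fst \<tau>' \<in> before (fst \<tau>)"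
      using index_order_facts(3)[OF fst_Field[OF T(1)] fst_Field[OF T(2)]] by blast
    then show False
    proof cases
      case 1
      have "k0 \<in> blocked (A (fst \<tau>'))"
        by (subst eqs(3)) (intro blocked_mem window_mem k0)
      then show False using diff_not_blocked[OF T 1 refl ne] unfolding k0_def by blast
    next
      case 2
      have "p \<tau>' \<in> blocked (A (fst \<tau>'))"
        by (subst eqs(1)) (intro blocked_mem window_mem(1) window_later T 2 k0)
      then show False using not_blocked[OF T(2)] by blast
    next
      case 3
      have "p \<tau> \<in> blocked (A (fst \<tau>))"
        by (subst eqs(2)) (intro blocked_mem window_mem(1) window_later T 3 k0)
      then show False using not_blocked[OF T(1)] by blast
    qed
  qed

  \<comment> \<open>Two expressions of \<open>z\<close> as a left quotient, of which the second uses earlier grids only. The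
    cases are: both points of the first expression are in the grid \<open>\<alpha>\<close>, or just one of them is.\<close>
  have left_unique: False
    if T: "\<tau> \<in> grid_indices" "\<tau>' \<in> grid_indices" "\<sigma> \<in> grid_indices" "\<sigma>' \<in> grid_indices"
      and z: "z \<notin> K2" and rep: "- p \<tau> + z + p \<tau>' \<in> K2" "- p \<sigma> + z + p \<sigma>' \<in> K2"
      and below: "fst \<sigma> \<in> before \<alpha>" "fst \<sigma>' \<in> before \<alpha>"
      and top: "fst \<tau> = \<alpha> \<or> fst \<tau> \<in> before \<alpha>" "fst \<tau>' = \<alpha> \<or> fst \<tau>' \<in> before \<alpha>" "fst \<tau> = \<alpha> \<or> fst \<tau>' = \<alpha>"
    for \<tau> \<tau>' \<sigma> \<sigma>' z \<alpha>
  proof -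
    define s where "s = - p \<sigma> + z + p \<sigma>'"
    define t where "t = - p \<tau> + z + p \<tau>'"
    have st: "s \<in> K2" "t \<in> K2" using rep by (simp_all add: s_def t_def)
    have z_eq: "z = p \<sigma> + s - p \<sigma>'" "z = p \<tau> + t - p \<tau>'"
      unfolding s_def t_def by (simp_all add: diff_conv_add_uminus add.assoc del: add_uminus_conv_diff)
    note W = window_later[OF T(3) below(1)] window_later[OF T(4) below(2)]
    note inv = conj_invariantD[OF conj_K2]
    consider "fst \<tau> = \<alpha>" "fst \<tau>' = \<alpha>" | "fst \<tau> = \<alpha>" "fst \<tau>' \<in> before \<alpha>" | "fst \<tau> \<in> before \<alpha>" "fst \<tau>' = \<alpha>"
      using top by blast
    then show False
    proof cases
      case 1
      have "\<tau> \<noteq> \<tau>'"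
      proof
        assume "\<tau> = \<tau>'"
        then have "z \<in> K2" using inv(1)[OF st(2), of "p \<tau>"] z_eq(2) by simp
        with z show False by blast
      qed
      define e where "e = (p \<sigma>' + s - p \<sigma>') + - (p \<tau>' + t - p \<tau>')"
      have "e \<in> K4" unfolding e_def by (intro K4 uminus_K2 inv st)
      have "p \<tau> - p \<tau>' = z + - (p \<tau>' + t - p \<tau>')"
        by (subst z_eq(2)) (simp add: minus_diff_eq minus_add diff_conv_add_uminus add.assoc del: add_uminus_conv_diff)
      also have "\<dots> = p \<sigma> + - p \<sigma>' + 0 + e"
        by (subst z_eq(1)) (simp add: e_def diff_conv_add_uminus add.assoc del: add_uminus_conv_diff)
      also have "\<dots> \<in> blocked (A \<alpha>)" by (intro blocked_mem W window_mem(1) \<open>e \<in> K4\<close>)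
      finally show False using diff_not_blocked[OF T(1,2) 1 \<open>\<tau> \<noteq> \<tau>'\<close>] by blast
    next
      case 2
      note W' = window_later[OF T(2) 2(2)]
      define g where "g = - p \<sigma>' + p \<tau>'"
      define e where "e = (- g + s + g) + - t"
      have "e \<in> K4" unfolding e_def by (intro K4 uminus_K2 inv st)
      have "p \<tau> = z + p \<tau>' + - t"
        by (subst z_eq(2)) (simp add: diff_conv_add_uminus add.assoc del: add_uminus_conv_diff)
      also have "\<dots> = p \<sigma> + - p \<sigma>' + p \<tau>' + e"
        by (subst z_eq(1)) (simp add: e_def g_def minus_add diff_conv_add_uminus add.assoc del: add_uminus_conv_diff)
      also have "\<dots> \<in> blocked (A \<alpha>)" by (intro blocked_mem W W' \<open>e \<in> K4\<close>)
      finally show False using not_blocked[OF T(1)] 2(1) by simp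
    next
      case 3
      note W' = window_later[OF T(1) 3(1)]
      define g where "g = - p \<sigma> + p \<tau>"
      define e where "e = (- g + - s + g) + t"
      have "e \<in> K4" unfolding e_def by (intro K4 uminus_K2 inv st)
      have "p \<tau>' = - z + p \<tau> + t"
        by (subst z_eq(2)) (simp add: minus_diff_eq minus_add diff_conv_add_uminus add.assoc del: add_uminus_conv_diff)
      also have "\<dots> = p \<sigma>' + - p \<sigma> + p \<tau> + e"
        by (subst z_eq(1)) (simp add: e_def g_def minus_diff_eq minus_add diff_conv_add_uminus add.assoc del: add_uminus_conv_diff)
      also have "\<dots> \<in> blocked (A \<alpha>)" by (intro blocked_mem W W' \<open>e \<in> K4\<close>)
      finally show False using not_blocked[OF T(2)] 3(2) by simp
    qed
  qed

  \<comment> \<open>The same for right quotients.\<close>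
  have right_unique: False
    if T: "\<tau> \<in> grid_indices" "\<tau>' \<in> grid_indices" "\<sigma> \<in> grid_indices" "\<sigma>' \<in> grid_indices"
      and z: "z \<notin> K2" and rep: "- p \<tau>' + p \<tau> + z \<in> K2" "- p \<sigma>' + p \<sigma> + z \<in> K2"
      and below: "fst \<sigma> \<in> before \<alpha>" "fst \<sigma>' \<in> before \<alpha>"
      and top: "fst \<tau> = \<alpha> \<or> fst \<tau> \<in> before \<alpha>" "fst \<tau>' = \<alpha> \<or> fst \<tau>' \<in> before \<alpha>" "fst \<tau> = \<alpha> \<or> fst \<tau>' = \<alpha>"
    for \<tau> \<tau>' \<sigma> \<sigma>' z \<alpha>
  proof -
    define s where "s = - p \<sigma>' + p \<sigma> + z"
    define t where "t = - p \<tau>' + p \<tau> + z"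
    have st: "s \<in> K2" "t \<in> K2" using rep by (simp_all add: s_def t_def)
    have z_eq: "z = - p \<sigma> + p \<sigma>' + s" "z = - p \<tau> + p \<tau>' + t"
      unfolding s_def t_def by (simp_all add: add.assoc)
    note W = window_later[OF T(3) below(1)] window_later[OF T(4) below(2)]
    note inv = conj_invariantD[OF conj_K2]
    consider "fst \<tau> = \<alpha>" "fst \<tau>' = \<alpha>" | "fst \<tau> = \<alpha>" "fst \<tau>' \<in> before \<alpha>" | "fst \<tau> \<in> before \<alpha>" "fst \<tau>' = \<alpha>"
      using top by blast
    then show False
    proof cases
      case 1
      have "\<tau> \<noteq> \<tau>'"
      proof
        assume "\<tau> = \<tau>'"
        then have "z \<in> K2" using st(2) z_eq(2) by simp
        with z show False by blast
      qed
      have "s + - t \<in> K4" by (intro K4 uminus_K2 st)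
      have "- p \<tau> + p \<tau>' = z + - t"
        by (subst z_eq(2)) (simp add: diff_conv_add_uminus add.assoc del: add_uminus_conv_diff)
      also have "\<dots> = - p \<sigma> + p \<sigma>' + 0 + (s + - t)"
        by (subst z_eq(1)) (simp add: diff_conv_add_uminus add.assoc del: add_uminus_conv_diff)
      also have "\<dots> \<in> blocked (A \<alpha>)" by (intro blocked_mem W window_mem(1) \<open>s + - t \<in> K4\<close>)
      finally show False using diff_not_blocked[OF T(1,2) 1 \<open>\<tau> \<noteq> \<tau>'\<close>] by blast
    next
      case 2
      note W' = window_later[OF T(2) 2(2)]
      define g where "g = - p \<sigma>' + p \<sigma>"
      define e where "e = - g + (t + - s) + g"
      have "e \<in> K4" unfolding e_def
        by (intro conj_invariantD(2)[OF conj_invariant_plus[OF conj_K2 conj_K2]] K4 uminus_K2 st)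
      have "p \<tau> = p \<tau>' + t + - z"
        by (subst z_eq(2)) (simp add: minus_add diff_conv_add_uminus add.assoc del: add_uminus_conv_diff)
      also have "\<dots> = p \<tau>' + - p \<sigma>' + p \<sigma> + e"
        by (subst z_eq(1)) (simp add: e_def g_def minus_add diff_conv_add_uminus add.assoc del: add_uminus_conv_diff)
      also have "\<dots> \<in> blocked (A \<alpha>)" by (intro blocked_mem W W' \<open>e \<in> K4\<close>)
      finally show False using not_blocked[OF T(1)] 2(1) by simp
    next
      case 3
      note W' = window_later[OF T(1) 3(1)]
      have "s + - t \<in> K4" by (intro K4 uminus_K2 st)
      have "p \<tau>' = p \<tau> + z + - t"
        by (subst z_eq(2)) (simp add: diff_conv_add_uminus add.assoc del: add_uminus_conv_diff)
      also have "\<dots> = p \<tau> + - p \<sigma> + p \<sigma>' + (s + - t)"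
        by (subst z_eq(1)) (simp add: diff_conv_add_uminus add.assoc del: add_uminus_conv_diff)
      also have "\<dots> \<in> blocked (A \<alpha>)" by (intro blocked_mem W W' \<open>s + - t \<in> K4\<close>)
      finally show False using not_blocked[OF T(2)] 3(2) by simp
    qed
  qed

  have finite_cover: "\<exists>S. finite S \<and> (\<forall>\<tau>\<in>grid_indices. \<forall>\<tau>'\<in>grid_indices. R \<tau> \<tau>' \<longrightarrow> p \<tau> \<in> S \<or> p \<tau>' \<in> S)"
    if uniq: "\<And>\<tau> \<tau>' \<sigma> \<sigma>' \<alpha>. \<tau> \<in> grid_indices \<Longrightarrow> \<tau>' \<in> grid_indices \<Longrightarrow> \<sigma> \<in> grid_indices \<Longrightarrow> \<sigma>' \<in> grid_indices \<Longrightarrow>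
      R \<tau> \<tau>' \<Longrightarrow> R \<sigma> \<sigma>' \<Longrightarrow> fst \<sigma> \<in> before \<alpha> \<Longrightarrow> fst \<sigma>' \<in> before \<alpha> \<Longrightarrow>
      fst \<tau> = \<alpha> \<or> fst \<tau> \<in> before \<alpha> \<Longrightarrow> fst \<tau>' = \<alpha> \<or> fst \<tau>' \<in> before \<alpha> \<Longrightarrow> fst \<tau> = \<alpha> \<or> fst \<tau>' = \<alpha> \<Longrightarrow> False"
    for R
  proof (cases "\<exists>\<sigma>\<in>grid_indices. \<exists>\<sigma>'\<in>grid_indices. R \<sigma> \<sigma>'")
    case True
    have top: "\<exists>\<alpha>\<in>Field index_order. (fst \<tau> = \<alpha> \<or> fst \<tau> \<in> before \<alpha>) \<and> (fst \<tau>' = \<alpha> \<or> fst \<tau>' \<in> before \<alpha>) \<and> (fst \<tau> = \<alpha> \<or> fst \<tau>' = \<alpha>)"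
      if "\<tau> \<in> grid_indices" "\<tau>' \<in> grid_indices" for \<tau> \<tau>'
      using index_order_facts(3)[OF fst_Field[OF that(1)] fst_Field[OF that(2)]] fst_Field that by metis
    obtain \<sigma> \<sigma>' where \<sigma>: "\<sigma> \<in> grid_indices" "\<sigma>' \<in> grid_indices" "R \<sigma> \<sigma>'" using True by blast
    obtain \<beta> where \<beta>: "\<beta> \<in> Field index_order" "fst \<sigma> = \<beta> \<or> fst \<sigma> \<in> before \<beta>" "fst \<sigma>' = \<beta> \<or> fst \<sigma>' \<in> before \<beta>" "fst \<sigma> = \<beta> \<or> fst \<sigma>' = \<beta>"
      using top[OF \<sigma>(1,2)] by blast
    have "p \<tau> \<in> grid (f \<beta>) (snd \<beta>) \<or> p \<tau>' \<in> grid (f \<beta>) (snd \<beta>)"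
      if \<tau>: "\<tau> \<in> grid_indices" "\<tau>' \<in> grid_indices" "R \<tau> \<tau>'" for \<tau> \<tau>'
    proof -
      obtain \<alpha> where \<alpha>: "\<alpha> \<in> Field index_order" "fst \<tau> = \<alpha> \<or> fst \<tau> \<in> before \<alpha>" "fst \<tau>' = \<alpha> \<or> fst \<tau>' \<in> before \<alpha>" "fst \<tau> = \<alpha> \<or> fst \<tau>' = \<alpha>"
        using top[OF \<tau>(1,2)] by blast
      have "\<beta> \<notin> before \<alpha>"
      proof
        assume "\<beta> \<in> before \<alpha>"
        then have b: "fst \<sigma> \<in> before \<alpha>" "fst \<sigma>' \<in> before \<alpha>" 
          using \<beta>(2,3) index_order_facts(2)[of "fst \<sigma>" \<beta> \<alpha>] index_order_facts(2)[of "fst \<sigma>'" \<beta> \<alpha>] by auto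
        show False by (rule uniq[OF \<tau>(1,2) \<sigma>(1,2) \<tau>(3) \<sigma>(3) b \<alpha>(2-4)])
      qed
      moreover have "\<alpha> \<notin> before \<beta>"
      proof
        assume "\<alpha> \<in> before \<beta>"
        then have b: "fst \<tau> \<in> before \<beta>" "fst \<tau>' \<in> before \<beta>" 
          using \<alpha>(2,3) index_order_facts(2)[of "fst \<tau>" \<alpha> \<beta>] index_order_facts(2)[of "fst \<tau>'" \<alpha> \<beta>] by auto
        show False by (rule uniq[OF \<sigma>(1,2) \<tau>(1,2) \<sigma>(3) \<tau>(3) b \<beta>(2-4)])
      qed
      ultimately have "\<alpha> = \<beta>" using index_order_facts(3)[OF \<alpha>(1) \<beta>(1)] by blast
      then show ?thesis using \<alpha>(4) p_grid[OF \<tau>(1)] p_grid[OF \<tau>(2)] by auto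
    qed
    moreover have "finite (grid (f \<beta>) (snd \<beta>))" by (simp add: grid_def)
    ultimately show ?thesis by blast
  qed blast

  show thesis
  proof (rule that[of p "\<lambda>\<alpha>. snd (f \<alpha>)" "\<lambda>\<alpha>. fst (f \<alpha>)"])
    show "p (\<alpha>, k, l) = snd (f \<alpha>) l + fst (f \<alpha>) k" for \<alpha> k l by (simp add: p_def)
    show "scattered p"
      unfolding scattered_def
    proof (intro conjI ballI allI impI)
      show "\<tau> = \<tau>'" if "\<tau> \<in> grid_indices" "\<tau>' \<in> grid_indices" "- p \<tau> + p \<tau>' \<in> K2" for \<tau> \<tau>'
        using that by (rule separated)
      fix z assume z: "z \<notin> K2"
      show "\<exists>S. finite S \<and> (\<forall>\<tau>\<in>grid_indices. \<forall>\<tau>'\<in>grid_indices.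
          - p \<tau> + z + p \<tau>' \<in> K2 \<longrightarrow> p \<tau> \<in> S \<or> p \<tau>' \<in> S)"
        by (rule finite_cover) (rule left_unique[OF _ _ _ _ z])
      show "\<exists>S. finite S \<and> (\<forall>\<tau>\<in>grid_indices. \<forall>\<tau>'\<in>grid_indices.
          - p \<tau>' + p \<tau> + z \<in> K2 \<longrightarrow> p \<tau> \<in> S \<or> p \<tau>' \<in> S)"
        by (rule finite_cover) (rule right_unique[OF _ _ _ _ z])
    qed
  qed
qed

end

section \<open>Eberlein functions do not correlate with Fourier matrices\<close>

definition fourier :: "nat \<Rightarrow> nat \<Rightarrow> nat \<Rightarrow> complex" where
  "fourier n k l = cis (2 * pi * real k * real l / real n)"

lemma norm_fourier: "cmod (fourier n k l) = 1"
  by (simp add: fourier_def)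

lemma fourier_mult_cnj: "fourier n k l * cnj (fourier n k l) = 1"
  by (simp add: complex_norm_square[symmetric] norm_fourier)

lemma cnj_sgn_mult: "cnj (sgn z) * z = of_real (cmod z)" for z :: complex
proof (cases "z = 0")
  case False
  have "cnj (sgn z) * z = (z * cnj z) / of_real (cmod z)" by (simp add: sgn_eq)
  also have "\<dots> = of_real ((cmod z)\<^sup>2) / of_real (cmod z)" by (simp only: complex_norm_square)
  finally show ?thesis using False by (simp add: power2_eq_square)
qed simp

lemma fourier_orthogonal:
  assumes "k < n" "k' < n"
  shows "(\<Sum>l<n. fourier n k l * cnj (fourier n k' l)) = (if k = k' then of_nat n else 0)"
proof (cases "k = k'")
  case True
  then show ?thesis by (simp add: fourier_mult_cnj)
next
  case False
  define a where "a = 2 * pi * (real k - real k') / real n"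
  have n: "real n > 0" using assms by simp
  have "fourier n k l * cnj (fourier n k' l) = cis a ^ l" for l
  proof -
    have "2 * pi * real k * real l / real n + - (2 * pi * real k' * real l / real n) = real l * a"
      using n by (simp add: a_def field_simps)
    then show ?thesis unfolding fourier_def cis_cnj cis_mult Complex.DeMoivre by simp
  qed
  then have "(\<Sum>l<n. fourier n k l * cnj (fourier n k' l)) = (\<Sum>l<n. cis a ^ l)" by simp
  also have "\<dots> = 0"
  proof -
    have "cis a \<noteq> 1"
    proof
      assume "cis a = 1"
      then have "cos a = 1" by (metis cis.sel(1) one_complex.sel(1))
      then obtain m :: int where "a = of_int m * (2 * pi)" by (auto simp: cos_one_2pi_int)
      then have "2 * pi * (real k - real k') = 2 * pi * (of_int m * real n)"
        using n unfolding a_def by (simp add: field_simps)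
      then have "real k - real k' = of_int m * real n" by simp
      then have eq: "int k - int k' = m * int n"
        by (metis of_int_diff of_int_eq_iff of_int_mult of_int_of_nat_eq)
      have "\<bar>int k - int k'\<bar> < int n" using assms by linarith
      with eq have "m = 0"
        by (metis abs_mult abs_of_nat mult_less_cancel_right2 not_less zabs_less_one_iff of_nat_less_0_iff)
      with eq False show False by simp
    qed
    moreover have "cis a ^ n = 1"
    proof -
      have "real n * a = 2 * pi * real_of_int (int k - int k')" using n unfolding a_def by simp
      then have "cis a ^ n = cis (2 * pi * real_of_int (int k - int k'))" by (simp add: Complex.DeMoivre)
      also have "\<dots> = 1" by (rule cis_multiple_2pi) simp
      finally show ?thesis .
    qed
    ultimately show ?thesis by (simp add: geometric_sum)
  qed
  finally show ?thesis using False by simp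
qed

lemma positive_definite_hermitian:
  assumes "positive_definite \<phi>"
  shows "\<phi> (- s) = cnj (\<phi> s)"
proof -
  have two: "a * cnj a * \<phi> 0 + a * cnj b * \<phi> (- s) + (b * cnj a * \<phi> s + b * cnj b * \<phi> 0) \<in> \<real>\<^sub>\<ge>\<^sub>0" for a b
    using assms[unfolded positive_definite_def, rule_format,
        of "\<lambda>i. if i = 0 then a else b" "\<lambda>i. if i = 0 then 0 else s" 2]
    by (simp add: numeral_2_eq_2 add.assoc)
  have im0: "Im (\<phi> 0) = 0" using two[of 1 0] by (simp add: complex_nonneg_Reals_iff)
  have "Im (\<phi> (- s)) = - Im (\<phi> s)"
    using two[of 1 1] im0 by (simp add: complex_nonneg_Reals_iff)
  moreover have "Re (\<phi> (- s)) = Re (\<phi> s)"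
    using two[of 1 \<i>] im0 by (simp add: complex_nonneg_Reals_iff)
  ultimately show ?thesis by (simp add: complex_eq_iff)
qed

text \<open>
  For each column \<open>l\<close>, apply positive definiteness to the points \<open>x k\<close> with the coefficients
  \<open>\<theta> * fourier n k l\<close> and the point \<open>- y l\<close> with the coefficient \<open>- \<surd>n\<close>, and add up the columns. By
  orthogonality the terms with two \<open>x\<close> contribute \<open>n\<^sup>2 \<phi>(0)\<close>. The phase \<open>\<theta>\<close> makes the
  mixed terms real, and the weight \<open>\<surd>n\<close> balances the two kinds of square terms.
\<close>

lemma positive_definite_fourier_bound:
  fixes x y :: "nat \<Rightarrow> 'a::group_add"
  assumes pd: "positive_definite \<phi>"
  shows "cmod (\<Sum>l<n. \<Sum>k<n. fourier n k l * \<phi> (y l + x k)) \<le> real n * sqrt (real n) * Re (\<phi> 0)"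
proof (cases "n = 0")
  case False
  define S where "S l = (\<Sum>k<n. fourier n k l * \<phi> (y l + x k))" for l
  define \<theta> where "\<theta> = (if (\<Sum>l<n. S l) = 0 then 1 else cnj (sgn (\<Sum>l<n. S l)))"
  have \<theta>1: "\<theta> * cnj \<theta> = 1"
    unfolding \<theta>_def by (simp add: complex_norm_square[symmetric] norm_sgn mult.commute)
  have \<theta>S: "\<theta> * (\<Sum>l<n. S l) = of_real (cmod (\<Sum>l<n. S l))"
    unfolding \<theta>_def using cnj_sgn_mult by (simp only: if_distrib split: if_split) simp
  define r where "r = sqrt (real n)"
  have r: "r > 0" "r * r = real n" using False by (simp_all add: r_def)
  define A where "A l = (\<Sum>i<n. \<Sum>j<n. fourier n i l * cnj (fourier n j l) * \<phi> (- x j + x i))" for l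
  have key: "0 \<le> Re (A l) - 2 * r * Re (\<theta> * S l) + r * r * Re (\<phi> 0)" for l
  proof -
    define s where "s i = (if i < n then x i else - y l)" for i
    define c where "c i = (if i < n then \<theta> * fourier n i l else - of_real r)" for i
    let ?t = "\<lambda>i j. c i * cnj (c j) * \<phi> (- s j + s i)"
    have "(\<Sum>i<Suc n. \<Sum>j<Suc n. ?t i j) \<in> \<real>\<^sub>\<ge>\<^sub>0"
      using pd unfolding positive_definite_def by blast
    then have nonneg: "0 \<le> Re (\<Sum>i<Suc n. \<Sum>j<Suc n. ?t i j)" by (simp add: complex_nonneg_Reals_iff)
    have "(\<Sum>i<Suc n. \<Sum>j<Suc n. ?t i j) =
        (\<Sum>i<n. \<Sum>j<n. ?t i j) + (\<Sum>i<n. ?t i n) + ((\<Sum>j<n. ?t n j) + ?t n n)"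
      by (simp add: sum.distrib)
    moreover have "(\<Sum>i<n. \<Sum>j<n. ?t i j) = A l"
      unfolding A_def
    proof (intro sum.cong refl)
      fix i j assume "i \<in> {..<n}" "j \<in> {..<n}"
      then have "?t i j = (\<theta> * cnj \<theta>) * (fourier n i l * cnj (fourier n j l)) * \<phi> (- x j + x i)"
        by (simp add: c_def s_def mult_ac)
      then show "?t i j = fourier n i l * cnj (fourier n j l) * \<phi> (- x j + x i)" by (simp add: \<theta>1)
    qed
    moreover have "(\<Sum>i<n. ?t i n) = - of_real r * (\<theta> * S l)"
      unfolding S_def sum_distrib_left
      by (intro sum.cong refl) (simp add: c_def s_def mult_ac)
    moreover have "(\<Sum>j<n. ?t n j) = cnj (- of_real r * (\<theta> * S l))"
      unfolding S_def sum_distrib_left cnj_sum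
    proof (intro sum.cong refl)
      fix j assume "j \<in> {..<n}"
      moreover have "\<phi> (- x j + - y l) = cnj (\<phi> (y l + x j))"
        using positive_definite_hermitian[OF pd, of "y l + x j"] by (simp only: minus_add)
      ultimately show "?t n j = cnj (- of_real r * (\<theta> * (fourier n j l * \<phi> (y l + x j))))"
        by (simp add: c_def s_def mult_ac del: add_uminus_conv_diff)
    qed
    moreover have "?t n n = of_real (r * r) * \<phi> 0" by (simp add: c_def s_def)
    ultimately have total: "(\<Sum>i<Suc n. \<Sum>j<Suc n. ?t i j) =
        A l + - of_real r * (\<theta> * S l) + (cnj (- of_real r * (\<theta> * S l)) + of_real (r * r) * \<phi> 0)"
      by (simp only:)
    have "Re (a + - of_real r * z + (cnj (- of_real r * z) + of_real (r * r) * b)) =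
        Re a - 2 * r * Re z + r * r * Re b" for a z b
      by simp
    then have "Re (\<Sum>i<Suc n. \<Sum>j<Suc n. ?t i j) = Re (A l) - 2 * r * Re (\<theta> * S l) + r * r * Re (\<phi> 0)"
      unfolding total by blast
    with nonneg show ?thesis by linarith
  qed
  have "(\<Sum>l<n. A l) = (\<Sum>i<n. \<Sum>j<n. (\<Sum>l<n. fourier n i l * cnj (fourier n j l)) * \<phi> (- x j + x i))"
  proof -
    have "(\<Sum>l<n. A l) = (\<Sum>i<n. \<Sum>l<n. \<Sum>j<n. fourier n i l * cnj (fourier n j l) * \<phi> (- x j + x i))"
      unfolding A_def by (rule sum.swap)
    also have "\<dots> = (\<Sum>i<n. \<Sum>j<n. \<Sum>l<n. fourier n i l * cnj (fourier n j l) * \<phi> (- x j + x i))"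
      by (intro sum.cong refl sum.swap)
    finally show ?thesis by (simp only: sum_distrib_right)
  qed
  also have "\<dots> = (\<Sum>i<n. \<Sum>j<n. if i = j then of_nat n * \<phi> 0 else 0)"
    by (intro sum.cong refl) (simp add: fourier_orthogonal)
  also have "\<dots> = of_nat n * (of_nat n * \<phi> 0)" by simp
  finally have sumA: "Re (\<Sum>l<n. A l) = real n * real n * Re (\<phi> 0)" by simp
  have "0 \<le> (\<Sum>l<n. Re (A l) - 2 * r * Re (\<theta> * S l) + r * r * Re (\<phi> 0))"
    using key by (intro sum_nonneg) simp
  also have "\<dots> = Re (\<Sum>l<n. A l) - 2 * r * Re (\<theta> * (\<Sum>l<n. S l)) + real n * (r * r * Re (\<phi> 0))"
  proof -
    have "(\<Sum>l<n. 2 * r * Re (\<theta> * S l)) = 2 * r * Re (\<theta> * (\<Sum>l<n. S l))"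
      by (simp only: sum_distrib_left Re_sum)
    then show ?thesis by (simp only: sum.distrib sum_subtractf sum_constant card_lessThan Re_sum)
  qed
  also have "\<dots> = 2 * (real n * real n * Re (\<phi> 0)) - 2 * r * cmod (\<Sum>l<n. S l)"
    unfolding sumA \<theta>S r(2) by simp
  finally have "r * cmod (\<Sum>l<n. S l) \<le> real n * real n * Re (\<phi> 0)" by simp
  also have "\<dots> = r * (real n * r * Re (\<phi> 0))" using r(2) by (simp add: algebra_simps)
  finally have "cmod (\<Sum>l<n. S l) \<le> real n * r * Re (\<phi> 0)" using r(1) by simp
  then show ?thesis unfolding S_def r_def .
qed simp

definition fourier_pairing :: "nat \<Rightarrow> (nat \<Rightarrow> 'a) \<Rightarrow> (nat \<Rightarrow> 'a) \<Rightarrow> ('a::topological_group_add \<Rightarrow>\<^sub>C complex) \<Rightarrow> complex" where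
  "fourier_pairing n x y f = (\<Sum>l<n. \<Sum>k<n. fourier n k l * apply_bcontfun f (y l + x k))"

lemma fourier_pairing_add:
  "fourier_pairing n x y (f + g) = fourier_pairing n x y f + fourier_pairing n x y g"
  unfolding fourier_pairing_def by (simp add: plus_bcontfun.rep_eq distrib_left sum.distrib)

lemma fourier_pairing_cscale: "fourier_pairing n x y (cscale c f) = c * fourier_pairing n x y f"
  unfolding fourier_pairing_def by (simp add: cscale.rep_eq sum_distrib_left mult_ac)

lemma fourier_pairing_le: "cmod (fourier_pairing n x y f) \<le> real n * real n * norm f"
proof -
  have "cmod (fourier_pairing n x y f) \<le> (\<Sum>l<n. \<Sum>k<n. norm f)"
    unfolding fourier_pairing_def
    by (intro sum_norm_le) (simp add: norm_mult norm_fourier norm_bounded)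
  then show ?thesis by simp
qed

lemma Fourier_Stieltjes_pairing_bound:
  assumes "u \<in> Fourier_Stieltjes"
  shows "\<exists>C. \<forall>n x y. cmod (fourier_pairing n x y u) \<le> C * (real n * sqrt (real n))"
  using assms unfolding Fourier_Stieltjes_def
proof (induction rule: CB.span_induct_alt)
  case base
  show ?case by (intro exI[of _ 0]) (simp add: fourier_pairing_def)
next
  case (step c g h)
  obtain C where C: "\<And>n x y. cmod (fourier_pairing n x y h) \<le> C * (real n * sqrt (real n))"
    using step.IH by blast
  define d where "d = Re (apply_bcontfun g 0)"
  have g: "cmod (fourier_pairing n x y g) \<le> real n * sqrt (real n) * d" for n x y
    using step.hyps unfolding fourier_pairing_def d_def by (intro positive_definite_fourier_bound) simp
  have "cmod (fourier_pairing n x y (cscale c g + h)) \<le> (cmod c * d + C) * (real n * sqrt (real n))" for n x y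
  proof -
    have "cmod (fourier_pairing n x y (cscale c g + h)) \<le> cmod c * cmod (fourier_pairing n x y g) + cmod (fourier_pairing n x y h)"
      unfolding fourier_pairing_add fourier_pairing_cscale by (metis norm_mult norm_triangle_ineq)
    also have "\<dots> \<le> cmod c * (real n * sqrt (real n) * d) + C * (real n * sqrt (real n))"
      by (intro add_mono mult_left_mono g C) simp
    finally show ?thesis by (simp add: algebra_simps)
  qed
  then show ?case by blast
qed

text \<open>
  The pairing of order \<open>n\<close> is \<open>n\<^sup>2 * a\<close> on \<open>f\<close>, has norm at most \<open>n\<^sup>2\<close>, and is at most of order \<open>n\<^bsup>3/2\<^esup>\<close> on
  any fixed Fourier-Stieltjes function. Division by \<open>n\<^sup>2\<close> leaves the claim as \<open>n\<close> grows.
\<close>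

lemma norm_ge_of_fourier_values:
  fixes f :: "'a::topological_group_add \<Rightarrow>\<^sub>C complex" and x y :: "nat \<Rightarrow> nat \<Rightarrow> 'a"
  assumes f: "\<And>n k l. k < n \<Longrightarrow> l < n \<Longrightarrow> apply_bcontfun f (y n l + x n k) = a * cnj (fourier n k l)"
    and w: "w \<in> Eberlein"
  shows "cmod a \<le> norm (f + w)"
proof -
  have pairing: "fourier_pairing n (x n) (y n) f = of_nat n * of_nat n * a" for n
  proof -
    have "fourier_pairing n (x n) (y n) f = (\<Sum>l<n. \<Sum>k<n. a)"
      unfolding fourier_pairing_def
    proof (intro sum.cong refl)
      fix l k assume "l \<in> {..<n}" "k \<in> {..<n}"
      then have "fourier n k l * apply_bcontfun f (y n l + x n k) = (fourier n k l * cnj (fourier n k l)) * a"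
        by (simp add: f)
      then show "fourier n k l * apply_bcontfun f (y n l + x n k) = a" by (simp add: fourier_mult_cnj)
    qed
    then show ?thesis by simp
  qed
  have "cmod a \<le> norm (f + u)" if u: "u \<in> Fourier_Stieltjes" for u
  proof (rule field_le_epsilon)
    fix e :: real assume "e > 0"
    obtain C where C: "\<And>n x y. cmod (fourier_pairing n x y u) \<le> C * (real n * sqrt (real n))"
      using Fourier_Stieltjes_pairing_bound[OF u] by blast
    obtain m :: nat where m: "(C / e)\<^sup>2 < real m" using reals_Archimedean2 by blast
    then have m0: "real m > 0" by (meson le_less_trans zero_le_power2)
    have "\<bar>C / e\<bar> < sqrt (real m)" using m by (metis real_sqrt_abs real_sqrt_less_iff)
    then have Ce: "C \<le> e * sqrt (real m)" using \<open>e > 0\<close> by (simp add: abs_less_iff field_simps)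
    have "real m * real m * cmod a = cmod (fourier_pairing m (x m) (y m) f)"
      by (simp add: pairing norm_mult)
    also have "\<dots> \<le> cmod (fourier_pairing m (x m) (y m) (f + u)) + cmod (fourier_pairing m (x m) (y m) u)"
      unfolding fourier_pairing_add by (metis add_diff_cancel_right' norm_triangle_ineq4)
    also have "\<dots> \<le> real m * real m * norm (f + u) + C * (real m * sqrt (real m))"
      by (intro add_mono fourier_pairing_le C)
    also have "C * (real m * sqrt (real m)) \<le> (e * sqrt (real m)) * (real m * sqrt (real m))"
      using Ce by (intro mult_right_mono) auto
    also have "\<dots> = real m * real m * e" by (simp add: mult_ac)
    finally have "(real m * real m) * cmod a \<le> (real m * real m) * (norm (f + u) + e)"
      by (simp add: distrib_left)
    then show "cmod a \<le> norm (f + u) + e" using m0 by simp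
  qed
  then have "Fourier_Stieltjes \<subseteq> {u. cmod a \<le> norm (f + u)}" by blast
  moreover have "closed {u. cmod a \<le> norm (f + u)}"
    by (intro closed_Collect_le continuous_intros)
  ultimately have "Eberlein \<subseteq> {u. cmod a \<le> norm (f + u)}"
    unfolding Eberlein_def by (rule closure_minimal)
  with w show ?thesis by blast
qed

section \<open>Cosets of the Eberlein algebra\<close>

lemma norm_cscale_le: "norm (cscale c f) \<le> cmod c * norm f"
  by (rule norm_bound) (simp add: cscale.rep_eq norm_mult mult_left_mono norm_bounded)

lemma Eberlein_subspace:
  "0 \<in> (Eberlein :: ('a::topological_group_add \<Rightarrow>\<^sub>C complex) set)"
  "u \<in> Eberlein \<Longrightarrow> v \<in> Eberlein \<Longrightarrow> u + v \<in> (Eberlein :: ('a \<Rightarrow>\<^sub>C complex) set)"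
  "u \<in> Eberlein \<Longrightarrow> cscale c u \<in> (Eberlein :: ('a \<Rightarrow>\<^sub>C complex) set)"
proof -
  let ?B = "Fourier_Stieltjes :: ('a \<Rightarrow>\<^sub>C complex) set"
  show "0 \<in> (Eberlein :: ('a \<Rightarrow>\<^sub>C complex) set)"
    unfolding Eberlein_def Fourier_Stieltjes_def using CB.span_zero closure_subset by blast
  show "u + v \<in> (Eberlein :: ('a \<Rightarrow>\<^sub>C complex) set)" if uv: "u \<in> Eberlein" "v \<in> Eberlein"
  proof -
    obtain a b where a: "\<And>n. a n \<in> ?B" "a \<longlonglongrightarrow> u" and b: "\<And>n. b n \<in> ?B" "b \<longlonglongrightarrow> v"
      using uv unfolding Eberlein_def closure_sequential by blast
    have "a n + b n \<in> ?B" for n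
      using a(1) b(1) unfolding Fourier_Stieltjes_def by (intro CB.span_add)
    moreover have "(\<lambda>n. a n + b n) \<longlonglongrightarrow> u + v" using a(2) b(2) by (rule tendsto_add)
    ultimately show ?thesis
      unfolding Eberlein_def closure_sequential by (intro exI[of _ "\<lambda>n. a n + b n"]) simp
  qed
  show "cscale c u \<in> (Eberlein :: ('a \<Rightarrow>\<^sub>C complex) set)" if u: "u \<in> Eberlein"
  proof -
    obtain a where a: "\<And>n. a n \<in> ?B" "a \<longlonglongrightarrow> u"
      using u unfolding Eberlein_def closure_sequential by blast
    have "cscale c (a n) \<in> ?B" for n
      using a(1) unfolding Fourier_Stieltjes_def by (intro CB.span_scale)
    moreover have "(\<lambda>n. cscale c (a n)) \<longlonglongrightarrow> cscale c u"
    proof (rule Lim_null_comparison[THEN LIM_zero_cancel])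
      show "eventually (\<lambda>n. norm (cscale c (a n) - cscale c u) \<le> cmod c * norm (a n - u)) sequentially"
        using norm_cscale_le[of c "a _ - u"] by (simp add: CB.scale_right_diff_distrib)
      show "(\<lambda>n. cmod c * norm (a n - u)) \<longlonglongrightarrow> 0"
        using a(2) by (intro tendsto_mult_right_zero tendsto_norm_zero) (simp add: LIM_zero)
    qed
    ultimately show ?thesis
      unfolding Eberlein_def closure_sequential by (intro exI[of _ "\<lambda>n. cscale c (a n)"]) simp
  qed
qed

lemma Eberlein_coset_add:
  "((f + g) +o (Eberlein :: ('a::topological_group_add \<Rightarrow>\<^sub>C complex) set)) = (f +o Eberlein) + (g +o Eberlein)"
proof (intro equalityI subsetI)
  fix h assume "h \<in> (f + g) +o (Eberlein :: ('a \<Rightarrow>\<^sub>C complex) set)"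
  then obtain w where w: "w \<in> Eberlein" "h = f + g + w" by (auto simp: elt_set_plus_def)
  then have "h = (f + w) + (g + 0)" by simp
  then show "h \<in> (f +o Eberlein) + (g +o Eberlein)"
    using w(1) Eberlein_subspace(1) unfolding set_plus_def elt_set_plus_def by blast
next
  fix h assume "h \<in> (f +o Eberlein) + (g +o (Eberlein :: ('a \<Rightarrow>\<^sub>C complex) set))"
  then obtain v w where "v \<in> Eberlein" "w \<in> Eberlein" "h = (f + v) + (g + w)"
    by (auto simp: elt_set_plus_def elim!: set_plus_elim)
  then have "v + w \<in> Eberlein" "h = (f + g) + (v + w)" by (simp_all add: Eberlein_subspace(2))
  then show "h \<in> (f + g) +o Eberlein" by (auto simp: elt_set_plus_def)
qed

lemma Eberlein_coset_scale:
  "cscale c f +o (Eberlein :: ('a::topological_group_add \<Rightarrow>\<^sub>C complex) set) = coset_scale Eberlein c (f +o Eberlein)"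
proof (intro equalityI subsetI)
  fix h assume "h \<in> cscale c f +o (Eberlein :: ('a \<Rightarrow>\<^sub>C complex) set)"
  then obtain w where w: "w \<in> Eberlein" "h = cscale c f + w" by (auto simp: elt_set_plus_def)
  moreover have "f \<in> f +o Eberlein" using Eberlein_subspace(1) unfolding elt_set_plus_def by force
  ultimately show "h \<in> coset_scale Eberlein c (f +o Eberlein)"
    unfolding coset_scale_def by (auto intro!: set_plus_intro)
next
  fix h assume "h \<in> coset_scale Eberlein c (f +o (Eberlein :: ('a \<Rightarrow>\<^sub>C complex) set))"
  then obtain v w where "v \<in> Eberlein" "w \<in> Eberlein" "h = cscale c (f + v) + w"
    unfolding coset_scale_def by (auto simp: elt_set_plus_def elim!: set_plus_elim)
  then have "cscale c v + w \<in> Eberlein" "h = cscale c f + (cscale c v + w)"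
    by (simp_all add: Eberlein_subspace(2,3) CB.scale_right_distrib)
  then show "h \<in> cscale c f +o Eberlein" by (auto simp: elt_set_plus_def)
qed

lemma linf_bound:
  assumes "\<xi> \<in> linf I" "i \<in> I"
  shows "cmod (\<xi> i) \<le> linf_norm I \<xi>"
  unfolding linf_norm_def
proof (rule cSUP_upper[OF assms(2)])
  obtain b where "\<forall>i\<in>I. cmod (\<xi> i) \<le> b" using assms(1) unfolding linf_def bounded_iff by auto
  then show "bdd_above ((\<lambda>i. cmod (\<xi> i)) ` I)" by (intro bdd_aboveI2[of _ _ b]) simp
qed

section \<open>The isometry\<close>

locale scattered_bumps = few_translates_not_covering K I
  for K :: "'a::{topological_group_add, t2_space} set" and I :: "'i set" +
  fixes h :: "'a \<Rightarrow> real" and x y :: "'i \<times> nat \<Rightarrow> nat \<Rightarrow> 'a" and p :: "('i \<times> nat) \<times> nat \<times> nat \<Rightarrow> 'a"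
  assumes h0: "h 0 = 1" and h_nonneg: "0 \<le> h t" and h_le: "h t \<le> 1" and h_supp: "t \<notin> K \<Longrightarrow> h t = 0"
    and h_unif: "\<epsilon> > 0 \<Longrightarrow> \<exists>N. open N \<and> 0 \<in> N \<and> (\<forall>v\<in>N. \<forall>g t. \<bar>h (g + v - g + t) - h t\<bar> \<le> \<epsilon>)"
    and p: "p (\<alpha>, k, l) = y \<alpha> l + x \<alpha> k"
    and scattered: "scattered p"
begin

lemma separated: "\<tau> \<in> grid_indices \<Longrightarrow> \<tau>' \<in> grid_indices \<Longrightarrow> - p \<tau> + p \<tau>' \<in> K2 \<Longrightarrow> \<tau> = \<tau>'"
  using scattered[unfolded scattered_def, THEN conjunct1] by blast

lemmas scattered_left = scattered[unfolded scattered_def, THEN conjunct2, THEN conjunct1, rule_format]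
lemmas scattered_right = scattered[unfolded scattered_def, THEN conjunct2, THEN conjunct2, rule_format]

text \<open>
  If \<open>t\<close> is in no support, this is an arbitrary index. It does no harm: \<open>bumps \<xi> t\<close> is \<open>0\<close> anyway,
  because the coefficient or the value of \<open>h\<close> vanishes.
\<close>

definition nearest :: "'a \<Rightarrow> ('i \<times> nat) \<times> nat \<times> nat" where
  "nearest t = (SOME \<tau>. \<tau> \<in> grid_indices \<and> - p \<tau> + t \<in> K)"

definition coefficient :: "('i \<Rightarrow> complex) \<Rightarrow> ('i \<times> nat) \<times> nat \<times> nat \<Rightarrow> complex" where
  "coefficient \<xi> \<tau> = (if \<tau> \<in> grid_indices
     then \<xi> (fst (fst \<tau>)) * cnj (fourier (snd (fst \<tau>)) (fst (snd \<tau>)) (snd (snd \<tau>))) else 0)"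

definition bumps :: "('i \<Rightarrow> complex) \<Rightarrow> 'a \<Rightarrow> complex" where
  "bumps \<xi> t = coefficient \<xi> (nearest t) * of_real (h (- p (nearest t) + t))"

lemma nearest_eq:
  assumes "\<tau> \<in> grid_indices" "- p \<tau> + t \<in> K"
  shows "nearest t = \<tau>"
proof -
  have "nearest t \<in> grid_indices \<and> - p (nearest t) + t \<in> K"
    unfolding nearest_def by (rule someI[of _ \<tau>]) (use assms in blast)
  then have n: "nearest t \<in> grid_indices" "- p (nearest t) + t \<in> K" by blast+
  have "- p (nearest t) + p \<tau> = (- p (nearest t) + t) + - (- p \<tau> + t)"
    by (simp add: minus_add add.assoc)
  also have "\<dots> \<in> K2" by (intro set_plus_intro uminus_K n assms)
  finally show ?thesis by (rule separated[OF n(1) assms(1)])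
qed

lemma bumps_nonzero:
  assumes "bumps \<xi> t \<noteq> 0"
  shows "nearest t \<in> grid_indices" "- p (nearest t) + t \<in> K"
  using assms h_supp unfolding bumps_def coefficient_def by (auto split: if_splits)

lemma cmod_coefficient_le:
  assumes "\<xi> \<in> linf I"
  shows "cmod (coefficient \<xi> \<tau>) \<le> linf_norm I \<xi>"
proof -
  have "I \<noteq> {}" using inf by auto
  then obtain i where "i \<in> I" by blast
  then have "0 \<le> linf_norm I \<xi>" using linf_bound[OF assms] norm_ge_zero order_trans by blast
  moreover have "cmod (\<xi> (fst (fst \<tau>))) \<le> linf_norm I \<xi>" if "\<tau> \<in> grid_indices"
    using that by (intro linf_bound[OF assms]) (auto simp: grid_indices_def)
  ultimately show ?thesis by (simp add: coefficient_def norm_mult norm_fourier)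
qed

lemma linf_norm_nonneg: "\<xi> \<in> linf I \<Longrightarrow> 0 \<le> linf_norm I \<xi>"
  using cmod_coefficient_le norm_ge_zero order_trans by blast

lemma cmod_bumps_le:
  assumes "\<xi> \<in> linf I"
  shows "cmod (bumps \<xi> t) \<le> linf_norm I \<xi>"
proof -
  have "cmod (bumps \<xi> t) = cmod (coefficient \<xi> (nearest t)) * h (- p (nearest t) + t)"
    using h_nonneg by (simp add: bumps_def norm_mult)
  also have "\<dots> \<le> linf_norm I \<xi> * 1"
    by (intro mult_mono cmod_coefficient_le assms h_le h_nonneg linf_norm_nonneg)
  finally show ?thesis by simp
qed

text \<open>
  The factor \<open>2\<close> covers the case that \<open>s\<close> and \<open>t\<close> are in the supports of two different bumps; each of
  these bumps is then close to its value \<open>0\<close> at the other point.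
\<close>

lemma bumps_close:
  assumes \<xi>: "\<xi> \<in> linf I" and close: "\<And>\<tau>. \<bar>h (- p \<tau> + s) - h (- p \<tau> + t)\<bar> \<le> \<epsilon>"
  shows "cmod (bumps \<xi> s - bumps \<xi> t) \<le> 2 * linf_norm I \<xi> * \<epsilon>"
proof -
  let ?M = "linf_norm I \<xi>"
  have M: "0 \<le> ?M" using \<xi> by (rule linf_norm_nonneg)
  have \<epsilon>: "0 \<le> \<epsilon>" using close[of undefined] by linarith
  have one: "cmod (coefficient \<xi> \<tau>) * r \<le> ?M * \<epsilon>" if "r \<le> \<epsilon>" "0 \<le> r" for \<tau> r
    using that M cmod_coefficient_le[OF \<xi>] by (intro mult_mono) auto
  show ?thesis
  proof (cases "nearest s = nearest t")
    case True
    have "bumps \<xi> s - bumps \<xi> t = coefficient \<xi> (nearest t) * of_real (h (- p (nearest t) + s) - h (- p (nearest t) + t))"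
      unfolding bumps_def True by (simp add: right_diff_distrib)
    then have "cmod (bumps \<xi> s - bumps \<xi> t) = cmod (coefficient \<xi> (nearest t)) * \<bar>h (- p (nearest t) + s) - h (- p (nearest t) + t)\<bar>"
      by (simp only: norm_mult norm_of_real)
    also have "\<dots> \<le> ?M * \<epsilon>" by (intro one close) simp
    also have "\<dots> \<le> 2 * ?M * \<epsilon>" using M \<epsilon> by (simp add: mult_nonneg_nonneg)
    finally show ?thesis .
  next
    case False
    have small: "cmod (bumps \<xi> a) \<le> ?M * \<epsilon>"
      if ab: "nearest a \<noteq> nearest b" and cl: "\<And>\<tau>. \<bar>h (- p \<tau> + a) - h (- p \<tau> + b)\<bar> \<le> \<epsilon>" for a b
    proof (cases "bumps \<xi> a = 0")
      case True
      then show ?thesis using M \<epsilon> by simp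
    next
      case False
      have "- p (nearest a) + b \<notin> K"
        using nearest_eq[OF bumps_nonzero(1)[OF False], of b] ab by auto
      then have "h (- p (nearest a) + b) = 0" by (rule h_supp)
      then have "h (- p (nearest a) + a) \<le> \<epsilon>" using cl[of "nearest a"] by simp
      then have "cmod (coefficient \<xi> (nearest a)) * h (- p (nearest a) + a) \<le> ?M * \<epsilon>"
        using h_nonneg by (intro one)
      then show ?thesis using h_nonneg by (simp add: bumps_def norm_mult)
    qed
    have "cmod (bumps \<xi> s) \<le> ?M * \<epsilon>" using False close by (rule small)
    moreover have "cmod (bumps \<xi> t) \<le> ?M * \<epsilon>"
      by (rule small[of t s]) (use False close in \<open>auto simp: abs_minus_commute\<close>)
    ultimately show ?thesis using norm_triangle_ineq4[of "bumps \<xi> s" "bumps \<xi> t"] by linarith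
  qed
qed

lemma bumps_uniformly_continuous:
  assumes \<xi>: "\<xi> \<in> linf I"
  shows "uniformly_continuous_left (bumps \<xi>)" "uniformly_continuous_right (bumps \<xi>)"
proof -
  have "\<exists>N. open N \<and> 0 \<in> N \<and> (\<forall>v\<in>N. \<forall>t. cmod (bumps \<xi> (v + t) - bumps \<xi> t) \<le> \<epsilon> \<and>
      cmod (bumps \<xi> (t + v) - bumps \<xi> t) \<le> \<epsilon>)" if \<epsilon>: "\<epsilon> > 0" for \<epsilon>
  proof -
    define M where "M = 2 * linf_norm I \<xi> + 1"
    have M: "M > 0" using linf_norm_nonneg[OF \<xi>] by (simp add: M_def)
    obtain N where N: "open N" "0 \<in> N" "\<And>v g t. v \<in> N \<Longrightarrow> \<bar>h (g + v - g + t) - h t\<bar> \<le> \<epsilon> / M"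
      using h_unif[of "\<epsilon> / M"] \<epsilon> M by auto
    have bound: "2 * linf_norm I \<xi> * (\<epsilon> / M) \<le> \<epsilon>"
    proof -
      have "2 * linf_norm I \<xi> * (\<epsilon> / M) \<le> M * (\<epsilon> / M)"
        using \<epsilon> M by (intro mult_right_mono) (auto simp: M_def)
      then show ?thesis using M by simp
    qed
    have "cmod (bumps \<xi> (v + t) - bumps \<xi> t) \<le> \<epsilon>" if v: "v \<in> N" for v t
    proof -
      have "\<bar>h (- p \<tau> + (v + t)) - h (- p \<tau> + t)\<bar> \<le> \<epsilon> / M" for \<tau>
      proof -
        have "- p \<tau> + (v + t) = - p \<tau> + v - (- p \<tau>) + (- p \<tau> + t)"
          by (simp add: add.assoc diff_conv_add_uminus del: add_uminus_conv_diff)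
        then show ?thesis using N(3)[OF v, of "- p \<tau>" "- p \<tau> + t"] by simp
      qed
      from bumps_close[OF \<xi> this] bound show ?thesis by linarith
    qed
    moreover have "cmod (bumps \<xi> (t + v) - bumps \<xi> t) \<le> \<epsilon>" if v: "v \<in> N" for v t
    proof -
      have "\<bar>h (- p \<tau> + (t + v)) - h (- p \<tau> + t)\<bar> \<le> \<epsilon> / M" for \<tau>
      proof -
        have "- p \<tau> + (t + v) = (- p \<tau> + t) + v - (- p \<tau> + t) + (- p \<tau> + t)"
          by (simp add: add.assoc)
        then show ?thesis using N(3)[OF v, of "- p \<tau> + t" "- p \<tau> + t"] by simp
      qed
      from bumps_close[OF \<xi> this] bound show ?thesis by linarith
    qed
    ultimately show ?thesis using N(1,2) by blast
  qed
  then show "uniformly_continuous_left (bumps \<xi>)" "uniformly_continuous_right (bumps \<xi>)"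
    unfolding uniformly_continuous_left_def uniformly_continuous_right_def by meson+
qed

definition Bumps :: "('i \<Rightarrow> complex) \<Rightarrow> ('a \<Rightarrow>\<^sub>C complex)" where
  "Bumps \<xi> = Bcontfun (bumps \<xi>)"

lemma apply_Bumps: "\<xi> \<in> linf I \<Longrightarrow> apply_bcontfun (Bumps \<xi>) = bumps \<xi>"
  unfolding Bumps_def
  by (rule Bcontfun_inverse, rule bcontfun_normI[OF uniformly_continuous_right_continuous cmod_bumps_le])
     (rule bumps_uniformly_continuous)

lemma Bumps_WAP:
  assumes \<xi>: "\<xi> \<in> linf I"
  shows "Bumps \<xi> \<in> WAP"
proof -
  have cK2: "compact K2" by (intro compact_set_plus compact_K)
  have near: "t \<in> S + K" if "bumps \<xi> t \<noteq> 0" "p (nearest t) \<in> S" for t S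
  proof -
    have "p (nearest t) + (- p (nearest t) + t) \<in> S + K"
      using that(2) bumps_nonzero(2)[OF that(1)] by (rule set_plus_intro)
    then show ?thesis by (simp add: add.assoc[symmetric])
  qed
  have left: "\<exists>T. compact T \<and> {t. bumps \<xi> t \<noteq> 0 \<and> bumps \<xi> (z + t) \<noteq> 0} \<subseteq> T" if z: "z \<notin> K2" for z
  proof -
    obtain S where S: "finite S" "\<And>\<tau> \<tau>'. \<tau> \<in> grid_indices \<Longrightarrow> \<tau>' \<in> grid_indices \<Longrightarrow>
        - p \<tau> + z + p \<tau>' \<in> K2 \<Longrightarrow> p \<tau> \<in> S \<or> p \<tau>' \<in> S" using scattered_left[OF z] by metis
    let ?T = "(S + K) \<union> ({- z} + (S + K))"
    have SK: "compact (S + K)" by (rule compact_set_plus[OF finite_imp_compact[OF S(1)] compact_K])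
    have c: "compact ?T" by (rule compact_Un[OF SK compact_set_plus[OF _ SK]]) simp
    have m: "t \<in> ?T" if t: "bumps \<xi> t \<noteq> 0" "bumps \<xi> (z + t) \<noteq> 0" for t
    proof -
      let ?\<tau> = "nearest (z + t)" and ?\<tau>' = "nearest t"
      have "- p ?\<tau> + z + p ?\<tau>' = (- p ?\<tau> + (z + t)) + - (- p ?\<tau>' + t)"
        by (simp add: minus_add add.assoc)
      also have "\<dots> \<in> K2" by (intro set_plus_intro uminus_K bumps_nonzero(2)[OF t(1)] bumps_nonzero(2)[OF t(2)])
      finally have "p ?\<tau> \<in> S \<or> p ?\<tau>' \<in> S" by (rule S(2)[OF bumps_nonzero(1)[OF t(2)] bumps_nonzero(1)[OF t(1)]])
      then show ?thesis
      proof
        assume "p ?\<tau> \<in> S"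
        then have "z + t \<in> S + K" by (rule near[OF t(2)])
        then show ?thesis by (simp add: mem_translate_iff)
      qed (use near[OF t(1)] in blast)
    qed
    show ?thesis by (rule exI[of _ ?T], rule conjI[OF c], rule subsetI, elim CollectE conjE, rule m)
  qed
  have right: "\<exists>T. compact T \<and> {t. bumps \<xi> t \<noteq> 0 \<and> bumps \<xi> (t + z) \<noteq> 0} \<subseteq> T" if z: "z \<notin> K2" for z
  proof -
    obtain S where S: "finite S" "\<And>\<tau> \<tau>'. \<tau> \<in> grid_indices \<Longrightarrow> \<tau>' \<in> grid_indices \<Longrightarrow>
        - p \<tau>' + p \<tau> + z \<in> K2 \<Longrightarrow> p \<tau> \<in> S \<or> p \<tau>' \<in> S" using scattered_right[OF z] by metis
    let ?T = "(S + K) \<union> ((S + K) + {- z})"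
    have SK: "compact (S + K)" by (rule compact_set_plus[OF finite_imp_compact[OF S(1)] compact_K])
    have c: "compact ?T" by (rule compact_Un[OF SK compact_set_plus[OF SK]]) simp
    have m: "t \<in> ?T" if t: "bumps \<xi> t \<noteq> 0" "bumps \<xi> (t + z) \<noteq> 0" for t
    proof -
      let ?\<tau> = "nearest t" and ?\<tau>' = "nearest (t + z)"
      have "- p ?\<tau>' + p ?\<tau> + z = (- p ?\<tau>' + (t + z)) + - (- z + (- p ?\<tau> + t) + z)"
        by (simp add: minus_add add.assoc diff_conv_add_uminus del: add_uminus_conv_diff)
      also have "\<dots> \<in> K2"
        by (intro set_plus_intro uminus_K conj_invariantD(2)[OF conj_K]
            bumps_nonzero(2)[OF t(1)] bumps_nonzero(2)[OF t(2)])
      finally have "p ?\<tau> \<in> S \<or> p ?\<tau>' \<in> S" by (rule S(2)[OF bumps_nonzero(1)[OF t(1)] bumps_nonzero(1)[OF t(2)]])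
      then show ?thesis
      proof
        assume "p ?\<tau>' \<in> S"
        then have "t + z \<in> S + K" by (rule near[OF t(2)])
        from set_plus_intro[OF this singletonI] have "t + z + - z \<in> (S + K) + {- z}" .
        then have "t \<in> (S + K) + {- z}" by simp
        then show ?thesis by (rule UnI2)
      qed (use near[OF t(1)] in blast)
    qed
    show ?thesis by (rule exI[of _ ?T], rule conjI[OF c], rule subsetI, elim CollectE conjE, rule m)
  qed
  show ?thesis
    by (rule WAP_if_almost_disjoint_translates[of "Bumps \<xi>" K2, unfolded apply_Bumps[OF \<xi>],
          OF bumps_uniformly_continuous[OF \<xi>] cK2 left right])
qed

lemma linf_add: "\<xi> \<in> linf I \<Longrightarrow> \<eta> \<in> linf I \<Longrightarrow> (\<lambda>i. \<xi> i + \<eta> i) \<in> linf I"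
  unfolding linf_def by (auto intro: bounded_plus_comp)

lemma linf_scale: "\<xi> \<in> linf I \<Longrightarrow> (\<lambda>i. c * \<xi> i) \<in> linf I"
  unfolding linf_def
  using bounded_linear_image[OF _ bounded_linear_mult_right[of c], of "\<xi> ` I"] by (auto simp: image_image)

lemma Bumps_add:
  assumes "\<xi> \<in> linf I" "\<eta> \<in> linf I"
  shows "Bumps (\<lambda>i. \<xi> i + \<eta> i) = Bumps \<xi> + Bumps \<eta>"
  by (rule bcontfun_eqI)
     (simp add: apply_Bumps assms linf_add plus_bcontfun.rep_eq bumps_def coefficient_def algebra_simps)

lemma Bumps_scale:
  assumes "\<xi> \<in> linf I"
  shows "Bumps (\<lambda>i. c * \<xi> i) = cscale c (Bumps \<xi>)"
  by (rule bcontfun_eqI)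
     (simp add: apply_Bumps assms linf_scale cscale.rep_eq bumps_def coefficient_def)

lemma coset_norm_Bumps:
  assumes \<xi>: "\<xi> \<in> linf I"
  shows "coset_norm (Bumps \<xi> +o Eberlein) = linf_norm I \<xi>"
proof (rule antisym)
  have mem: "Bumps \<xi> \<in> Bumps \<xi> +o Eberlein" using Eberlein_subspace(1) unfolding elt_set_plus_def by force
  have "coset_norm (Bumps \<xi> +o Eberlein) \<le> norm (Bumps \<xi>)"
    unfolding coset_norm_def by (rule cINF_lower[OF _ mem]) (auto intro!: bdd_belowI[of _ 0])
  also have "\<dots> \<le> linf_norm I \<xi>"
    by (rule norm_bound) (simp add: apply_Bumps[OF \<xi>] cmod_bumps_le[OF \<xi>])
  finally show "coset_norm (Bumps \<xi> +o Eberlein) \<le> linf_norm I \<xi>" .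
  have I0: "I \<noteq> {}" using inf by auto
  have lower: "cmod (\<xi> i) \<le> norm (Bumps \<xi> + w)" if i: "i \<in> I" and w: "w \<in> Eberlein" for i w
  proof (rule norm_ge_of_fourier_values[OF _ w])
    show "apply_bcontfun (Bumps \<xi>) (y (i, n) l + x (i, n) k) = \<xi> i * cnj (fourier n k l)"
      if "k < n" "l < n" for n k l
    proof -
      let ?\<tau> = "((i, n), k, l)"
      have \<tau>: "?\<tau> \<in> grid_indices" using i that by (simp add: grid_indices_def)
      have "nearest (p ?\<tau>) = ?\<tau>" by (rule nearest_eq[OF \<tau>]) (simp add: zero_K)
      then show ?thesis using \<tau> by (simp add: apply_Bumps[OF \<xi>] bumps_def p[symmetric] coefficient_def h0)
    qed
  qed
  show "linf_norm I \<xi> \<le> coset_norm (Bumps \<xi> +o Eberlein)"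
    unfolding coset_norm_def
  proof (rule cINF_greatest)
    show "Bumps \<xi> +o Eberlein \<noteq> {}" using mem by blast
    fix f assume "f \<in> Bumps \<xi> +o Eberlein"
    then obtain w where "w \<in> Eberlein" "f = Bumps \<xi> + w" by (auto simp: elt_set_plus_def)
    then show "linf_norm I \<xi> \<le> norm f"
      unfolding linf_norm_def using lower by (intro cSUP_least[OF I0]) simp
  qed
qed

lemma linear_isometry_Bumps:
  "linear_isometry_linf_quotient I (WAP :: ('a \<Rightarrow>\<^sub>C complex) set) Eberlein (\<lambda>\<xi>. Bumps \<xi> +o Eberlein)"
  unfolding linear_isometry_linf_quotient_def
proof (intro conjI ballI allI)
  show "Bumps \<xi> +o Eberlein \<in> CB_quotient WAP Eberlein" if "\<xi> \<in> linf I" for \<xi>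
    unfolding CB_quotient_def using Bumps_WAP[OF that] by blast
qed (simp_all add: Bumps_add Bumps_scale Eberlein_coset_add Eberlein_coset_scale coset_norm_Bumps)

end

lemma few_translates_not_covering_compact_covering_number:
  fixes K :: "'a::{topological_group_add, t2_space} set"
  assumes K: "invariant_compact_nbhd K" and not_compact: "\<not> compact (UNIV :: 'a set)"
  shows "few_translates_not_covering K (Field (compact_covering_number :: 'a set rel))"
proof -
  define \<K> where "\<K> = (SOME \<K> :: 'a set set. least_compact_cover \<K>)"
  have least: "least_compact_cover \<K>"
    unfolding \<K>_def by (rule someI_ex[OF ex_least_compact_cover])
  have Field: "Field (compact_covering_number :: 'a set rel) = \<K>"
    unfolding compact_covering_number_def \<K>_def by (rule Field_card_of)
  have "infinite \<K>"
  proof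
    assume "finite \<K>"
    moreover have "\<forall>C\<in>\<K>. compact C" "\<Union>\<K> = UNIV"
      using least unfolding least_compact_cover_def compact_cover_def by blast+
    ultimately have "compact (UNIV :: 'a set)" using compact_Union[of \<K>] by simp
    with not_compact show False ..
  qed
  moreover have "A + K \<noteq> UNIV" if A: "few \<K> A" for A :: "'a set"
  proof
    assume AK: "A + K = UNIV"
    let ?\<L> = "(\<lambda>a. {a} + K) ` A"
    have "compact K" using K by (simp add: invariant_compact_nbhd_def)
    then have "\<forall>C\<in>?\<L>. compact C" by (intro ballI) (auto intro: compact_set_plus)
    moreover have "\<Union>?\<L> = A + K" by (auto simp: set_plus_def)
    ultimately have "compact_cover ?\<L>" unfolding compact_cover_def using AK by simp
    then have "|\<K>| \<le>o |?\<L>|" using least unfolding least_compact_cover_def by blast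
    moreover have "|?\<L>| <o |\<K>|" using few_image[OF A] by (simp add: few_def)
    ultimately show False using not_ordLess_ordLeq by blast
  qed
  ultimately show ?thesis unfolding Field by unfold_locales (use K in auto)
qed

theorem theorem5p6:
  assumes "locally_compact_space (euclidean :: 'a::{topological_group_add, t2_space} topology)"
    and "\<not> compact (UNIV :: 'a set)"
    and "IN_group TYPE('a)"
  shows "\<exists>\<Psi>. linear_isometry_linf_quotient
           (Field (compact_covering_number :: 'a set rel))
           (WAP :: ('a \<Rightarrow>\<^sub>C complex) set) Eberlein \<Psi>"
proof -
  let ?I = "Field (compact_covering_number :: 'a set rel)"
  obtain h :: "'a \<Rightarrow> real" and K where h: "invariant_compact_nbhd K"
    "h 0 = 1" "\<And>t. 0 \<le> h t" "\<And>t. h t \<le> 1" "\<And>t. t \<notin> K \<Longrightarrow> h t = 0"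
    "\<And>\<epsilon>. \<epsilon> > 0 \<Longrightarrow> \<exists>N. open N \<and> 0 \<in> N \<and> (\<forall>v\<in>N. \<forall>g t. \<bar>h (g + v - g + t) - h t\<bar> \<le> \<epsilon>)"
    using IN_group_central_bump[OF assms(3)] by metis
  interpret few_translates_not_covering K ?I
    using h(1) assms(2) by (rule few_translates_not_covering_compact_covering_number)
  obtain x y :: "'a set \<times> nat \<Rightarrow> nat \<Rightarrow> 'a" and p where "scattered_bumps K ?I h x y p"
  proof (rule ex_scattered_points)
    fix x y :: "'a set \<times> nat \<Rightarrow> nat \<Rightarrow> 'a" and p
    assume p: "\<And>\<alpha> k l. p (\<alpha>, k, l) = y \<alpha> l + x \<alpha> k" "scattered p"
    have "scattered_bumps K ?I h x y p"
      by (rule scattered_bumps.intro[OF few_translates_not_covering_axioms scattered_bumps_axioms.intro[OF h(2-6) p]])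
    then show thesis by (rule that)
  qed
  from scattered_bumps.linear_isometry_Bumps[OF this] show ?thesis
    by (rule exI[of "linear_isometry_linf_quotient ?I WAP Eberlein"])
qed

end
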